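(* Let $F$ be the cyclic quartic field defined by $a,b,c,d$ and let $p$ be an odd prime. Then: (i) $p$ is totally ramified in $F$ if and only if $p\mid d$. (ii) $p\mathcal{O}_F=P^2$ with $P$ the unique prime ideal of $\mathcal{O}_F$ above $p$ if and only if $p\mid a$ and $d$ is a quadratic non-residue modulo $p$. (iii) $p\mathcal{O}_F=P_1^2P_2^2$, where $P_1,P_2$ are exactly the two distinct prime ideals of $\mathcal{O}_F$ above $p$, if and only if $p\mid a$ and $d$ is a quadratic residue modulo $p$. (iv) $p$ is inert in $F$ if and only if $p\nmid abcd$ and $d$ is a quadratic non-residue modulo $p$. (v) $p$ splits totally in $F$ if and only if one of the following holds: - $p\mid b$ and $a$ is a quadratic residue modulo $p$; - $p\mid c$ and $2a$ is a quadratic residue modulo $p$; - $p\nmid abcd$, $d$ is a quadratic residue modulo $p$, and, if $d\equiv z^2\pmod p$, then $ad+abz$ and $ad-abz$ are also quadratic residues modulo $p$. (vi) In all remaining cases, $p\mathcal{O}_F$ is the product of two distinct prime ideals.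
   Context: Cyclic quartic fields: $a,b,c,d$ are integers with $a$ squarefree and odd, $d=b^2+c^2$ squarefree, $b>0$, $c>0$, $\gcd(a,d)=1$; $\beta=\sqrt{a(d-b\sqrt d)}$ and $F=\mathbb{Q}(\beta)$, a cyclic quartic field with defining polynomial $x^4-2adx^2+a^2c^2d$ and ring of integers $\mathcal{O}_F$. Quadratic residues and non-residues modulo $p$ are understood to be nonzero modulo $p$. *)

theory Defs
  imports
    "HOL-Algebra.Algebra"
    "HOL-Algebra.Algebraic_Closure_Type"
    "HOL-Number_Theory.Residues"
    "HOL-Computational_Algebra.Squarefree"
begin

text \<open>
  Number fields are subfields \<open>K\<close> of the complex numbers, represented by their carrier sets;
  \<open>\<rat>\<close> is the subset of rational complex numbers.
\<close>

abbreviation complex_field :: "complex ring" where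
  "complex_field \<equiv> ring_of_type_algebra"

definition adjoin :: "complex \<Rightarrow> complex set" where
  "adjoin x = generate_field complex_field (insert x \<rat>)"

definition field_degree :: "complex set \<Rightarrow> nat" where
  "field_degree K = ring.dim complex_field \<rat> K"

definition ring_of_integers :: "complex set \<Rightarrow> complex ring" where
  "ring_of_integers K = complex_field\<lparr>carrier := {x \<in> K. algebraic_int x}\<rparr>"

text \<open>
  The ideal \<open>p \<O>\<^sub>K\<close>, and the prime ideals of \<open>\<O>\<^sub>K\<close> above \<open>p\<close>, i.e. those whose contraction
  to \<open>\<int>\<close> is \<open>p\<int>\<close>. Products and powers of ideals are taken in the monoid
  \<open>ideals_set (ring_of_integers K)\<close>.
\<close>

definition ext_ideal :: "complex set \<Rightarrow> nat \<Rightarrow> complex set" where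
  "ext_ideal K p = PIdl\<^bsub>ring_of_integers K\<^esub> (of_nat p)"

definition primes_above :: "complex set \<Rightarrow> nat \<Rightarrow> complex set set" where
  "primes_above K p =
     {P. primeideal P (ring_of_integers K) \<and> P \<inter> \<int> = range (\<lambda>k::int. of_int (int p * k))}"

definition totally_ramified :: "complex set \<Rightarrow> nat \<Rightarrow> bool" where
  "totally_ramified K p \<longleftrightarrow>
     (\<exists>P. primeideal P (ring_of_integers K) \<and>
          ext_ideal K p = P [^]\<^bsub>ideals_set (ring_of_integers K)\<^esub> field_degree K)"

definition inert :: "complex set \<Rightarrow> nat \<Rightarrow> bool" where
  "inert K p \<longleftrightarrow> primeideal (ext_ideal K p) (ring_of_integers K)"

definition splits_totally :: "complex set \<Rightarrow> nat \<Rightarrow> bool" where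
  "splits_totally K p \<longleftrightarrow>
     (\<exists>S. finite S \<and> card S = field_degree K \<and>
          (\<forall>P\<in>S. primeideal P (ring_of_integers K)) \<and>
          ext_ideal K p = (\<Otimes>\<^bsub>ideals_set (ring_of_integers K)\<^esub>P\<in>S. P))"

text \<open>
  \<^const>\<open>QuadRes\<close> holds for multiples of \<open>p\<close>; here residues and non-residues are
  nonzero modulo \<open>p\<close>.
\<close>

definition quad_residue :: "nat \<Rightarrow> int \<Rightarrow> bool" where
  "quad_residue p x \<longleftrightarrow> \<not> int p dvd x \<and> QuadRes (int p) x"

definition quad_nonresidue :: "nat \<Rightarrow> int \<Rightarrow> bool" where
  "quad_nonresidue p x \<longleftrightarrow> \<not> int p dvd x \<and> \<not> QuadRes (int p) x"

text \<open>
  The field \<open>\<rat>(\<beta>)\<close> with \<open>\<beta> = \<surd>(a (d - b \<surd>d))\<close>. The radicand is a real number with the sign of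
  \<open>a\<close>, so for \<open>a < 0\<close> the root is purely imaginary. The parameter \<open>c\<close> enters only through
  \<open>d = b\<^sup>2 + c\<^sup>2\<close>.
\<close>

definition cyclic_quartic_field :: "int \<Rightarrow> int \<Rightarrow> int \<Rightarrow> complex set" where
  "cyclic_quartic_field a b d =
     adjoin (csqrt (complex_of_real
       (real_of_int a * (real_of_int d - real_of_int b * sqrt (real_of_int d)))))"

end

theory Submission
  imports Defs "Jordan_Normal_Form.Char_Poly"
begin

text \<open>
  Write \<open>\<delta> = \<surd>d\<close> and \<open>\<gamma> = \<beta> (\<delta> + b) / c\<close>. The elements \<open>1, \<delta>, \<beta>, \<gamma>\<close> form a basis of the
  field, and their integer span is a ring, because \<open>\<delta>\<^sup>2 = d\<close>, \<open>\<beta>\<^sup>2 = a d - a b \<delta>\<close>,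
  \<open>\<gamma>\<^sup>2 = a d + a b \<delta>\<close>, \<open>\<beta> \<gamma> = a c \<delta>\<close>, \<open>\<delta> \<beta> = c \<gamma> - b \<beta>\<close> and \<open>\<delta> \<gamma> = c \<beta> + b \<gamma>\<close>. Traces
  and the squarefreeness of \<open>a d\<close> show that this ring contains \<open>4 \<O>\<close>
  (\<open>four_times_coordinates_in_Ints\<close>). For odd \<open>p\<close> the residue ring \<open>\<O> / p \<O>\<close> is therefore the
  four-dimensional algebra over \<open>\<int> / p\<close> with the same multiplication table, and all primes above
  \<open>p\<close> can be read off from it.

  In this algebra \<open>\<delta>\<close> is a square root of \<open>d\<close>, and \<open>\<beta>\<close> and \<open>\<gamma>\<close> are square roots of
  \<open>a d \<mp> a b \<delta>\<close>. If \<open>p\<close> divides \<open>d\<close>, everything except the constants is nilpotent, and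
  \<open>\<beta>\<close> is a root of an Eisenstein polynomial (\<open>split_type_1_4\<close>). If \<open>p\<close> divides \<open>a\<close>, then \<open>p\<close>, \<open>\<beta>\<close>
  and \<open>\<gamma>\<close> generate an ideal with square \<open>p \<O>\<close>, modulo which only \<open>\<int> / p\<close> with \<open>\<surd>d\<close> is left: a field or a
  product of two fields, as \<open>d\<close> is a non-residue or a residue (\<open>split_type_1_2\<close>, \<open>split_type_2_2\<close>). If
  \<open>p\<close> does not divide \<open>a\<close> and \<open>d\<close> is a non-residue, the norm form of the basis has no nontrivial zero
  modulo \<open>p\<close> and \<open>p\<close> is inert (\<open>split_type_inert\<close>). If finally \<open>p\<close> divides neither \<open>a\<close> nor
  \<open>d\<close> and \<open>d = r\<^sup>2\<close> modulo \<open>p\<close>, each of the choices \<open>\<delta> \<mapsto> \<plusminus> r\<close> leaves a quadratic algebra over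
  \<open>\<int> / p\<close>, generated by a square root of a number \<open>n\<close> that can be computed: it is \<open>a d \<mp> a b r\<close> if \<open>p\<close>
  does not divide \<open>c\<close> and \<open>2 a b\<^sup>2\<close> if it does. The two choices give residues or non-residues
  together, so there are four primes or two (\<open>split_type_4_1\<close>, \<open>split_type_2_1\<close>).

  It remains to see that these decompositions exclude each other, so that each of them characterizes
  its case. As \<open>\<O> / p \<O>\<close> is finite, primes above \<open>p\<close> are maximal. Hence the set of primes above \<open>p\<close> is
  determined by any one decomposition, and the exponent \<open>e\<close> in \<open>p \<O> = N\<^sup>e\<close>, with \<open>N\<close> the
  intersection of these primes, is determined because the ideals \<open>p\<^sup>k \<O>\<close> are distinct
  (\<open>split_type_unique\<close>).

  That the algebraic integers form a ring is proved first, by characteristic polynomials of integer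
  matrices.
\<close>

section \<open>Algebraic integers form a ring\<close>

text \<open>
  Multiplication by \<open>z\<close> maps the integer span of the family \<open>v\<close> into itself. A finite nonzero
  family of this kind certifies that \<open>z\<close> is integral, and, unlike monic polynomials, certificates
  for two numbers over the same family combine at once to certificates for sum and product.
\<close>

definition integer_action :: "complex \<Rightarrow> 'i set \<Rightarrow> ('i \<Rightarrow> complex) \<Rightarrow> bool" where
  "integer_action z I v \<longleftrightarrow>
     (\<exists>M :: 'i \<Rightarrow> 'i \<Rightarrow> int. \<forall>i\<in>I. z * v i = (\<Sum>j\<in>I. of_int (M i j) * v j))"

text \<open>
  Read as a matrix, the coefficients have \<open>v\<close> as an eigenvector for \<open>z\<close>. So \<open>z\<close> is a root of
  the characteristic polynomial, which is monic with integer coefficients.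
\<close>

lemma algebraic_int_if_integer_action:
  assumes "finite I" and i0: "i0 \<in> I" "v i0 \<noteq> 0" and "integer_action z I v"
  shows "algebraic_int z"
proof -
  obtain M :: "'a \<Rightarrow> 'a \<Rightarrow> int"
    where M: "\<And>i. i \<in> I \<Longrightarrow> z * v i = (\<Sum>j\<in>I. of_int (M i j) * v j)"
    using assms unfolding integer_action_def by blast
  define n where "n = card I"
  obtain f where f: "bij_betw f {0..<n} I"
    unfolding n_def using ex_bij_betw_nat_finite[OF \<open>finite I\<close>] by blast
  define B where "B = mat n n (\<lambda>(i, j). M (f i) (f j))"
  define w where "w = vec n (\<lambda>i. v (f i))"
  have B: "B \<in> carrier_mat n n" and Bc: "map_mat of_int B \<in> carrier_mat n n"
    by (auto simp: B_def)
  obtain k where k: "k < n" "f k = i0"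
    using f i0(1) by (metis atLeastLessThan_iff bij_betw_iff_bijections)
  have "map_mat of_int B *\<^sub>v w = z \<cdot>\<^sub>v w"
  proof (rule eq_vecI)
    fix i assume "i < dim_vec (z \<cdot>\<^sub>v w)"
    hence i: "i < n" by (simp add: w_def)
    hence fi: "f i \<in> I" using f by (auto simp: bij_betw_def)
    have "(map_mat of_int B *\<^sub>v w) $ i = (\<Sum>j = 0..<n. of_int (M (f i) (f j)) * v (f j))"
      using i by (auto simp: B_def w_def scalar_prod_def intro!: sum.cong)
    also have "\<dots> = (\<Sum>j\<in>I. of_int (M (f i) j) * v j)"
      by (rule sum.reindex_bij_betw[OF f])
    also have "\<dots> = (z \<cdot>\<^sub>v w) $ i" using M[OF fi] i by (simp add: w_def)
    finally show "(map_mat of_int B *\<^sub>v w) $ i = (z \<cdot>\<^sub>v w) $ i" .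
  qed (auto simp: B_def w_def)
  moreover have "w \<noteq> 0\<^sub>v n"
  proof
    assume "w = 0\<^sub>v n"
    hence "w $ k = 0" using k by simp
    thus False using k i0 by (simp add: w_def)
  qed
  ultimately have "eigenvalue (map_mat of_int B) z"
    unfolding eigenvalue_def eigenvector_def using Bc by (intro exI[of _ w]) (auto simp: w_def)
  hence "poly (map_poly of_int (char_poly B)) z = 0"
    using eigenvalue_root_char_poly[OF Bc] of_int_hom.char_poly_hom[OF B] by metis
  moreover have "lead_coeff (char_poly B) = 1"
    using degree_monic_char_poly[OF B] by simp
  ultimately show ?thesis unfolding algebraic_int_altdef_ipoly by blast
qed

lemma integer_action_add:
  assumes "integer_action x I v" "integer_action y I v"
  shows "integer_action (x + y) I v"
proof -
  obtain M N :: "'a \<Rightarrow> 'a \<Rightarrow> int"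
    where "\<And>i. i \<in> I \<Longrightarrow> x * v i = (\<Sum>j\<in>I. of_int (M i j) * v j)"
      and "\<And>i. i \<in> I \<Longrightarrow> y * v i = (\<Sum>j\<in>I. of_int (N i j) * v j)"
    using assms unfolding integer_action_def by metis
  thus ?thesis unfolding integer_action_def
    by (intro exI[of _ "\<lambda>i j. M i j + N i j"]) (simp add: distrib_right sum.distrib)
qed

lemma integer_action_mult:
  assumes "integer_action x I v" "integer_action y I v"
  shows "integer_action (x * y) I v"
proof -
  obtain M N :: "'a \<Rightarrow> 'a \<Rightarrow> int"
    where M: "\<And>i. i \<in> I \<Longrightarrow> x * v i = (\<Sum>j\<in>I. of_int (M i j) * v j)"
      and N: "\<And>i. i \<in> I \<Longrightarrow> y * v i = (\<Sum>j\<in>I. of_int (N i j) * v j)"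
    using assms unfolding integer_action_def by metis
  have "x * y * v i = (\<Sum>k\<in>I. of_int (\<Sum>j\<in>I. N i j * M j k) * v k)" if "i \<in> I" for i
  proof -
    have "x * y * v i = (\<Sum>j\<in>I. of_int (N i j) * (x * v j))"
      using N[OF that] by (simp add: sum_distrib_left mult_ac)
    also have "\<dots> = (\<Sum>j\<in>I. \<Sum>k\<in>I. of_int (N i j) * (of_int (M j k) * v k))"
      by (intro sum.cong refl) (simp add: M sum_distrib_left)
    also have "\<dots> = (\<Sum>k\<in>I. \<Sum>j\<in>I. of_int (N i j) * (of_int (M j k) * v k))"
      by (rule sum.swap)
    finally show ?thesis by (simp add: sum_distrib_right mult.assoc)
  qed
  thus ?thesis unfolding integer_action_def
    by (intro exI[of _ "\<lambda>i k. \<Sum>j\<in>I. N i j * M j k"]) blast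
qed

lemma algebraic_int_power_eq_sum:
  fixes x :: complex
  assumes "algebraic_int x"
  obtains m and c :: "nat \<Rightarrow> int"
  where "m > 0" "x ^ m = (\<Sum>i<m. of_int (c i) * x ^ i)"
proof -
  obtain p :: "int poly" where p: "poly (map_poly of_int p) x = 0" "lead_coeff p = 1"
    using assms unfolding algebraic_int_altdef_ipoly by blast
  define m where "m = degree p"
  have "(\<Sum>i\<le>m. of_int (coeff p i) * x ^ i) = 0"
    using p(1) by (simp add: poly_altdef m_def)
  hence *: "x ^ m + (\<Sum>i<m. of_int (coeff p i) * x ^ i) = 0"
    using p(2) by (simp add: lessThan_Suc_atMost[symmetric] m_def) (simp only: add.commute)
  have "m > 0" using * by (cases m) auto
  moreover have "x ^ m = (\<Sum>i<m. of_int (- coeff p i) * x ^ i)"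
    using * by (simp only: of_int_minus mult_minus_left sum_negf eq_neg_iff_add_eq_0)
  ultimately show ?thesis by (rule that)
qed

text \<open>
  A monic relation of degree \<open>m\<close> for \<open>x\<close> makes the span of \<open>x\<^sup>i u\<^sub>j\<close>, \<open>i < m\<close>, stable under \<open>x\<close>. The
  factors \<open>u\<^sub>j\<close> are carried along so that the powers of a second number can be taken for them.
\<close>

lemma integer_action_powers:
  fixes u :: "'b \<Rightarrow> complex"
  assumes "finite J" and x: "x ^ m = (\<Sum>i<m. of_int (c i) * x ^ i)"
  shows "integer_action x ({..<m} \<times> J) (\<lambda>(i, j). x ^ i * u j)"
  unfolding integer_action_def
proof (intro exI ballI)
  (* one copy of the companion matrix for each j *)
  define M :: "nat \<times> 'b \<Rightarrow> nat \<times> 'b \<Rightarrow> int" where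
    "M = (\<lambda>(i, j) (k, l). if l = j then if Suc i < m then if k = Suc i then 1 else 0 else c k else 0)"
  fix ij assume ij: "ij \<in> {..<m} \<times> J"
  obtain i j where [simp]: "ij = (i, j)" by force
  have "i < m" "j \<in> J" using ij by auto
  have "(\<Sum>kl\<in>{..<m} \<times> J. of_int (M ij kl) * (case kl of (k, l) \<Rightarrow> x ^ k * u l))
      = (\<Sum>k<m. \<Sum>l\<in>J. of_int (M ij (k, l)) * (x ^ k * u l))"
    by (simp add: sum.cartesian_product split_def)
  also have "\<dots> = (\<Sum>k<m. (if Suc i < m then if k = Suc i then 1 else 0 else of_int (c k)) * x ^ k * u j)"
  proof (intro sum.cong refl)
    fix k
    have "(\<Sum>l\<in>J. of_int (M ij (k, l)) * (x ^ k * u l))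
        = (\<Sum>l\<in>J. if l = j then (if Suc i < m then if k = Suc i then 1 else 0 else of_int (c k)) * x ^ k * u l else 0)"
      by (intro sum.cong) (auto simp: M_def)
    thus "(\<Sum>l\<in>J. of_int (M ij (k, l)) * (x ^ k * u l))
        = (if Suc i < m then if k = Suc i then 1 else 0 else of_int (c k)) * x ^ k * u j"
      using \<open>finite J\<close> \<open>j \<in> J\<close> by (simp add: sum.delta)
  qed
  also have "\<dots> = x * (x ^ i * u j)"
  proof (cases "Suc i < m")
    case True
    have "(\<Sum>k<m. (if k = Suc i then 1 else 0) * x ^ k * u j)
        = (\<Sum>k<m. if k = Suc i then x ^ k * u j else 0)"
      by (intro sum.cong) auto
    with True show ?thesis by (simp add: sum.delta)
  next
    case False
    hence "m = Suc i" using \<open>i < m\<close> by simp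
    have "(\<Sum>k<m. of_int (c k) * x ^ k * u j) = x ^ m * u j"
      by (simp add: x sum_distrib_right)
    with False show ?thesis by (simp add: \<open>m = Suc i\<close>)
  qed
  finally show "x * (case ij of (i, j) \<Rightarrow> x ^ i * u j) =
      (\<Sum>kl\<in>{..<m} \<times> J. of_int (M ij kl) * (case kl of (k, l) \<Rightarrow> x ^ k * u l))"
    by simp
qed

text \<open>
  If \<open>x\<close> and \<open>y\<close> satisfy monic relations of degrees \<open>m\<close> and \<open>n\<close>, the products \<open>x\<^sup>i y\<^sup>j\<close> with
  \<open>i < m\<close> and \<open>j < n\<close> form a certificate for both numbers at the same time.
\<close>

lemma
  fixes x y :: complex
  assumes "algebraic_int x" "algebraic_int y"
  shows algebraic_int_add: "algebraic_int (x + y)"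
    and algebraic_int_mult: "algebraic_int (x * y)"
proof -
  obtain m c where m: "m > 0" "x ^ m = (\<Sum>i<m. of_int (c i :: int) * x ^ i)"
    using algebraic_int_power_eq_sum[OF assms(1)] .
  obtain n e where n: "n > 0" "y ^ n = (\<Sum>i<n. of_int (e i :: int) * y ^ i)"
    using algebraic_int_power_eq_sum[OF assms(2)] .
  define I where "I = {..<m} \<times> {..<n}"
  define v where "v = (\<lambda>(i, j). x ^ i * y ^ j)"
  have I: "finite I" "(0, 0) \<in> I" "v (0, 0) \<noteq> 0" using m n by (auto simp: I_def v_def)
  have x: "integer_action x I v"
    using integer_action_powers[OF _ m(2), of "{..<n}" "\<lambda>j. y ^ j"] by (simp add: I_def v_def)
  have "integer_action y ({..<n} \<times> {..<m}) (\<lambda>(i, j). y ^ i * x ^ j)"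
    using integer_action_powers[OF _ n(2), of "{..<m}" "\<lambda>j. x ^ j"] by simp
  then obtain M :: "nat \<times> nat \<Rightarrow> nat \<times> nat \<Rightarrow> int"
    where M: "\<And>i j. i < n \<Longrightarrow> j < m \<Longrightarrow> y * (y ^ i * x ^ j)
      = (\<Sum>kl\<in>{..<n} \<times> {..<m}. of_int (M (i, j) kl) * (case kl of (k, l) \<Rightarrow> y ^ k * x ^ l))"
    unfolding integer_action_def by fastforce
  have y: "integer_action y I v"
    unfolding integer_action_def
  proof (intro exI ballI)
    fix ij assume "ij \<in> I"
    then obtain i j where ij: "ij = (i, j)" "i < m" "j < n" by (auto simp: I_def)
    have "y * v ij = (\<Sum>kl\<in>{..<n} \<times> {..<m}. of_int (M (j, i) kl) * (case kl of (k, l) \<Rightarrow> y ^ k * x ^ l))"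
      using M[OF ij(3,2)] by (simp add: ij v_def mult_ac)
    also have "\<dots> = (\<Sum>kl\<in>I. of_int (M (prod.swap ij) (prod.swap kl)) * v kl)"
      unfolding I_def
      by (rule sum.reindex_bij_witness[of _ prod.swap prod.swap]) (auto simp: ij v_def)
    finally show "y * v ij = (\<Sum>kl\<in>I. of_int (M (prod.swap ij) (prod.swap kl)) * v kl)" .
  qed
  show "algebraic_int (x + y)" "algebraic_int (x * y)"
    by (intro algebraic_int_if_integer_action[where v = v, OF I] integer_action_add integer_action_mult x y)+
qed

lemma algebraic_int_diff: "algebraic_int (u :: complex) \<Longrightarrow> algebraic_int v \<Longrightarrow> algebraic_int (u - v)"
  using algebraic_int_add[of u "- v"] by simp

lemma algebraic_int_if_square_algebraic_int:
  "algebraic_int (u * u) \<Longrightarrow> algebraic_int (u :: complex)"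
  by (rule algebraic_int_root[of "u * u" "monom 1 2"])
     (auto simp: poly_monom degree_monom_eq power2_eq_square)

section \<open>Rational numbers, squarefree factors and integrality\<close>

lemma complex_field_simps [simp]:
  "carrier complex_field = UNIV" "x \<otimes>\<^bsub>complex_field\<^esub> y = x * y" "x \<oplus>\<^bsub>complex_field\<^esub> y = x + y"
  "\<one>\<^bsub>complex_field\<^esub> = 1" "\<zero>\<^bsub>complex_field\<^esub> = 0"
  by (simp_all add: ring_of_type_algebra_def)

lemma complex_field_minus [simp]: "\<ominus>\<^bsub>complex_field\<^esub> x = - x"
proof -
  interpret C: field complex_field by (rule field_from_type_algebra)
  show ?thesis by (rule C.minus_equality) auto
qed

lemma complex_field_inv [simp]: "x \<noteq> 0 \<Longrightarrow> inv\<^bsub>complex_field\<^esub> x = inverse x"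
proof -
  interpret C: field complex_field by (rule field_from_type_algebra)
  show "x \<noteq> 0 \<Longrightarrow> inv\<^bsub>complex_field\<^esub> x = inverse x" by (intro C.comm_inv_char) auto
qed

text \<open>
  This is how squarefreeness of \<open>a\<close> and \<open>d\<close> enters: if \<open>q = n / k\<close> in lowest terms, then \<open>k\<^sup>2\<close>
  divides \<open>m n\<^sup>2\<close> and hence \<open>m\<close>.
\<close>

lemma rat_in_Ints_if_squarefree_mult_square:
  fixes q :: rat
  assumes "squarefree m" and "of_int m * q\<^sup>2 \<in> \<int>"
  shows "q \<in> \<int>"
proof -
  obtain n k where nk: "quotient_of q = (n, k)" by force
  have q: "q = of_int n / of_int k" and k: "k > 0" and cop: "coprime n k"
    using quotient_of_div[OF nk] quotient_of_denom_pos[OF nk] quotient_of_coprime[OF nk] by auto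
  obtain r where "of_int m * q\<^sup>2 = of_int r" using assms(2) by (auto elim: Ints_cases)
  hence "(of_int (m * n\<^sup>2) :: rat) = of_int (r * k\<^sup>2)"
    using k by (simp add: q field_simps power2_eq_square)
  hence "m * n\<^sup>2 = r * k\<^sup>2" by (simp only: of_int_eq_iff)
  hence "k\<^sup>2 dvd m * n\<^sup>2" by simp
  moreover have "coprime (k\<^sup>2) (n\<^sup>2)" using cop by (simp add: coprime_commute)
  ultimately have "k\<^sup>2 dvd m" using coprime_dvd_mult_left_iff by blast
  hence "is_unit k" by (rule squarefreeD[OF assms(1)])
  hence "k = 1" using k by (simp add: zdvd1_eq)
  thus ?thesis by (simp add: q)
qed

lemma rat_in_Ints_if_algebraic_int:
  assumes "algebraic_int (of_rat q :: complex)"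
  shows "q \<in> \<int>"
proof -
  have "(of_rat q :: complex) \<in> \<int>"
    using assms by (intro rational_algebraic_int_is_int) auto
  then obtain k where "(of_rat q :: complex) = of_int k" by (auto elim: Ints_cases)
  hence "(of_rat q :: complex) = of_rat (of_int k)" by simp
  hence "q = of_int k" by (simp only: of_rat_eq_iff)
  thus ?thesis by simp
qed

section \<open>A basis of the cyclic quartic field\<close>

text \<open>
  Here \<open>\<delta> = \<surd>d\<close> and \<open>\<beta>\<close> is the generator of the field. The third parameter \<open>\<gamma>\<close> is, up to sign, a
  conjugate of \<open>\<beta>\<close>: it satisfies \<open>\<gamma>\<^sup>2 = a (d + b \<delta>)\<close> and \<open>\<beta> \<gamma> = a c \<delta>\<close>. With respect to the
  basis \<open>1, \<delta>, \<beta>, \<gamma>\<close> multiplication has integer structure constants, and the trace form is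
  diagonal, with entries \<open>4, 4d, 4ad, 4ad\<close>; this is why the basis is close to an integral basis.
\<close>

locale cyclic_quartic =
  fixes a b c d :: int and \<delta> \<beta> \<gamma> :: complex
  assumes squarefree_a: "squarefree a" and squarefree_d: "squarefree d"
    and d_eq: "d = b\<^sup>2 + c\<^sup>2" and b_pos: "b > 0" and c_pos: "c > 0"
    and coprime_a_d: "coprime a d"
    and \<delta>_square: "\<delta>\<^sup>2 = of_int d"
    and \<beta>_square: "\<beta>\<^sup>2 = of_int (a * d) - of_int (a * b) * \<delta>"
    and \<gamma>_eq: "of_int c * \<gamma> = \<beta> * (\<delta> + of_int b)"
begin

lemma a_nonzero: "a \<noteq> 0" and d_ge_2: "d \<ge> 2" and c_nonzero: "(of_int c :: complex) \<noteq> 0"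
proof -
  show "a \<noteq> 0" using squarefree_a by auto
  have "b\<^sup>2 \<ge> 1" "c\<^sup>2 \<ge> 1" using b_pos c_pos by (simp_all add: int_one_le_iff_zero_less)
  thus "d \<ge> 2" by (simp add: d_eq)
  show "(of_int c :: complex) \<noteq> 0" using c_pos by simp
qed

lemma d_eq_of_int: "(of_int d :: complex) = of_int b * of_int b + of_int c * of_int c"
  by (simp add: d_eq power2_eq_square)

lemma \<delta>\<delta>: "\<delta> * \<delta> = of_int d"
  using \<delta>_square by (simp add: power2_eq_square)

lemma \<beta>\<beta>: "\<beta> * \<beta> = of_int a * of_int d - of_int a * of_int b * \<delta>"
  using \<beta>_square by (simp add: power2_eq_square)

lemma \<delta>\<beta>: "\<delta> * \<beta> = of_int c * \<gamma> - of_int b * \<beta>"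
  using \<gamma>_eq by (simp add: algebra_simps)

lemma \<beta>\<gamma>: "\<beta> * \<gamma> = of_int a * of_int c * \<delta>"
proof -
  have "of_int c * (\<beta> * \<gamma>) = (\<beta> * \<beta>) * (\<delta> + of_int b)"
    using \<gamma>_eq by (metis mult.assoc mult.commute)
  also have "\<dots> = of_int a * ((of_int d - of_int b * of_int b) * \<delta>) + of_int a * of_int b * (of_int d - \<delta> * \<delta>)"
    by (simp add: \<beta>\<beta> algebra_simps)
  also have "\<dots> = of_int c * (of_int a * of_int c * \<delta>)"
    by (simp add: \<delta>\<delta> d_eq_of_int algebra_simps)
  finally show ?thesis using c_nonzero by simp
qed

lemma \<gamma>\<gamma>: "\<gamma> * \<gamma> = of_int a * of_int d + of_int a * of_int b * \<delta>"
proof -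
  have "of_int c * (\<gamma> * \<gamma>) = (\<beta> * \<gamma>) * (\<delta> + of_int b)"
    using \<gamma>_eq by (metis mult.assoc mult.commute)
  also have "\<dots> = of_int c * (of_int a * (\<delta> * \<delta>) + of_int a * of_int b * \<delta>)"
    by (simp add: \<beta>\<gamma> algebra_simps)
  finally show ?thesis using c_nonzero by (simp add: \<delta>\<delta>)
qed

lemma \<delta>\<gamma>: "\<delta> * \<gamma> = of_int c * \<beta> + of_int b * \<gamma>"
proof -
  have "of_int c * (\<delta> * \<gamma>) = \<delta> * (\<beta> * (\<delta> + of_int b))"
    using \<gamma>_eq by (metis mult.assoc mult.commute)
  also have "\<dots> = of_int d * \<beta> + of_int b * (\<delta> * \<beta>)"
    by (simp add: algebra_simps flip: \<delta>\<delta>)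
  also have "\<dots> = of_int c * (of_int c * \<beta> + of_int b * \<gamma>)"
    unfolding \<delta>\<beta> d_eq_of_int by (simp add: algebra_simps)
  finally show ?thesis using c_nonzero by simp
qed

definition el :: "rat \<Rightarrow> rat \<Rightarrow> rat \<Rightarrow> rat \<Rightarrow> complex" where
  "el x y z w = of_rat x + of_rat y * \<delta> + of_rat z * \<beta> + of_rat w * \<gamma>"

lemma el_rat: "el x 0 0 0 = of_rat x"
  and el_0: "el 0 0 0 0 = 0"
  and el_add: "el x y z w + el x' y' z' w' = el (x + x') (y + y') (z + z') (w + w')"
  and el_diff: "el x y z w - el x' y' z' w' = el (x - x') (y - y') (z - z') (w - w')"
  and el_minus: "- el x y z w = el (- x) (- y) (- z) (- w)"
  and el_scale: "of_rat q * el x y z w = el (q * x) (q * y) (q * z) (q * w)"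
  by (simp_all add: el_def of_rat_add of_rat_diff of_rat_minus of_rat_mult algebra_simps)

lemma el_mult:
  "el x y z w * el x' y' z' w' = el
     (x * x' + of_int d * (y * y') + of_int (a * d) * (z * z' + w * w'))
     (x * y' + y * x' + of_int (a * b) * (w * w' - z * z') + of_int (a * c) * (z * w' + w * z'))
     (x * z' + z * x' + of_int c * (y * w' + w * y') - of_int b * (y * z' + z * y'))
     (x * w' + w * x' + of_int c * (y * z' + z * y') + of_int b * (y * w' + w * y'))"
proof -
  obtain X0 Y Z W X0' Y' Z' W' :: complex
    where defs: "X0 = of_rat x" "Y = of_rat y" "Z = of_rat z" "W = of_rat w"
      "X0' = of_rat x'" "Y' = of_rat y'" "Z' = of_rat z'" "W' = of_rat w'"
    by blast
  have "el x y z w * el x' y' z' w' = (X0 + Y * \<delta> + Z * \<beta> + W * \<gamma>) * (X0' + Y' * \<delta> + Z' * \<beta> + W' * \<gamma>)"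
    by (simp add: el_def defs)
  also have "\<dots> = X0 * X0' + (X0 * Y' + Y * X0') * \<delta> + (X0 * Z' + Z * X0') * \<beta> + (X0 * W' + W * X0') * \<gamma>
     + (Y * Y') * (\<delta> * \<delta>) + (Z * Z') * (\<beta> * \<beta>) + (W * W') * (\<gamma> * \<gamma>)
     + (Y * Z' + Z * Y') * (\<delta> * \<beta>) + (Y * W' + W * Y') * (\<delta> * \<gamma>) + (Z * W' + W * Z') * (\<beta> * \<gamma>)"
    by (simp add: algebra_simps)
  also have "\<dots> = (X0 * X0' + of_int d * (Y * Y') + of_int (a * d) * (Z * Z' + W * W'))
    + (X0 * Y' + Y * X0' + of_int (a * b) * (W * W' - Z * Z') + of_int (a * c) * (Z * W' + W * Z')) * \<delta>
    + (X0 * Z' + Z * X0' + of_int c * (Y * W' + W * Y') - of_int b * (Y * Z' + Z * Y')) * \<beta>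
    + (X0 * W' + W * X0' + of_int c * (Y * Z' + Z * Y') + of_int b * (Y * W' + W * Y')) * \<gamma>"
    unfolding \<delta>\<delta> \<beta>\<beta> \<gamma>\<gamma> \<delta>\<beta> \<delta>\<gamma> \<beta>\<gamma> by (simp add: algebra_simps)
  finally show ?thesis by (simp add: el_def defs of_rat_add of_rat_diff of_rat_mult)
qed

text \<open>
  As \<open>d\<close> is squarefree and at least 2, it is not the square of a rational number.
\<close>

lemma rat_square_eq_d_mult_square:
  fixes x y :: rat
  assumes "x\<^sup>2 = of_int d * y\<^sup>2"
  shows "x = 0" "y = 0"
proof -
  show "y = 0"
  proof (rule ccontr)
    assume "y \<noteq> 0"
    hence sq: "(x / y)\<^sup>2 = of_int d" using assms by (simp add: field_simps)
    have "x / y \<in> \<int>"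
    proof (rule rat_in_Ints_if_squarefree_mult_square)
      show "squarefree (1 :: int)" by simp
      show "of_int 1 * (x / y)\<^sup>2 \<in> \<int>" unfolding sq by simp
    qed
    then obtain k where "x / y = of_int k" by (auto elim: Ints_cases)
    hence "(of_int (k\<^sup>2) :: rat) = of_int d" using sq by simp
    hence "k\<^sup>2 = d" by (simp only: of_int_eq_iff)
    moreover from this have "k\<^sup>2 dvd d" by simp
    hence "is_unit k" by (rule squarefreeD[OF squarefree_d])
    hence "k\<^sup>2 = 1\<^sup>2" by (simp only: power2_eq_iff) (simp add: zdvd1_eq abs_if split: if_splits)
    ultimately show False using d_ge_2 by simp
  qed
  thus "x = 0" using assms by simp
qed

lemma quadratic_part_eq_0:
  assumes "of_rat x + of_rat y * \<delta> = 0"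
  shows "x = 0" "y = 0"
proof -
  have "of_rat x = - (of_rat y * \<delta>)" using assms by (simp add: add_eq_0_iff)
  hence "(of_rat x)\<^sup>2 = (of_rat y * \<delta>)\<^sup>2" by simp
  hence "(of_rat (x\<^sup>2) :: complex) = of_rat (of_int d * y\<^sup>2)"
    by (simp add: power_mult_distrib \<delta>_square of_rat_mult of_rat_power mult.commute)
  hence "x\<^sup>2 = of_int d * y\<^sup>2" by (simp only: of_rat_eq_iff)
  thus "x = 0" "y = 0" by (rule rat_square_eq_d_mult_square)+
qed

text \<open>
  Linear independence of the basis. If \<open>x + y \<delta> = - (z \<beta> + w \<gamma>)\<close>, compare squares: the right-hand
  side gives \<open>a d S + a D \<delta>\<close> with \<open>S\<close> and \<open>D\<close> as below, and the identity \<open>d S\<^sup>2 - D\<^sup>2 = E\<^sup>2\<close>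
  turns the norm of this equation down to \<open>\<rat>\<close> into \<open>(x\<^sup>2 - d y\<^sup>2)\<^sup>2 = d (a E)\<^sup>2\<close>.
\<close>

lemma el_eq_0:
  assumes "el x y z w = 0"
  shows "x = 0" "y = 0" "z = 0" "w = 0"
proof -
  define S where "S = z\<^sup>2 + w\<^sup>2"
  define D where "D = of_int b * (w\<^sup>2 - z\<^sup>2) + 2 * of_int c * z * w"
  define E where "E = of_int c * (w\<^sup>2 - z\<^sup>2) - 2 * of_int b * z * w"
  have "el x y 0 0 + el 0 0 z w = 0" using assms by (simp add: el_add)
  hence "el x y 0 0 = - el 0 0 z w" by (simp add: add_eq_0_iff)
  hence "el x y 0 0 * el x y 0 0 - el 0 0 z w * el 0 0 z w = 0" by simp
  hence "el (x\<^sup>2 + of_int d * y\<^sup>2 - of_int (a * d) * S) (2 * x * y - of_int a * D) 0 0 = 0"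
    unfolding el_mult el_diff S_def D_def by (simp add: power2_eq_square algebra_simps)
  hence "of_rat (x\<^sup>2 + of_int d * y\<^sup>2 - of_int (a * d) * S) + of_rat (2 * x * y - of_int a * D) * \<delta> = 0"
    by (simp only: el_def of_rat_0 mult_zero_left add_0_right)
  from quadratic_part_eq_0[OF this] have *: "x\<^sup>2 + of_int d * y\<^sup>2 = of_int (a * d) * S" "2 * x * y = of_int a * D" by simp_all
  have dr: "(of_int d :: rat) = of_int b * of_int b + of_int c * of_int c"
    by (simp add: d_eq power2_eq_square)
  have SDE: "of_int d * S\<^sup>2 - D\<^sup>2 = E\<^sup>2"
    unfolding S_def D_def E_def dr by (simp add: power2_eq_square algebra_simps)
  have "(x\<^sup>2 - of_int d * y\<^sup>2)\<^sup>2 = (x\<^sup>2 + of_int d * y\<^sup>2)\<^sup>2 - of_int d * (2 * x * y)\<^sup>2"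
    by (simp add: power2_eq_square algebra_simps)
  also have "\<dots> = of_int d * (of_int a)\<^sup>2 * (of_int d * S\<^sup>2 - D\<^sup>2)"
    unfolding * by (simp add: algebra_simps power2_eq_square)
  also have "\<dots> = of_int d * (of_int a * E)\<^sup>2" by (simp add: SDE power_mult_distrib)
  finally have "x\<^sup>2 - of_int d * y\<^sup>2 = 0" by (rule rat_square_eq_d_mult_square)
  hence "x\<^sup>2 = of_int d * y\<^sup>2" by simp
  thus xy: "x = 0" "y = 0" by (rule rat_square_eq_d_mult_square)+
  (* S is a sum of two rational squares, so its vanishing settles z and w *)
  have "S = 0" using *(1) xy a_nonzero d_ge_2 by simp
  thus "z = 0" "w = 0" unfolding S_def by (simp_all add: sum_power2_eq_zero_iff)
qed

lemma el_eq_iff: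
  "el x y z w = el x' y' z' w' \<longleftrightarrow> x = x' \<and> y = y' \<and> z = z' \<and> w = w'"
proof
  assume "el x y z w = el x' y' z' w'"
  hence "el (x - x') (y - y') (z - z') (w - w') = 0" by (simp flip: el_diff)
  from el_eq_0[OF this] show "x = x' \<and> y = y' \<and> z = z' \<and> w = w'" by simp
qed simp

definition quartic_field :: "complex set" where
  "quartic_field = {el x y z w | x y z w. True}"

lemma el_in_quartic_field [simp, intro]: "el x y z w \<in> quartic_field"
  unfolding quartic_field_def by blast

lemma quartic_fieldE:
  assumes "s \<in> quartic_field"
  obtains x y z w where "s = el x y z w"
  using assms unfolding quartic_field_def by blast

text \<open>
  \<open>U + V \<delta>\<close> is the relative norm to the quadratic subfield, so \<open>U\<^sup>2 - d V\<^sup>2\<close> is the absolute norm;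
  its cofactor serves to invert elements, over \<open>\<rat>\<close> and later modulo a prime.
\<close>

lemma el_norm:
  fixes x y z w :: rat
  defines "U \<equiv> x\<^sup>2 + of_int d * y\<^sup>2 - of_int (a * d) * (z\<^sup>2 + w\<^sup>2)"
    and "V \<equiv> 2 * x * y - of_int a * (of_int b * (w\<^sup>2 - z\<^sup>2) + 2 * of_int c * z * w)"
  shows "el x y z w * (el x y (- z) (- w) * el U (- V) 0 0) = of_rat (U\<^sup>2 - of_int d * V\<^sup>2)"
    and "el x y z w \<noteq> 0 \<Longrightarrow> U\<^sup>2 - of_int d * V\<^sup>2 \<noteq> 0"
proof -
  have UV: "el x y z w * el x y (- z) (- w) = el U V 0 0"
    unfolding el_mult el_eq_iff U_def V_def by (simp add: power2_eq_square algebra_simps)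
  have N: "el U V 0 0 * el U (- V) 0 0 = of_rat (U\<^sup>2 - of_int d * V\<^sup>2)"
    unfolding el_mult by (simp add: el_rat power2_eq_square algebra_simps)
  show "el x y z w * (el x y (- z) (- w) * el U (- V) 0 0) = of_rat (U\<^sup>2 - of_int d * V\<^sup>2)"
    unfolding mult.assoc[symmetric] UV N ..
  show "U\<^sup>2 - of_int d * V\<^sup>2 \<noteq> 0" if nz: "el x y z w \<noteq> 0"
  proof
    assume "U\<^sup>2 - of_int d * V\<^sup>2 = 0"
    hence "U\<^sup>2 = of_int d * V\<^sup>2" by simp
    hence "U = 0" "V = 0" by (rule rat_square_eq_d_mult_square)+
    hence "el x y (- z) (- w) = 0" using UV nz by (simp add: el_0)
    from el_eq_0[OF this] have "x = 0" "y = 0" "z = 0" "w = 0" by simp_all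
    thus False using nz by (simp add: el_0)
  qed
qed

lemma quartic_field_closed:
  assumes "s \<in> quartic_field" "t \<in> quartic_field"
  shows "s + t \<in> quartic_field" "s * t \<in> quartic_field" "- s \<in> quartic_field" "s - t \<in> quartic_field"
  using assms by (auto elim!: quartic_fieldE simp: el_add el_mult el_minus el_diff)

lemma quartic_field_inverse:
  assumes "s \<in> quartic_field"
  shows "inverse s \<in> quartic_field"
proof (cases "s = 0")
  case True
  thus ?thesis using el_in_quartic_field[of 0 0 0 0] by (simp add: el_0)
next
  case False
  obtain x y z w where s: "s = el x y z w" using assms by (rule quartic_fieldE)
  obtain t N where N: "s * t = of_rat N" "N \<noteq> 0" "t \<in> quartic_field"
    using el_norm[of x y z w] False quartic_field_closed(2)[OF el_in_quartic_field el_in_quartic_field]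
    unfolding s by blast
  have "inverse s = of_rat (1 / N) * t"
    using N False by (simp add: field_simps of_rat_divide)
  moreover have "of_rat (1 / N) * t \<in> quartic_field"
    using N(3) by (auto elim!: quartic_fieldE simp: el_scale)
  ultimately show ?thesis by simp
qed

lemma of_rat_in_quartic_field [simp]: "of_rat q \<in> quartic_field"
  using el_in_quartic_field[of q 0 0 0] by (simp add: el_rat)

lemma of_int_in_quartic_field [simp]: "of_int q \<in> quartic_field"
  using of_rat_in_quartic_field[of "of_int q"] by (simp del: of_rat_in_quartic_field)

lemma adjoin_\<beta>_eq: "adjoin \<beta> = quartic_field"
proof
  interpret C: field complex_field by (rule field_from_type_algebra)
  show "adjoin \<beta> \<subseteq> quartic_field"
  proof
    fix s assume "s \<in> adjoin \<beta>"
    thus "s \<in> quartic_field" unfolding adjoin_def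
    proof (induction rule: generate_field.induct)
      case one
      thus ?case using of_int_in_quartic_field[of 1]
        by (simp del: of_int_in_quartic_field)
    next
      case (incl h)
      have "\<beta> = el 0 0 1 0" by (simp add: el_def)
      thus ?case using incl el_in_quartic_field[of 0 0 1 0] by (auto simp: Rats_def)
    qed (auto intro: quartic_field_closed quartic_field_inverse)
  qed
  have rat: "of_rat q \<in> adjoin \<beta>" for q
    unfolding adjoin_def by (rule generate_field.incl) (auto simp: Rats_def)
  have \<beta>: "\<beta> \<in> adjoin \<beta>"
    unfolding adjoin_def by (rule generate_field.incl) simp
  have add: "x + y \<in> adjoin \<beta>" if "x \<in> adjoin \<beta>" "y \<in> adjoin \<beta>" for x y
    using generate_field.eng_add[of x complex_field "insert \<beta> \<rat>" y] that
    by (simp add: adjoin_def)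
  have mult: "x * y \<in> adjoin \<beta>" if "x \<in> adjoin \<beta>" "y \<in> adjoin \<beta>" for x y
    using generate_field.eng_mult[of x complex_field "insert \<beta> \<rat>" y] that
    by (simp add: adjoin_def)
  have "of_int (a * b) \<noteq> (0 :: complex)" using a_nonzero b_pos by simp
  hence "\<delta> = of_rat (of_int d / of_int b) + of_rat (- 1 / of_int (a * b)) * (\<beta> * \<beta>)"
    by (simp add: \<beta>\<beta> of_rat_divide of_rat_minus of_rat_mult field_simps)
  hence \<delta>: "\<delta> \<in> adjoin \<beta>" using rat \<beta> add mult by metis
  have "\<gamma> = of_rat (1 / of_int c) * (\<beta> * (\<delta> + of_rat (of_int b)))"
    using \<gamma>_eq c_nonzero by (simp add: of_rat_divide field_simps)
  hence \<gamma>: "\<gamma> \<in> adjoin \<beta>" using rat \<beta> \<delta> add mult by metis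
  show "quartic_field \<subseteq> adjoin \<beta>"
    unfolding quartic_field_def el_def using rat \<beta> \<delta> \<gamma> by (auto intro!: add mult)
qed

lemma field_degree_quartic_field: "field_degree quartic_field = 4"
proof -
  interpret C: field complex_field by (rule field_from_type_algebra)
  have Q: "subfield \<rat> complex_field"
  proof (rule C.subfieldI')
    show "subring \<rat> complex_field"
      by (rule C.subringI) auto
    show "inv\<^bsub>complex_field\<^esub> k \<in> \<rat>" if "k \<in> \<rat> - {\<zero>\<^bsub>complex_field\<^esub>}" for k
      using that by auto
  qed
  define B where "B = [1, \<delta>, \<beta>, \<gamma>]"
  have B: "set B \<subseteq> carrier complex_field" by auto
  have comb: "C.combine [k0, k1, k2, k3] B = k0 + k1 * \<delta> + k2 * \<beta> + k3 * \<gamma>" for k0 k1 k2 k3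
    by (simp add: B_def add_ac)
  have "C.Span \<rat> B = quartic_field"
  proof
    show "C.Span \<rat> B \<subseteq> quartic_field"
    proof
      fix s assume "s \<in> C.Span \<rat> B"
      then obtain Ks where "s = C.combine Ks B" "length Ks = 4" "set Ks \<subseteq> \<rat>"
        unfolding C.Span_eq_combine_set_length_version[OF Q B] by (auto simp: B_def)
      then obtain k0 k1 k2 k3 where "s = C.combine [k0, k1, k2, k3] B"
          "k0 \<in> \<rat>" "k1 \<in> \<rat>" "k2 \<in> \<rat>" "k3 \<in> \<rat>"
        by (auto simp: length_Suc_conv numeral_eq_Suc)
      thus "s \<in> quartic_field" unfolding comb Rats_def
        by (auto simp flip: el_def)
    qed
    show "quartic_field \<subseteq> C.Span \<rat> B"
    proof
      fix s assume "s \<in> quartic_field"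
      then obtain x y z w where "s = el x y z w" by (rule quartic_fieldE)
      hence "s = C.combine (map of_rat [x, y, z, w]) B" by (simp add: comb el_def)
      moreover have "set (map of_rat [x, y, z, w]) \<subseteq> (\<rat> :: complex set)"
          "length (map of_rat [x, y, z, w] :: complex list) = length B"
        by (auto simp: B_def)
      ultimately show "s \<in> C.Span \<rat> B"
        unfolding C.Span_eq_combine_set_length_version[OF Q B] by blast
    qed
  qed
  moreover have "C.independent \<rat> B"
  proof (rule C.trivial_combine_imp_independent[OF Q B])
    fix Ks assume Ks: "set Ks \<subseteq> \<rat>" "C.combine Ks B = \<zero>\<^bsub>complex_field\<^esub>"
    obtain Ks' where Ks': "set (take (length B) Ks) \<subseteq> set Ks'" "set Ks' \<subseteq> set (take (length B) Ks) \<union> {\<zero>\<^bsub>complex_field\<^esub>}"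
        "length Ks' = length B" "C.combine Ks' B = \<zero>\<^bsub>complex_field\<^esub>"
      using C.combine_normalize[OF _ B Ks(2)] by auto
    have "set (take (length B) Ks) \<union> {\<zero>\<^bsub>complex_field\<^esub>} \<subseteq> \<rat>"
      using Ks(1) set_take_subset[of "length B" Ks] by (simp add: subset_trans)
    hence "set Ks' \<subseteq> \<rat>" using Ks'(2) by (rule subset_trans[rotated])
    moreover have "length Ks' = 4" using Ks' by (simp add: B_def)
    ultimately obtain k0 k1 k2 k3 where k: "Ks' = map of_rat [k0, k1, k2, k3]"
      by (auto simp: length_Suc_conv numeral_eq_Suc Rats_def)
    have "el k0 k1 k2 k3 = 0"
      using Ks'(4) by (simp add: k comb el_def)
    from el_eq_0[OF this] have "set Ks' \<subseteq> {0}" by (simp add: k)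
    thus "set (take (length B) Ks) \<subseteq> {\<zero>\<^bsub>complex_field\<^esub>}"
      using Ks'(1) by auto
  qed
  ultimately have "C.dimension 4 \<rat> quartic_field"
    using C.dimensionI[OF Q, of B] by (simp add: B_def numeral_eq_Suc)
  thus ?thesis using C.dimI[OF Q] by (simp add: field_degree_def over_def)
qed

text \<open>
  The map \<open>\<delta> \<mapsto> - \<delta>\<close>, \<open>\<beta> \<mapsto> \<gamma>\<close>, \<open>\<gamma> \<mapsto> - \<beta>\<close> respects the multiplication table; it generates the
  Galois group. Hence it commutes with the evaluation of integer polynomials.
\<close>

lemma algebraic_int_conjugate:
  assumes "algebraic_int (el x y z w)"
  shows "algebraic_int (el x (- y) (- w) z)"
proof -
  have conj: "\<exists>X0 Y Z W. poly (map_poly of_int p) (el x y z w) = el X0 Y Z W \<and>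
      poly (map_poly of_int p) (el x (- y) (- w) z) = el X0 (- Y) (- W) Z" for p :: "int poly"
  proof (induction p)
    case 0
    show ?case by (rule exI[of _ 0])+ (simp add: el_0)
  next
    case (pCons k p)
    then obtain X0 Y Z W where IH: "poly (map_poly of_int p) (el x y z w) = el X0 Y Z W"
        "poly (map_poly of_int p) (el x (- y) (- w) z) = el X0 (- Y) (- W) Z" by blast
    have map_pCons: "map_poly of_int (pCons k p) = pCons (of_int k :: complex) (map_poly of_int p)"
      by (rule Polynomial.map_poly_pCons) simp
    have k: "(of_int k :: complex) = el (of_int k) 0 0 0" by (simp add: el_rat)
    show ?case
      unfolding map_pCons poly_pCons IH k el_mult el_add el_eq_iff
      by (intro exI conjI) (rule refl | simp add: algebra_simps)+
  qed
  obtain p :: "int poly" where p: "poly (map_poly of_int p) (el x y z w) = 0" "lead_coeff p = 1"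
    using assms unfolding algebraic_int_altdef_ipoly by blast
  obtain X0 Y Z W where c: "poly (map_poly of_int p) (el x y z w) = el X0 Y Z W"
      "poly (map_poly of_int p) (el x (- y) (- w) z) = el X0 (- Y) (- W) Z"
    using conj by blast
  have "X0 = 0" "Y = 0" "Z = 0" "W = 0" using el_eq_0[of X0 Y Z W] c(1) p(1) by simp_all
  hence "poly (map_poly of_int p) (el x (- y) (- w) z) = 0" using c(2) by (simp add: el_0)
  thus ?thesis using p(2) unfolding algebraic_int_altdef_ipoly by blast
qed

lemma in_Ints_if_algebraic_int_\<delta>_multiple:
  assumes "algebraic_int (el 0 y 0 0)"
  shows "y \<in> \<int>"
proof -
  have "algebraic_int (el 0 y 0 0 * el 0 y 0 0)" using assms assms by (rule algebraic_int_mult)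
  hence "algebraic_int (of_rat (of_int d * y\<^sup>2) :: complex)"
    by (simp add: el_mult el_rat power2_eq_square)
  hence "of_int d * y\<^sup>2 \<in> \<int>" by (rule rat_in_Ints_if_algebraic_int)
  thus ?thesis by (rule rat_in_Ints_if_squarefree_mult_square[OF squarefree_d])
qed

text \<open>
  The ring of integers is contained in the span of \<open>1, \<delta>, \<beta>, \<gamma>\<close> over \<open>\<int> / 4\<close>, so at an odd
  prime the integer span of the basis may replace it. Sums and differences of conjugates isolate
  \<open>4 x\<close>, \<open>4 y \<delta>\<close> and \<open>Z \<beta> + W \<gamma>\<close> with \<open>Z = 2 z\<close> and \<open>W = 2 w\<close>. The square of the last element
  and its product with its conjugate give integrality of \<open>2 a d S\<close>, \<open>2 a D\<close> and \<open>a E\<close>. From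
  these \<open>a d (2 Z)\<^sup>2\<close> and \<open>a d (2 W)\<^sup>2\<close> are recovered, and \<open>a d\<close> is squarefree.
\<close>

lemma four_times_coordinates_in_Ints:
  assumes int: "algebraic_int (el x y z w)"
  shows "4 * x \<in> \<int>" "4 * y \<in> \<int>" "4 * z \<in> \<int>" "4 * w \<in> \<int>"
proof -
  have o1: "algebraic_int (el x (- y) (- w) z)" by (rule algebraic_int_conjugate[OF int])
  have o2: "algebraic_int (el x y (- z) (- w))" using algebraic_int_conjugate[OF o1] by simp
  have o3: "algebraic_int (el x (- y) w (- z))" using algebraic_int_conjugate[OF o2] by simp
  have t0: "algebraic_int (el (2 * x) (2 * y) 0 0)"
    using algebraic_int_add[OF int o2] by (simp add: el_add)
  have t1: "algebraic_int (el (2 * x) (- (2 * y)) 0 0)"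
    using algebraic_int_add[OF o1 o3] by (simp add: el_add)
  have "algebraic_int (of_rat (4 * x) :: complex)"
    using algebraic_int_add[OF t0 t1] by (simp add: el_add el_rat)
  thus "4 * x \<in> \<int>" by (rule rat_in_Ints_if_algebraic_int)
  have "algebraic_int (el 0 (4 * y) 0 0)"
    using algebraic_int_diff[OF t0 t1] by (simp add: el_diff)
  thus "4 * y \<in> \<int>" by (rule in_Ints_if_algebraic_int_\<delta>_multiple)
  define Z where "Z = 2 * z"
  define W where "W = 2 * w"
  define S where "S = Z\<^sup>2 + W\<^sup>2"
  define D where "D = of_int b * (W\<^sup>2 - Z\<^sup>2) + 2 * of_int c * Z * W"
  define E where "E = of_int c * (W\<^sup>2 - Z\<^sup>2) - 2 * of_int b * Z * W"
  have w0: "algebraic_int (el 0 0 Z W)"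
    using algebraic_int_diff[OF int o2] by (simp add: el_diff Z_def W_def)
  have w1: "algebraic_int (el 0 0 (- W) Z)"
    using algebraic_int_diff[OF o1 o3] by (simp add: el_diff Z_def W_def)
  have sq0: "algebraic_int (el (of_int (a * d) * S) (of_int a * D) 0 0)"
    using algebraic_int_mult[OF w0 w0] unfolding el_mult S_def D_def
    by (simp add: power2_eq_square algebra_simps)
  have sq1: "algebraic_int (el (of_int (a * d) * S) (- (of_int a * D)) 0 0)"
    using algebraic_int_mult[OF w1 w1] unfolding el_mult S_def D_def
    by (simp add: power2_eq_square algebra_simps)
  have "algebraic_int (of_rat (2 * of_int (a * d) * S) :: complex)"
    using algebraic_int_add[OF sq0 sq1] by (simp add: el_add el_rat mult_ac)
  hence S: "2 * of_int (a * d) * S \<in> \<int>" by (rule rat_in_Ints_if_algebraic_int)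
  have "algebraic_int (el 0 (2 * of_int a * D) 0 0)"
    using algebraic_int_diff[OF sq0 sq1] by (simp add: el_diff mult_ac)
  hence D: "2 * of_int a * D \<in> \<int>" by (rule in_Ints_if_algebraic_int_\<delta>_multiple)
  have "algebraic_int (el 0 (- (of_int a * E)) 0 0)"
    using algebraic_int_mult[OF w0 w1] unfolding el_mult E_def
    by (simp add: power2_eq_square algebra_simps)
  hence "- (of_int a * E) \<in> \<int>" by (rule in_Ints_if_algebraic_int_\<delta>_multiple)
  hence E: "of_int a * E \<in> \<int>" using minus_in_Ints_iff by blast
  have dr: "(of_int d :: rat) = of_int b * of_int b + of_int c * of_int c"
    by (simp add: d_eq power2_eq_square)
  (* D and E arise from W^2 - Z^2 and 2 Z W by the matrix with rows (b, c) and (c, -b);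
     as b^2 + c^2 = d, that matrix is its own inverse up to the factor d *)
  have "of_int b * (2 * of_int a * D) + of_int (2 * c) * (of_int a * E) \<in> \<int>"
    by (intro Ints_add Ints_mult Ints_of_int D E)
  also have "of_int b * (2 * of_int a * D) + of_int (2 * c) * (of_int a * E) = 2 * of_int (a * d) * (W\<^sup>2 - Z\<^sup>2)"
    unfolding D_def E_def of_int_mult dr by (simp add: algebra_simps power2_eq_square)
  finally have U: "2 * of_int (a * d) * (W\<^sup>2 - Z\<^sup>2) \<in> \<int>" .
  have sf: "squarefree (a * d)"
    by (rule squarefree_mult_coprime[OF coprime_a_d squarefree_a squarefree_d])
  have "of_int (a * d) * (4 * w)\<^sup>2 = 2 * of_int (a * d) * S + 2 * of_int (a * d) * (W\<^sup>2 - Z\<^sup>2)"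
    unfolding S_def W_def Z_def by (simp add: algebra_simps power2_eq_square)
  hence "of_int (a * d) * (4 * w)\<^sup>2 \<in> \<int>" using Ints_add[OF S U] by simp
  thus "4 * w \<in> \<int>" by (rule rat_in_Ints_if_squarefree_mult_square[OF sf])
  have "of_int (a * d) * (4 * z)\<^sup>2 = 2 * of_int (a * d) * S - 2 * of_int (a * d) * (W\<^sup>2 - Z\<^sup>2)"
    unfolding S_def W_def Z_def by (simp add: algebra_simps power2_eq_square)
  hence "of_int (a * d) * (4 * z)\<^sup>2 \<in> \<int>" using Ints_diff[OF S U] by simp
  thus "4 * z \<in> \<int>" by (rule rat_in_Ints_if_squarefree_mult_square[OF sf])
qed

lemma algebraic_int_generators: "algebraic_int \<delta>" "algebraic_int \<beta>" "algebraic_int \<gamma>"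
proof -
  have \<delta>: "algebraic_int \<delta>"
    by (rule algebraic_int_if_square_algebraic_int) (simp add: \<delta>\<delta> int_imp_algebraic_int)
  have "algebraic_int (of_int (a * d) - of_int (a * b) * \<delta>)"
       "algebraic_int (of_int (a * d) + of_int (a * b) * \<delta>)"
    by (intro algebraic_int_add algebraic_int_diff algebraic_int_mult \<delta> int_imp_algebraic_int Ints_of_int)+
  thus "algebraic_int \<beta>" "algebraic_int \<gamma>"
    using algebraic_int_if_square_algebraic_int[of \<beta>] algebraic_int_if_square_algebraic_int[of \<gamma>]
    by (simp_all add: \<beta>\<beta> \<gamma>\<gamma>)
  show "algebraic_int \<delta>" by (rule \<delta>)
qed

lemma algebraic_int_el_of_int: "algebraic_int (el (of_int x) (of_int y) (of_int z) (of_int w))"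
  unfolding el_def of_rat_of_int_eq
  by (intro algebraic_int_add algebraic_int_mult algebraic_int_generators int_imp_algebraic_int Ints_of_int)

end

section \<open>Splitting types of rational primes\<close>

text \<open>
  The intersection of the primes above \<open>p\<close> is the radical of \<open>p \<O>\<close>. In a Galois extension all
  ramification indices agree, so \<open>p \<O>\<close> is a power of its radical; the number \<open>g\<close> of primes and the
  exponent \<open>e\<close> then distinguish all the decompositions under consideration. In degree 4 they
  determine the residue degree \<open>4 / (e g)\<close> as well.
\<close>

definition split_type :: "complex set \<Rightarrow> nat \<Rightarrow> nat \<Rightarrow> nat \<Rightarrow> bool" where
  "split_type K p g e \<longleftrightarrow>
     card (primes_above K p) = g \<and>
     ext_ideal K p = \<Inter>(primes_above K p) [^]\<^bsub>ideals_set (ring_of_integers K)\<^esub> e"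

text \<open>
  Finiteness of \<open>\<O> / p \<O>\<close> makes all primes above \<open>p\<close> maximal. This suffices for the part of the
  ideal theory of Dedekind rings that concerns the primes above \<open>p\<close>.
\<close>

locale finite_residue_ring =
  fixes K :: "complex set" and p :: nat
  assumes prime_p: "Factorial_Ring.prime p"
    and one_in_K: "1 \<in> K"
    and add_in_K: "x \<in> K \<Longrightarrow> y \<in> K \<Longrightarrow> x + y \<in> K"
    and minus_in_K: "x \<in> K \<Longrightarrow> - x \<in> K"
    and mult_in_K: "x \<in> K \<Longrightarrow> y \<in> K \<Longrightarrow> x * y \<in> K"
    and finite_residues: "\<exists>Y. finite Y \<and>
      (\<forall>x. x \<in> K \<and> algebraic_int x \<longrightarrow>
        (\<exists>y\<in>Y. \<exists>t. t \<in> K \<and> algebraic_int t \<and> x = y + of_nat p * t))"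
begin

abbreviation (input) R where "R \<equiv> ring_of_integers K"

definition \<O> :: "complex set" where
  "\<O> = {x \<in> K. algebraic_int x}"

lemma ring_of_integers_simps [simp]:
  "carrier R = \<O>" "x \<otimes>\<^bsub>R\<^esub> y = x * y" "x \<oplus>\<^bsub>R\<^esub> y = x + y" "\<one>\<^bsub>R\<^esub> = 1" "\<zero>\<^bsub>R\<^esub> = 0"
  by (simp_all add: ring_of_integers_def ring_of_type_algebra_def \<O>_def)

lemma \<O>_closed [simp, intro]:
  "1 \<in> \<O>" "0 \<in> \<O>"
  "x \<in> \<O> \<Longrightarrow> y \<in> \<O> \<Longrightarrow> x + y \<in> \<O>"
  "x \<in> \<O> \<Longrightarrow> - x \<in> \<O>"
  "x \<in> \<O> \<Longrightarrow> y \<in> \<O> \<Longrightarrow> x - y \<in> \<O>"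
  "x \<in> \<O> \<Longrightarrow> y \<in> \<O> \<Longrightarrow> x * y \<in> \<O>"
proof -
  show 1: "1 \<in> \<O>" using one_in_K by (simp add: \<O>_def int_imp_algebraic_int)
  show add: "x + y \<in> \<O>" if "x \<in> \<O>" "y \<in> \<O>" for x y
    using that by (simp add: \<O>_def add_in_K algebraic_int_add)
  show minus: "- x \<in> \<O>" if "x \<in> \<O>" for x
    using that by (simp add: \<O>_def minus_in_K)
  show "0 \<in> \<O>" using add[OF 1 minus[OF 1]] by simp
  show "x \<in> \<O> \<Longrightarrow> y \<in> \<O> \<Longrightarrow> x - y \<in> \<O>" using add[of x "- y"] minus[of y] by simp
  show "x \<in> \<O> \<Longrightarrow> y \<in> \<O> \<Longrightarrow> x * y \<in> \<O>"
    by (simp add: \<O>_def mult_in_K algebraic_int_mult)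
qed

lemma \<O>_power [simp, intro]: "x \<in> \<O> \<Longrightarrow> x ^ n \<in> \<O>"
  by (induction n) auto

lemma \<O>_of_nat [simp, intro]: "of_nat n \<in> \<O>"
  by (induction n) auto

lemma \<O>_of_int [simp, intro]: "of_int n \<in> \<O>"
  by (cases n) auto

sublocale cring R
proof (rule cringI)
  show "abelian_group R"
  proof (rule abelian_groupI)
    show "\<exists>y\<in>carrier R. y \<oplus>\<^bsub>R\<^esub> x = \<zero>\<^bsub>R\<^esub>" if "x \<in> carrier R" for x
      using that by (intro bexI[of _ "- x"]) auto
  qed (auto simp: algebra_simps)
  show "comm_monoid R"
    by (rule comm_monoidI) (auto simp: algebra_simps)
qed (auto simp: algebra_simps)

lemma a_inv_eq [simp]: "x \<in> \<O> \<Longrightarrow> \<ominus>\<^bsub>R\<^esub> x = - x"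
  by (rule minus_equality) auto

lemma ideal_closed:
  assumes "ideal I R"
  shows "x \<in> I \<Longrightarrow> x \<in> \<O>" "0 \<in> I"
    and "x \<in> I \<Longrightarrow> y \<in> I \<Longrightarrow> x + y \<in> I"
    and "x \<in> I \<Longrightarrow> y \<in> I \<Longrightarrow> x - y \<in> I"
    and "x \<in> \<O> \<Longrightarrow> y \<in> I \<Longrightarrow> x * y \<in> I"
    and "x \<in> I \<Longrightarrow> y \<in> \<O> \<Longrightarrow> x * y \<in> I"
proof -
  interpret ideal I R by fact
  show mem: "x \<in> \<O>" if "x \<in> I" for x using a_Hcarr[OF that] by simp
  show "0 \<in> I" using zero_closed by simp
  show add: "x + y \<in> I" if "x \<in> I" "y \<in> I" for x y using a_closed[OF that] by simp
  show mult: "x * y \<in> I" if "x \<in> \<O>" "y \<in> I" for x y using I_l_closed[of y x] that by simp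
  show "x \<in> I \<Longrightarrow> y \<in> \<O> \<Longrightarrow> x * y \<in> I" using I_r_closed[of x y] by simp
  show "x \<in> I \<Longrightarrow> y \<in> I \<Longrightarrow> x - y \<in> I" using add[of x "- 1 * y"] mult[of "- 1" y] by simp
qed

lemma ideal_intro:
  assumes "I \<subseteq> \<O>" "0 \<in> I" "\<And>x y. x \<in> I \<Longrightarrow> y \<in> I \<Longrightarrow> x + y \<in> I"
    and mult: "\<And>x y. x \<in> \<O> \<Longrightarrow> y \<in> I \<Longrightarrow> x * y \<in> I"
  shows "ideal I R"
proof (rule idealI)
  show "subgroup I (add_monoid R)"
  proof (rule add.subgroupI)
    show "\<ominus>\<^bsub>R\<^esub> x \<in> I" if "x \<in> I" for x
      using mult[of "- 1" x] that assms(1) by (auto simp: subset_iff)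
  qed (use assms in auto)
  show "x \<otimes>\<^bsub>R\<^esub> y \<in> I" "y \<otimes>\<^bsub>R\<^esub> x \<in> I" if "y \<in> I" "x \<in> carrier R" for x y
    using mult[of x y] that by (simp_all add: mult.commute)
qed (rule ring_axioms)

lemma primeideal_intro:
  assumes "ideal P R" "1 \<notin> P"
    and "\<And>x y. x \<in> \<O> \<Longrightarrow> y \<in> \<O> \<Longrightarrow> x * y \<in> P \<Longrightarrow> x \<in> P \<or> y \<in> P"
  shows "primeideal P R"
proof (rule primeidealI)
  show "carrier R \<noteq> P" using assms(2) \<O>_closed(1) by auto
qed (use assms is_cring in auto)

lemma primeideal_dest:
  assumes "primeideal P R"
  shows "ideal P R" "1 \<notin> P" "x \<in> \<O> \<Longrightarrow> y \<in> \<O> \<Longrightarrow> x * y \<in> P \<Longrightarrow> x \<in> P \<or> y \<in> P"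
proof -
  interpret primeideal P R by fact
  show "ideal P R" by (rule ideal_axioms)
  show "1 \<notin> P" using I_notcarr one_imp_carrier by auto
  show "x \<in> \<O> \<Longrightarrow> y \<in> \<O> \<Longrightarrow> x * y \<in> P \<Longrightarrow> x \<in> P \<or> y \<in> P"
    using I_prime[of x y] by simp
qed

lemma prime_power_mem:
  assumes "primeideal P R" "x \<in> \<O>" "x ^ n \<in> P"
  shows "x \<in> P"
  using assms(3)
proof (induction n)
  case 0
  thus ?case using primeideal_dest(2)[OF assms(1)] by simp
next
  case (Suc n)
  thus ?case using primeideal_dest(3)[OF assms(1,2), of "x ^ n"] assms(2) by auto
qed

lemma ext_ideal_eq: "ext_ideal K p = {of_nat p * x | x. x \<in> \<O>}"
  by (auto simp: ext_ideal_def cgenideal_def mult.commute)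

lemma ideal_ext_ideal: "ideal (ext_ideal K p) R"
  unfolding ext_ideal_def by (rule cgenideal_ideal) simp

lemma ext_ideal_subset_iff:
  assumes "ideal I R"
  shows "ext_ideal K p \<subseteq> I \<longleftrightarrow> of_nat p \<in> I"
proof
  assume "ext_ideal K p \<subseteq> I"
  moreover have "of_nat p * 1 \<in> ext_ideal K p" unfolding ext_ideal_eq by blast
  ultimately show "of_nat p \<in> I" by auto
next
  assume "of_nat p \<in> I"
  thus "ext_ideal K p \<subseteq> I"
    unfolding ext_ideal_eq using ideal_closed(6)[OF assms] by blast
qed

text \<open>
  A prime ideal containing \<open>p\<close> and an integer prime to \<open>p\<close> would contain 1 by Bezout.
\<close>

lemma primes_above_eq: "primes_above K p = {P. primeideal P R \<and> of_nat p \<in> P}"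
proof (rule Set.set_eqI, rule iffI)
  fix P assume "P \<in> primes_above K p"
  hence "primeideal P R" and Z: "P \<inter> \<int> = range (\<lambda>k::int. of_int (int p * k))"
    by (auto simp: primes_above_def)
  have "(of_int (int p * 1) :: complex) \<in> P \<inter> \<int>" unfolding Z by blast
  thus "P \<in> {P. primeideal P R \<and> of_nat p \<in> P}" using \<open>primeideal P R\<close> by simp
next
  fix P assume "P \<in> {P. primeideal P R \<and> of_nat p \<in> P}"
  hence P: "primeideal P R" "of_nat p \<in> P" by auto
  note I = ideal_closed[OF primeideal_dest(1)[OF P(1)]]
  have "int p dvd k" if k: "of_int k \<in> P" for k
  proof (rule ccontr)
    assume "\<not> int p dvd k"
    hence "coprime (int p) k" using prime_p by (simp add: prime_imp_coprime)
    then obtain u v where uv: "int p * u + k * v = 1"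
      using bezout_int[of "int p" k] by (auto simp: mult_ac)
    have "of_nat p * of_int u + of_int k * of_int v \<in> P"
      by (intro I(3) I(6) P(2) k \<O>_of_int)
    also have "of_nat p * of_int u + of_int k * of_int v = (of_int (int p * u + k * v) :: complex)" by simp
    finally show False using uv primeideal_dest(2)[OF P(1)] by simp
  qed
  moreover have "of_int (int p * k) \<in> P" for k
    using I(6)[OF P(2) \<O>_of_int[of k]] by simp
  ultimately have "P \<inter> \<int> = range (\<lambda>k::int. of_int (int p * k))"
    by (fastforce elim!: Ints_cases dvdE)
  thus "P \<in> primes_above K p" using P(1) by (simp add: primes_above_def)
qed

text \<open>
  The powers of \<open>x\<close> fall into finitely many classes modulo \<open>p \<O>\<close>, so that
  \<open>x\<^sup>m (1 - x\<^sup>n\<^sup>-\<^sup>m)\<close> lies in \<open>P\<close> for some \<open>m < n\<close>, and \<open>x\<^sup>m\<close> does not.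
\<close>

lemma prime_above_invertible:
  assumes "P \<in> primes_above K p" "x \<in> \<O>" "x \<notin> P"
  obtains y where "y \<in> \<O>" "1 - x * y \<in> P"
proof -
  have P: "primeideal P R" "of_nat p \<in> P" using assms(1) by (auto simp: primes_above_eq)
  note I = ideal_closed[OF primeideal_dest(1)[OF P(1)]]
  obtain Y where Y: "finite Y" "\<And>x. x \<in> \<O> \<Longrightarrow> \<exists>y\<in>Y. \<exists>t\<in>\<O>. x = y + of_nat p * t"
    using finite_residues by (auto simp: \<O>_def)
  hence "\<forall>n. \<exists>y t. y \<in> Y \<and> t \<in> \<O> \<and> x ^ n = y + of_nat p * t"
    using \<O>_power[OF assms(2)] by blast
  then obtain r t where r: "\<And>n. r n \<in> Y" and t: "\<And>n. t n \<in> \<O>"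
      and rt: "\<And>n. x ^ n = r n + of_nat p * t n" by metis
  have "\<not> inj r"
    using Y(1) r finite_subset[of "range r" Y] finite_imageD[of r UNIV] by (auto simp: image_subset_iff)
  then obtain m n where mn: "m < n" "r m = r n"
    unfolding inj_def by (metis linorder_neqE_nat)
  have "x ^ m * (1 - x * x ^ (n - m - 1)) = x ^ m - x ^ (m + Suc (n - m - 1))"
    by (simp add: algebra_simps power_add)
  also have "\<dots> = x ^ m - x ^ n" using mn by simp
  also have "\<dots> = of_nat p * (t m - t n)"
    using rt[of m] rt[of n] mn by (simp add: algebra_simps)
  also have "\<dots> \<in> P" using P(2) t by (intro I(6)) auto
  finally have "x ^ m * (1 - x * x ^ (n - m - 1)) \<in> P" .
  hence "x ^ m \<in> P \<or> 1 - x * x ^ (n - m - 1) \<in> P"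
    using assms(2) by (intro primeideal_dest(3)[OF P(1)]) auto
  moreover have "x ^ m \<notin> P" using prime_power_mem[OF P(1) assms(2)] assms(3) by blast
  ultimately show ?thesis using that[of "x ^ (n - m - 1)"] assms(2) by blast
qed

lemma primes_above_subset_imp_eq:
  assumes "P \<in> primes_above K p" "Q \<in> primes_above K p" "P \<subseteq> Q"
  shows "P = Q"
proof (rule ccontr)
  assume "P \<noteq> Q"
  then obtain x where x: "x \<in> Q" "x \<notin> P" using assms(3) by blast
  have Q: "primeideal Q R" using assms(2) by (simp add: primes_above_eq)
  note I = ideal_closed[OF primeideal_dest(1)[OF Q]]
  obtain y where y: "y \<in> \<O>" "1 - x * y \<in> P"
    using prime_above_invertible[OF assms(1)] x I(1) by blast
  have "(1 - x * y) + x * y \<in> Q" using y x assms(3) by (intro I(3) I(6)) auto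
  thus False using primeideal_dest(2)[OF Q] by simp
qed

text \<open>
  If \<open>P\<close> differs from all members of \<open>\<Q>\<close>, it contains none of them by maximality. The product of
  elements outside \<open>P\<close>, one from each member, then lies in the intersection but not in \<open>P\<close>.
\<close>

lemma prime_above_in_set_if_Inter_subset:
  assumes "finite \<Q>" "\<Q> \<subseteq> primes_above K p" "P \<in> primes_above K p" "\<O> \<inter> \<Inter>\<Q> \<subseteq> P"
  shows "P \<in> \<Q>"
proof (rule ccontr)
  assume "P \<notin> \<Q>"
  have P: "primeideal P R" using assms(3) by (simp add: primes_above_eq)
  have "\<exists>x\<in>\<O> \<inter> \<Inter>\<Q>. x \<notin> P" using assms(1,2) \<open>P \<notin> \<Q>\<close>
  proof (induction \<Q> rule: finite_induct)
    case empty
    show ?case using primeideal_dest(2)[OF P] by (intro bexI[of _ 1]) auto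
  next
    case (insert Q \<Q>)
    then obtain x where x: "x \<in> \<O>" "x \<in> \<Inter>\<Q>" "x \<notin> P" by auto
    have Q: "Q \<in> primes_above K p" "Q \<noteq> P" using insert.prems by auto
    then obtain y where y: "y \<in> Q" "y \<notin> P"
      using primes_above_subset_imp_eq[OF Q(1) assms(3)] by blast
    have IQ: "ideal Q' R" if "Q' \<in> insert Q \<Q>" for Q'
      using that insert.prems by (auto simp: primes_above_eq dest: primeideal_dest)
    have "y \<in> \<O>" using ideal_closed(1)[OF IQ] y by blast
    hence "x * y \<in> \<O> \<inter> \<Inter>(insert Q \<Q>)"
      using x y IQ by (auto intro: ideal_closed(5,6))
    moreover have "x * y \<notin> P" using primeideal_dest(3)[OF P] x y \<open>y \<in> \<O>\<close> by blast
    ultimately show ?case by blast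
  qed
  thus False using assms(4) by blast
qed

lemma comaximal_Inter:
  assumes "finite \<Q>" "\<Q> \<subseteq> primes_above K p" "P \<in> primes_above K p" "P \<notin> \<Q>"
  obtains v where "v \<in> \<O> \<inter> \<Inter>\<Q>" "1 - v \<in> P"
proof -
  have "\<not> \<O> \<inter> \<Inter>\<Q> \<subseteq> P" using prime_above_in_set_if_Inter_subset assms by blast
  then obtain x where x: "x \<in> \<O>" "x \<in> \<Inter>\<Q>" "x \<notin> P" by blast
  then obtain y where y: "y \<in> \<O>" "1 - x * y \<in> P"
    using prime_above_invertible[OF assms(3)] by blast
  have "x * y \<in> \<O> \<inter> \<Inter>\<Q>"
    using x y assms(2) by (auto simp: primes_above_eq intro: ideal_closed(6) dest: primeideal_dest(1))
  thus ?thesis using that y(2) by blast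
qed

lemma ideal_Inter_primes:
  assumes "\<Q> \<subseteq> primes_above K p"
  shows "ideal (\<O> \<inter> \<Inter>\<Q>) R"
proof (rule ideal_intro)
  have I: "ideal Q R" if "Q \<in> \<Q>" for Q
    using that assms by (auto simp: primes_above_eq dest: primeideal_dest)
  show "0 \<in> \<O> \<inter> \<Inter>\<Q>" using ideal_closed(2)[OF I] by auto
  show "x + y \<in> \<O> \<inter> \<Inter>\<Q>" if "x \<in> \<O> \<inter> \<Inter>\<Q>" "y \<in> \<O> \<inter> \<Inter>\<Q>" for x y
    using that ideal_closed(3)[OF I] by auto
  show "x * y \<in> \<O> \<inter> \<Inter>\<Q>" if "x \<in> \<O>" "y \<in> \<O> \<inter> \<Inter>\<Q>" for x y
    using that ideal_closed(5)[OF I] by auto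
qed auto

lemma ideal_Inter_primes_nonempty:
  assumes "\<Q> \<subseteq> primes_above K p" "\<Q> \<noteq> {}"
  shows "\<O> \<inter> \<Inter>\<Q> = \<Inter>\<Q>"
  using assms by (auto simp: primes_above_eq dest!: primeideal_dest(1) ideal_closed(1))

sublocale ideals: comm_monoid "ideals_set R"
  by (rule ideals_set_is_comm_monoid)

lemma ideals_set_simps [simp]:
  "I \<otimes>\<^bsub>ideals_set R\<^esub> J = ideal_prod R I J"
  "I \<in> carrier (ideals_set R) \<longleftrightarrow> ideal I R"
  "\<one>\<^bsub>ideals_set R\<^esub> = \<O>"
  by (simp_all add: ideals_set_def)

text \<open>
  A prime outside \<open>\<Q>\<close> is comaximal with the intersection of \<open>\<Q>\<close>. The intersection with the ring
  itself matters only for empty \<open>\<Q>\<close>, where it makes the formula hold as well.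
\<close>

lemma prime_mult_Inter_primes:
  assumes "finite \<Q>" "\<Q> \<subseteq> primes_above K p" "P \<in> primes_above K p" "P \<notin> \<Q>"
  shows "ideal_prod R P (\<O> \<inter> \<Inter>\<Q>) = \<O> \<inter> \<Inter>(insert P \<Q>)"
proof -
  have P: "ideal P R" using assms(3) by (simp add: primes_above_eq primeideal_dest)
  obtain v where v: "v \<in> \<O> \<inter> \<Inter>\<Q>" "1 - v \<in> P" using comaximal_Inter assms by blast
  have "ideal (P <+>\<^bsub>R\<^esub> (\<O> \<inter> \<Inter>\<Q>)) R"
    by (rule add_ideals[OF P ideal_Inter_primes[OF assms(2)]])
  moreover have "(1 - v) \<oplus>\<^bsub>R\<^esub> v \<in> P <+>\<^bsub>R\<^esub> (\<O> \<inter> \<Inter>\<Q>)"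
    unfolding set_add_def' using v by blast
  hence "1 \<in> P <+>\<^bsub>R\<^esub> (\<O> \<inter> \<Inter>\<Q>)" by simp
  ultimately have "P <+>\<^bsub>R\<^esub> (\<O> \<inter> \<Inter>\<Q>) = carrier R"
    using ideal.one_imp_carrier[of "P <+>\<^bsub>R\<^esub> (\<O> \<inter> \<Inter>\<Q>)" R] by simp
  thus ?thesis
    using ideal_prod_eq_inter[OF P ideal_Inter_primes[OF assms(2)]] by auto
qed

lemma finprod_primes_eq_Inter:
  assumes "finite \<Q>" "\<Q> \<subseteq> primes_above K p"
  shows "(\<Otimes>\<^bsub>ideals_set R\<^esub>P\<in>\<Q>. P) = \<O> \<inter> \<Inter>\<Q>"
  using assms
proof (induction \<Q> rule: finite_induct)
  case empty
  thus ?case by simp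
next
  case (insert P \<Q>)
  have ideals: "ideal Q R" if "Q \<in> insert P \<Q>" for Q
    using that insert.prems by (auto simp: primes_above_eq dest: primeideal_dest)
  have "(\<Otimes>\<^bsub>ideals_set R\<^esub>Q\<in>insert P \<Q>. Q) = P \<otimes>\<^bsub>ideals_set R\<^esub> (\<Otimes>\<^bsub>ideals_set R\<^esub>Q\<in>\<Q>. Q)"
    using insert.hyps ideals by (intro ideals.finprod_insert) auto
  also have "\<dots> = ideal_prod R P (\<O> \<inter> \<Inter>\<Q>)" using insert by simp
  also have "\<dots> = \<O> \<inter> \<Inter>(insert P \<Q>)"
    using insert by (intro prime_mult_Inter_primes) auto
  finally show ?case .
qed

lemma two_primes_prod:
  assumes "P \<in> primes_above K p" "Q \<in> primes_above K p" "P \<noteq> Q"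
  shows "ideal_prod R P Q = P \<inter> Q"
  using prime_mult_Inter_primes[of "{Q}" P] assms
    ideal_Inter_primes_nonempty[of "{Q}"] ideal_Inter_primes_nonempty[of "{P, Q}"] by simp

lemma ideal_power:
  assumes "ideal I R"
  shows "ideal (I [^]\<^bsub>ideals_set R\<^esub> (n :: nat)) R"
  using ideals.nat_pow_closed[of I n] assms by simp

lemma power_mem_ideal_power:
  assumes "x \<in> I"
  shows "x ^ n \<in> I [^]\<^bsub>ideals_set R\<^esub> n"
proof (induction n)
  case (Suc n)
  have "x ^ n \<otimes>\<^bsub>R\<^esub> x \<in> ideal_prod R (I [^]\<^bsub>ideals_set R\<^esub> n) I"
    by (rule ideal_prod.prod[OF Suc assms])
  thus ?case by (simp add: mult.commute)
qed simp

lemma ideal_power_subset: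
  fixes n :: nat
  assumes "ideal I R" "n > 0"
  shows "I [^]\<^bsub>ideals_set R\<^esub> n \<subseteq> I"
proof -
  obtain m where "n = Suc m" using assms(2) by (cases n) auto
  thus ?thesis using ideal_prod_inter[OF ideal_power[OF assms(1), of m] assms(1)] by auto
qed

lemma ideal_power_1: "ideal I R \<Longrightarrow> I [^]\<^bsub>ideals_set R\<^esub> (1 :: nat) = I"
  by (rule ideals.nat_pow_eone) simp

lemma prime_contains_if_contains_power:
  assumes "primeideal P R" "ideal I R" "I [^]\<^bsub>ideals_set R\<^esub> (n :: nat) \<subseteq> P"
  shows "I \<subseteq> P"
proof
  fix x assume x: "x \<in> I"
  have "x ^ n \<in> P" using power_mem_ideal_power[OF x, of n] assms(3) by (rule subsetD[rotated])
  thus "x \<in> P" by (rule prime_power_mem[OF assms(1) ideal_closed(1)[OF assms(2) x]])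
qed

lemma primes_above_eqI:
  assumes "finite \<Q>" "\<Q> \<subseteq> primes_above K p"
    and "(\<O> \<inter> \<Inter>\<Q>) [^]\<^bsub>ideals_set R\<^esub> (e :: nat) \<subseteq> ext_ideal K p"
  shows "primes_above K p = \<Q>"
proof
  show "primes_above K p \<subseteq> \<Q>"
  proof
    fix P assume P: "P \<in> primes_above K p"
    hence "primeideal P R" "ext_ideal K p \<subseteq> P"
      using ext_ideal_subset_iff primeideal_dest(1) by (auto simp: primes_above_eq)
    hence "\<O> \<inter> \<Inter>\<Q> \<subseteq> P"
      using prime_contains_if_contains_power[OF _ ideal_Inter_primes[OF assms(2)]] assms(3) by blast
    thus "P \<in> \<Q>" by (rule prime_above_in_set_if_Inter_subset[OF assms(1,2) P])
  qed
qed (rule assms(2))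

text \<open>
  The criterion by which all decompositions are established: it is enough to exhibit primes above
  \<open>p\<close> whose intersection has \<open>p \<O>\<close> as its \<open>e\<close>-th power. There are no further ones, for a prime
  containing \<open>p\<close> contains that power, hence the intersection, hence equals one of the given primes.
\<close>

lemma split_typeI:
  assumes "finite \<Q>" "\<Q> \<subseteq> primes_above K p" "\<Q> \<noteq> {}" "card \<Q> = g"
    and "\<Inter>\<Q> [^]\<^bsub>ideals_set R\<^esub> e \<subseteq> ext_ideal K p" "of_nat p \<in> \<Inter>\<Q> [^]\<^bsub>ideals_set R\<^esub> e"
  shows "split_type K p g e"
proof -
  note I = ideal_Inter_primes_nonempty[OF assms(2,3)]
  have "primes_above K p = \<Q>" using primes_above_eqI[OF assms(1,2)] assms(5) unfolding I by blast
  moreover have "ideal (\<Inter>\<Q>) R" using ideal_Inter_primes[OF assms(2)] unfolding I .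
  hence "ext_ideal K p \<subseteq> \<Inter>\<Q> [^]\<^bsub>ideals_set R\<^esub> e"
    using ext_ideal_subset_iff[OF ideal_power] assms(6) by blast
  ultimately show ?thesis unfolding split_type_def using assms(4,5) by auto
qed

lemma ext_ideal_power:
  "ext_ideal K p [^]\<^bsub>ideals_set R\<^esub> n = {of_nat p ^ n * x | x. x \<in> \<O>}"
proof (induction n)
  case (Suc n)
  have "ideal_prod R {of_nat p ^ n * x | x. x \<in> \<O>} {of_nat p * x | x. x \<in> \<O>}
      = {of_nat p ^ Suc n * x | x. x \<in> \<O>}" (is "ideal_prod R ?I ?J = ?P")
  proof
    show "ideal_prod R ?I ?J \<subseteq> ?P"
    proof
      fix s assume "s \<in> ideal_prod R ?I ?J"
      thus "s \<in> ?P"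
      proof (induction rule: ideal_prod.induct)
        case (prod i j)
        then obtain x y where "i = of_nat p ^ n * x" "j = of_nat p * y" "x \<in> \<O>" "y \<in> \<O>" by blast
        thus ?case by (intro CollectI exI[of _ "x * y"]) auto
      next
        case (sum s1 s2)
        then obtain x y where "s1 = of_nat p ^ Suc n * x" "s2 = of_nat p ^ Suc n * y" "x \<in> \<O>" "y \<in> \<O>"
          by blast
        thus ?case by (intro CollectI exI[of _ "x + y"]) (auto simp: algebra_simps)
      qed
    qed
    show "?P \<subseteq> ideal_prod R ?I ?J"
    proof
      fix s assume "s \<in> ?P"
      then obtain x where x: "s = of_nat p ^ Suc n * x" "x \<in> \<O>" by blast
      have "(of_nat p ^ n * x) \<otimes>\<^bsub>R\<^esub> (of_nat p * 1) \<in> ideal_prod R ?I ?J"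
        using x(2) by (intro ideal_prod.prod) blast+
      thus "s \<in> ideal_prod R ?I ?J" by (simp add: x mult_ac)
    qed
  qed
  thus ?case using Suc by (simp add: ext_ideal_eq)
qed simp

text \<open>
  Otherwise \<open>1 / p\<close> would be an algebraic integer.
\<close>

lemma ext_ideal_power_inj:
  assumes "ext_ideal K p [^]\<^bsub>ideals_set R\<^esub> m = ext_ideal K p [^]\<^bsub>ideals_set R\<^esub> (n :: nat)"
  shows "m = n"
proof -
  have "\<not> m < n" if eq: "ext_ideal K p [^]\<^bsub>ideals_set R\<^esub> m = ext_ideal K p [^]\<^bsub>ideals_set R\<^esub> n" for m n :: nat
  proof
    assume "m < n"
    have "of_nat p ^ m * 1 \<in> {of_nat p ^ m * x | x. x \<in> \<O>}" by blast
    then obtain x where x: "x \<in> \<O>" "of_nat p ^ m = of_nat p ^ n * x"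
      using eq unfolding ext_ideal_power by auto
    have p0: "(of_nat p :: complex) \<noteq> 0" using prime_p by auto
    have "of_nat p ^ n = (of_nat p ^ m * (of_nat p * of_nat p ^ (n - m - 1)) :: complex)"
      using \<open>m < n\<close> by (simp flip: power_add power_Suc)
    hence "of_nat p * (of_nat p ^ (n - m - 1) * x) = 1"
      using x(2) p0 by (simp add: mult_ac)
    hence "of_nat p ^ (n - m - 1) * x = inverse (of_nat p)"
      using p0 by (simp add: field_simps)
    moreover have "of_nat p ^ (n - m - 1) * x \<in> \<O>" using x(1) by auto
    ultimately have "algebraic_int (inverse (of_nat p) :: complex)" by (simp add: \<O>_def)
    moreover have "inverse (of_nat p) = (of_rat (1 / of_nat p) :: complex)"
      by (simp add: of_rat_divide inverse_eq_divide)
    ultimately have "1 / of_nat p \<in> (\<int> :: rat set)" by (simp only: rat_in_Ints_if_algebraic_int)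
    then obtain k where "1 / of_nat p = (of_int k :: rat)" by (elim Ints_cases)
    hence "(of_int (int p * k) :: rat) = of_int 1" using p0 by (simp add: field_simps)
    hence "int p * k = 1" by (simp only: of_int_eq_iff)
    hence "int p dvd 1" by (metis dvd_triv_left)
    thus False using prime_p by (simp add: prime_nat_iff)
  qed
  from this[OF assms] this[OF assms[symmetric]] show ?thesis by simp
qed

text \<open>
  If \<open>N\<close> is the radical and \<open>N\<^sup>e = p \<O> = N\<^sup>e\<^sup>'\<close>, then both \<open>(p \<O>)\<^sup>e\<^sup>'\<close> and \<open>(p \<O>)\<^sup>e\<close> equal
  \<open>N\<close> to the power \<open>e e'\<close>. This replaces unique factorization of ideals.
\<close>

lemma split_type_unique:
  assumes "split_type K p g e" "split_type K p g' e'" "g > 0"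
  shows "g = g'" "e = e'"
proof -
  show "g = g'" using assms by (simp add: split_type_def)
  define N where "N = \<Inter>(primes_above K p)"
  have "primes_above K p \<noteq> {}" using assms by (auto simp: split_type_def)
  hence N: "ideal N R"
    using ideal_Inter_primes[of "primes_above K p"] ideal_Inter_primes_nonempty[of "primes_above K p"]
    by (simp add: N_def)
  have e: "N [^]\<^bsub>ideals_set R\<^esub> e = ext_ideal K p" "N [^]\<^bsub>ideals_set R\<^esub> e' = ext_ideal K p"
    using assms by (simp_all add: split_type_def N_def)
  have "ext_ideal K p [^]\<^bsub>ideals_set R\<^esub> e' = N [^]\<^bsub>ideals_set R\<^esub> (e * e')"
    unfolding e(1)[symmetric] using N by (intro ideals.nat_pow_pow) simp
  also have "\<dots> = ext_ideal K p [^]\<^bsub>ideals_set R\<^esub> e"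
    unfolding e(2)[symmetric] using N by (subst ideals.nat_pow_pow) (simp_all add: mult.commute)
  finally show "e = e'" using ext_ideal_power_inj by simp
qed

lemma split_type_one_prime_iff:
  assumes "e > 0"
  shows "split_type K p 1 e \<longleftrightarrow>
    (\<exists>P. primeideal P R \<and> ext_ideal K p = P [^]\<^bsub>ideals_set R\<^esub> e)"
proof
  assume "split_type K p 1 e"
  then obtain P where "primes_above K p = {P}" "ext_ideal K p = \<Inter>{P} [^]\<^bsub>ideals_set R\<^esub> e"
    by (auto simp: split_type_def card_1_singleton_iff)
  thus "\<exists>P. primeideal P R \<and> ext_ideal K p = P [^]\<^bsub>ideals_set R\<^esub> e"
    by (auto simp: primes_above_eq)
next
  assume "\<exists>P. primeideal P R \<and> ext_ideal K p = P [^]\<^bsub>ideals_set R\<^esub> e"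
  then obtain P where P: "primeideal P R" "ext_ideal K p = P [^]\<^bsub>ideals_set R\<^esub> e" by blast
  have "ext_ideal K p \<subseteq> P"
    using ideal_power_subset[OF primeideal_dest(1)[OF P(1)] assms] P(2) by simp
  hence "of_nat p \<in> P" using ext_ideal_subset_iff[OF primeideal_dest(1)[OF P(1)]] by simp
  moreover have "of_nat p \<in> ext_ideal K p" using ext_ideal_subset_iff[OF ideal_ext_ideal] by simp
  ultimately show "split_type K p 1 e"
    using P by (intro split_typeI[of "{P}"]) (auto simp: primes_above_eq)
qed

lemma totally_ramified_iff:
  "field_degree K > 0 \<Longrightarrow> totally_ramified K p \<longleftrightarrow> split_type K p 1 (field_degree K)"
  unfolding totally_ramified_def by (rule split_type_one_prime_iff[symmetric])

lemma inert_iff: "inert K p \<longleftrightarrow> split_type K p 1 1"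
proof -
  have "inert K p \<longleftrightarrow> (\<exists>P. primeideal P R \<and> ext_ideal K p = P [^]\<^bsub>ideals_set R\<^esub> (1 :: nat))"
    unfolding inert_def using ideal_power_1 primeideal_dest(1) by metis
  thus ?thesis using split_type_one_prime_iff[of 1] by simp
qed

lemma one_prime_square_iff:
  "split_type K p 1 2 \<longleftrightarrow>
     (\<exists>P. primes_above K p = {P} \<and> ext_ideal K p = P [^]\<^bsub>ideals_set R\<^esub> (2 :: nat))"
  by (auto simp: split_type_def card_1_singleton_iff)

lemma two_primes_square_iff:
  "split_type K p 2 2 \<longleftrightarrow>
     (\<exists>P1 P2. P1 \<noteq> P2 \<and> primes_above K p = {P1, P2} \<and>
        ext_ideal K p = P1 [^]\<^bsub>ideals_set R\<^esub> (2 :: nat) \<otimes>\<^bsub>ideals_set R\<^esub> P2 [^]\<^bsub>ideals_set R\<^esub> (2 :: nat))"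
proof -
  have *: "P1 [^]\<^bsub>ideals_set R\<^esub> (2 :: nat) \<otimes>\<^bsub>ideals_set R\<^esub> P2 [^]\<^bsub>ideals_set R\<^esub> (2 :: nat)
      = \<Inter>{P1, P2} [^]\<^bsub>ideals_set R\<^esub> (2 :: nat)"
    if "P1 \<noteq> P2" "primes_above K p = {P1, P2}" for P1 P2
  proof -
    have P: "P1 \<in> primes_above K p" "P2 \<in> primes_above K p" using that by auto
    hence "ideal P1 R" "ideal P2 R" by (auto simp: primes_above_eq dest: primeideal_dest)
    hence "P1 [^]\<^bsub>ideals_set R\<^esub> (2 :: nat) \<otimes>\<^bsub>ideals_set R\<^esub> P2 [^]\<^bsub>ideals_set R\<^esub> (2 :: nat)
        = (P1 \<otimes>\<^bsub>ideals_set R\<^esub> P2) [^]\<^bsub>ideals_set R\<^esub> (2 :: nat)"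
      by (intro ideals.nat_pow_distrib[symmetric]) simp_all
    thus ?thesis using two_primes_prod[OF P that(1)] by simp
  qed
  show ?thesis
  proof
    assume s: "split_type K p 2 2"
    then obtain P1 P2 where P: "P1 \<noteq> P2" "primes_above K p = {P1, P2}"
      by (auto simp: split_type_def card_2_iff)
    moreover have "ext_ideal K p = P1 [^]\<^bsub>ideals_set R\<^esub> (2 :: nat) \<otimes>\<^bsub>ideals_set R\<^esub> P2 [^]\<^bsub>ideals_set R\<^esub> (2 :: nat)"
      unfolding *[OF P] using s P(2) by (simp only: split_type_def)
    ultimately show "\<exists>P1 P2. P1 \<noteq> P2 \<and> primes_above K p = {P1, P2} \<and>
        ext_ideal K p = P1 [^]\<^bsub>ideals_set R\<^esub> (2 :: nat) \<otimes>\<^bsub>ideals_set R\<^esub> P2 [^]\<^bsub>ideals_set R\<^esub> (2 :: nat)"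
      by (intro exI conjI)
  next
    assume "\<exists>P1 P2. P1 \<noteq> P2 \<and> primes_above K p = {P1, P2} \<and>
        ext_ideal K p = P1 [^]\<^bsub>ideals_set R\<^esub> (2 :: nat) \<otimes>\<^bsub>ideals_set R\<^esub> P2 [^]\<^bsub>ideals_set R\<^esub> (2 :: nat)"
    thus "split_type K p 2 2"
    proof (elim exE conjE)
      fix P1 P2
      assume P: "P1 \<noteq> P2" "primes_above K p = {P1, P2}"
      assume "ext_ideal K p = P1 [^]\<^bsub>ideals_set R\<^esub> (2 :: nat) \<otimes>\<^bsub>ideals_set R\<^esub> P2 [^]\<^bsub>ideals_set R\<^esub> (2 :: nat)"
      thus "split_type K p 2 2" unfolding *[OF P] split_type_def using P by simp
    qed
  qed
qed

lemma split_type_unramified_iff: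
  assumes "g > 0"
  shows "split_type K p g 1 \<longleftrightarrow>
    (\<exists>S. finite S \<and> card S = g \<and> (\<forall>P\<in>S. primeideal P R) \<and>
         ext_ideal K p = (\<Otimes>\<^bsub>ideals_set R\<^esub>P\<in>S. P))"
proof
  assume s: "split_type K p g 1"
  define S where "S = primes_above K p"
  have S: "finite S" "card S = g" "S \<noteq> {}" "S \<subseteq> primes_above K p" "ext_ideal K p = \<Inter>S [^]\<^bsub>ideals_set R\<^esub> (1 :: nat)"
    using s assms by (auto simp: split_type_def S_def card_gt_0_iff)
  have I: "\<O> \<inter> \<Inter>S = \<Inter>S" by (rule ideal_Inter_primes_nonempty[OF S(4,3)])
  have "ext_ideal K p = \<Inter>S"
    using S(5) ideal_power_1[OF ideal_Inter_primes[OF S(4)]] unfolding I by simp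
  hence "ext_ideal K p = (\<Otimes>\<^bsub>ideals_set R\<^esub>P\<in>S. P)"
    using finprod_primes_eq_Inter[OF S(1,4)] unfolding I by simp
  thus "\<exists>S. finite S \<and> card S = g \<and> (\<forall>P\<in>S. primeideal P R) \<and>
         ext_ideal K p = (\<Otimes>\<^bsub>ideals_set R\<^esub>P\<in>S. P)"
    using S by (intro exI[of _ S]) (auto simp: S_def primes_above_eq)
next
  assume "\<exists>S. finite S \<and> card S = g \<and> (\<forall>P\<in>S. primeideal P R) \<and>
         ext_ideal K p = (\<Otimes>\<^bsub>ideals_set R\<^esub>P\<in>S. P)"
  then obtain S where S: "finite S" "card S = g" "\<And>P. P \<in> S \<Longrightarrow> primeideal P R"
      "ext_ideal K p = (\<Otimes>\<^bsub>ideals_set R\<^esub>P\<in>S. P)" by blast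
  have ideals: "ideal P R" if "P \<in> S" for P using S(3)[OF that] by (rule primeideal_dest)
  have p: "of_nat p \<in> ext_ideal K p" using ext_ideal_subset_iff[OF ideal_ext_ideal] by simp
  have above: "S \<subseteq> primes_above K p"
  proof
    fix P assume P: "P \<in> S"
    have "(\<Otimes>\<^bsub>ideals_set R\<^esub>Q\<in>S. Q) = P \<otimes>\<^bsub>ideals_set R\<^esub> (\<Otimes>\<^bsub>ideals_set R\<^esub>Q\<in>S - {P}. Q)"
      using ideals.finprod_insert[of "S - {P}" P "\<lambda>Q. Q"] S(1) P ideals
      unfolding insert_Diff[OF P] by (simp add: Pi_def)
    moreover have "ideal (\<Otimes>\<^bsub>ideals_set R\<^esub>Q\<in>S - {P}. Q) R"
      using ideals.finprod_closed[of "\<lambda>Q. Q" "S - {P}"] ideals by auto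
    ultimately have "ext_ideal K p \<subseteq> P"
      using ideal_prod_inter[OF ideals[OF P]] S(4) by auto
    thus "P \<in> primes_above K p" using p S(3)[OF P] by (auto simp: primes_above_eq)
  qed
  have "S \<noteq> {}" using S(2) assms by auto
  note I = ideal_Inter_primes_nonempty[OF above this]
  have "\<Inter>S [^]\<^bsub>ideals_set R\<^esub> (1 :: nat) = ext_ideal K p"
    using ideal_power_1[OF ideal_Inter_primes[OF above]] finprod_primes_eq_Inter[OF S(1) above] S(4)
    unfolding I by simp
  thus "split_type K p g 1"
    using split_typeI[OF S(1) above \<open>S \<noteq> {}\<close> S(2)] p by simp
qed

lemma splits_totally_iff:
  "field_degree K > 0 \<Longrightarrow> splits_totally K p \<longleftrightarrow> split_type K p (field_degree K) 1"
  unfolding splits_totally_def by (rule split_type_unramified_iff[symmetric])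

lemma split_type_2_1_imp_two_primes:
  assumes "split_type K p 2 1"
  shows "\<exists>P1 P2. primeideal P1 R \<and> primeideal P2 R \<and> P1 \<noteq> P2 \<and>
           ext_ideal K p = P1 \<otimes>\<^bsub>ideals_set R\<^esub> P2"
proof -
  obtain P1 P2 where P: "primes_above K p = {P1, P2}" "P1 \<noteq> P2"
    using assms by (auto simp: split_type_def card_2_iff)
  hence above: "P1 \<in> primes_above K p" "P2 \<in> primes_above K p" by auto
  have "ideal (P1 \<inter> P2) R"
    using ideal_Inter_primes[of "{P1, P2}"] ideal_Inter_primes_nonempty[of "{P1, P2}"] P by simp
  hence "ext_ideal K p = P1 \<inter> P2"
    using assms ideal_power_1 P by (simp add: split_type_def)
  hence "ext_ideal K p = P1 \<otimes>\<^bsub>ideals_set R\<^esub> P2"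
    using two_primes_prod[OF above P(2)] by simp
  moreover have "primeideal P1 R" "primeideal P2 R" using above by (simp_all add: primes_above_eq)
  ultimately show ?thesis using P(2) by blast
qed

end

section \<open>Coordinates modulo an odd prime\<close>

locale cyclic_quartic_at_prime = cyclic_quartic +
  fixes p :: nat
  assumes prime: "Factorial_Ring.prime p" and odd: "odd p"
begin

abbreviation ei :: "int \<Rightarrow> int \<Rightarrow> int \<Rightarrow> int \<Rightarrow> complex" where
  "ei x y z w \<equiv> el (of_int x) (of_int y) (of_int z) (of_int w)"

lemma prime_int: "Factorial_Ring.prime (int p)"
  using prime by simp

lemma int_p_dvd_mult_iff: "int p dvd x * y \<longleftrightarrow> int p dvd x \<or> int p dvd y"
  using prime_int by (rule prime_dvd_mult_iff)

lemma int_p_dvd_power2_iff: "int p dvd x\<^sup>2 \<longleftrightarrow> int p dvd x"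
  using prime_int by (simp add: prime_dvd_power_iff)

lemma not_int_p_dvd_2: "\<not> int p dvd 2"
proof
  assume "int p dvd 2"
  hence "int p \<le> 2" by (rule zdvd_imp_le) simp
  hence "p = 2" using prime_ge_2_nat[OF prime] by simp
  thus False using odd by simp
qed

lemma int_p_dvd_2_mult_iff: "int p dvd 2 * x \<longleftrightarrow> int p dvd x"
  using not_int_p_dvd_2 by (simp add: int_p_dvd_mult_iff)

lemma not_int_p_dvd_1: "\<not> int p dvd 1"
  using prime_int not_prime_unit by blast

lemma bezout_int_p:
  assumes "\<not> int p dvd k"
  obtains u v where "k * u + int p * v = 1"
proof -
  have "coprime (int p) k" using assms prime_int by (simp add: prime_imp_coprime)
  then obtain u v where "u * int p + v * k = 1" using bezout_int[of "int p" k] by auto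
  thus ?thesis using that[of v u] by (simp add: algebra_simps)
qed

lemma four_times_integer:
  assumes "algebraic_int t" "t \<in> quartic_field"
  obtains x y z w where "4 * t = ei x y z w"
proof -
  obtain x y z w where t: "t = el x y z w" using assms(2) by (rule quartic_fieldE)
  note * = four_times_coordinates_in_Ints[OF assms(1)[unfolded t]]
  obtain x' where x': "4 * x = of_int x'" using *(1) by (auto elim: Ints_cases)
  obtain y' where y': "4 * y = of_int y'" using *(2) by (auto elim: Ints_cases)
  obtain z' where z': "4 * z = of_int z'" using *(3) by (auto elim: Ints_cases)
  obtain w' where w': "4 * w = of_int w'" using *(4) by (auto elim: Ints_cases)
  have "4 * t = of_rat 4 * el x y z w" by (simp add: t)
  also have "\<dots> = ei x' y' z' w'" unfolding el_scale x' y' z' w' ..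
  finally show ?thesis by (rule that)
qed

lemma ei_add: "ei x y z w + ei x' y' z' w' = ei (x + x') (y + y') (z + z') (w + w')"
  and ei_diff: "ei x y z w - ei x' y' z' w' = ei (x - x') (y - y') (z - z') (w - w')"
  and ei_scale: "of_int k * ei x y z w = ei (k * x) (k * y) (k * z) (k * w)"
  using el_scale[of "of_int k" "of_int x" "of_int y" "of_int z" "of_int w"]
  by (simp_all add: el_add el_diff)

text \<open>
  The denominator 4 is invertible modulo \<open>p\<close>.
\<close>

lemma congruent_to_ei:
  assumes "algebraic_int s" "s \<in> quartic_field"
  obtains x y z w t where "algebraic_int t" "t \<in> quartic_field" "s = ei x y z w + of_nat p * t"
proof -
  have "\<not> int p dvd 2 * 2" unfolding int_p_dvd_2_mult_iff by (rule not_int_p_dvd_2)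
  then obtain k m where km: "4 * k + int p * m = 1" using bezout_int_p[of 4] by auto
  obtain x y z w where s: "4 * s = ei x y z w" using four_times_integer[OF assms] .
  have "s = of_int (4 * k + int p * m) * s" by (simp only: km of_int_1 mult_1_left)
  also have "\<dots> = of_int k * (4 * s) + of_nat p * (of_int m * s)" by (simp add: algebra_simps)
  also have "of_int k * (4 * s) = ei (k * x) (k * y) (k * z) (k * w)" unfolding s by (rule ei_scale)
  finally have "s = ei (k * x) (k * y) (k * z) (k * w) + of_nat p * (of_int m * s)" .
  moreover have "algebraic_int (of_int m * s)"
    by (intro algebraic_int_mult int_imp_algebraic_int Ints_of_int assms(1))
  moreover have "of_int m * s \<in> quartic_field"
    by (intro quartic_field_closed of_int_in_quartic_field assms(2))
  ultimately show ?thesis by (intro that[of "of_int m * s"])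
qed

sublocale finite_residue_ring quartic_field p
proof
  show "1 \<in> quartic_field" using of_int_in_quartic_field[of 1] by (simp del: of_int_in_quartic_field)
  define Y where "Y = (\<lambda>(x, y, z, w). ei x y z w) ` ({0..<int p} \<times> {0..<int p} \<times> {0..<int p} \<times> {0..<int p})"
  have "\<exists>y\<in>Y. \<exists>t. t \<in> quartic_field \<and> algebraic_int t \<and> s = y + of_nat p * t"
    if s: "s \<in> quartic_field \<and> algebraic_int s" for s
  proof -
    obtain x y z w t where t: "algebraic_int t" "t \<in> quartic_field" "s = ei x y z w + of_nat p * t"
      by (rule congruent_to_ei[of s]) (use s in auto)
    define u where "u = ei (x div int p) (y div int p) (z div int p) (w div int p)"
    have "ei x y z w = ei (x mod int p) (y mod int p) (z mod int p) (w mod int p) + of_int (int p) * u"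
      unfolding u_def ei_scale ei_add by (simp only: mod_mult_div_eq add.commute mult_div_mod_eq)
    hence "s = ei (x mod int p) (y mod int p) (z mod int p) (w mod int p) + of_nat p * (u + t)"
      using t(3) by (simp add: algebra_simps)
    moreover have "ei (x mod int p) (y mod int p) (z mod int p) (w mod int p) \<in> Y"
      unfolding Y_def using prime_gt_0_nat[OF prime]
      by (intro image_eqI[of _ _ "(x mod int p, y mod int p, z mod int p, w mod int p)"]) auto
    moreover have "u + t \<in> quartic_field" "algebraic_int (u + t)"
      unfolding u_def using t(1,2) algebraic_int_el_of_int
      by (auto intro: quartic_field_closed algebraic_int_add)
    ultimately show ?thesis by blast
  qed
  moreover have "finite Y" by (simp add: Y_def)
  ultimately show "\<exists>Y. finite Y \<and> (\<forall>x. x \<in> quartic_field \<and> algebraic_int x \<longrightarrow>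
      (\<exists>y\<in>Y. \<exists>t. t \<in> quartic_field \<and> algebraic_int t \<and> x = y + of_nat p * t))"
    by blast
qed (use prime in \<open>auto intro: quartic_field_closed\<close>)

lemma ei_in_\<O> [simp, intro]: "ei x y z w \<in> \<O>"
  by (simp add: \<O>_def algebraic_int_el_of_int)

text \<open>
  Congruence modulo \<open>p \<O>\<close> to an integer combination of the basis. The coefficients exist and are
  unique modulo \<open>p\<close> (\<open>rep_exists\<close>, \<open>rep_unique\<close>): they are coordinates on \<open>\<O> / p \<O>\<close>.
\<close>

definition rep :: "complex \<Rightarrow> int \<Rightarrow> int \<Rightarrow> int \<Rightarrow> int \<Rightarrow> bool" where
  "rep s x y z w \<longleftrightarrow> (\<exists>t\<in>\<O>. s = ei x y z w + of_nat p * t)"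

lemma rep_exists:
  assumes "s \<in> \<O>"
  obtains x y z w where "rep s x y z w"
proof -
  have "algebraic_int s" "s \<in> quartic_field" using assms by (simp_all add: \<O>_def)
  then obtain x y z w t where "algebraic_int t" "t \<in> quartic_field" "s = ei x y z w + of_nat p * t"
    by (rule congruent_to_ei)
  hence "rep s x y z w" unfolding rep_def \<O>_def by (intro bexI[of _ t]) simp_all
  thus ?thesis by (rule that)
qed

lemma rep_mem: "rep s x y z w \<Longrightarrow> s \<in> \<O>"
  unfolding rep_def by auto

lemma rep_ei: "rep (ei x y z w) x y z w"
  unfolding rep_def by (intro bexI[of _ 0]) auto

lemma rep_p: "rep (of_nat p) 0 0 0 0"
  unfolding rep_def by (intro bexI[of _ 1]) (auto simp: el_0)

lemma rep_add:
  assumes "rep s x y z w" "rep s' x' y' z' w'"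
  shows "rep (s + s') (x + x') (y + y') (z + z') (w + w')"
proof -
  obtain t t' where t: "t \<in> \<O>" "s = ei x y z w + of_nat p * t"
      "t' \<in> \<O>" "s' = ei x' y' z' w' + of_nat p * t'"
    using assms unfolding rep_def by blast
  thus ?thesis unfolding rep_def ei_add[symmetric]
    by (intro bexI[of _ "t + t'"]) (auto simp: algebra_simps)
qed

lemma rep_unique:
  assumes "rep s x y z w" "rep s x' y' z' w'"
  shows "int p dvd x - x'" "int p dvd y - y'" "int p dvd z - z'" "int p dvd w - w'"
proof -
  obtain t t' where t: "t \<in> \<O>" "s = ei x y z w + of_nat p * t"
      "t' \<in> \<O>" "s = ei x' y' z' w' + of_nat p * t'"
    using assms unfolding rep_def by blast
  have "t' - t \<in> \<O>" using t by auto
  hence "algebraic_int (t' - t)" "t' - t \<in> quartic_field" by (simp_all add: \<O>_def)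
  then obtain k l m n where k: "4 * (t' - t) = ei k l m n" by (rule four_times_integer)
  have "ei (x - x') (y - y') (z - z') (w - w') = of_nat p * (t' - t)"
    unfolding ei_diff[symmetric] using t by (simp add: algebra_simps)
  hence "of_int 4 * ei (x - x') (y - y') (z - z') (w - w') = of_int (int p) * (4 * (t' - t))" by simp
  hence *: "ei (4 * (x - x')) (4 * (y - y')) (4 * (z - z')) (4 * (w - w')) = ei (int p * k) (int p * l) (int p * m) (int p * n)"
    unfolding k ei_scale .
  have "int p dvd v" if "4 * v = int p * u" for u v :: int
  proof -
    have "int p dvd 2 * (2 * v)" using that by simp
    thus ?thesis unfolding int_p_dvd_2_mult_iff .
  qed
  thus "int p dvd x - x'" "int p dvd y - y'" "int p dvd z - z'" "int p dvd w - w'"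
    using * unfolding el_eq_iff of_int_eq_iff by blast+
qed

definition mul0 :: "int \<Rightarrow> int \<Rightarrow> int \<Rightarrow> int \<Rightarrow> int \<Rightarrow> int \<Rightarrow> int \<Rightarrow> int \<Rightarrow> int" where
  "mul0 x y z w x' y' z' w' = x * x' + d * (y * y') + a * d * (z * z' + w * w')"

definition mul1 :: "int \<Rightarrow> int \<Rightarrow> int \<Rightarrow> int \<Rightarrow> int \<Rightarrow> int \<Rightarrow> int \<Rightarrow> int \<Rightarrow> int" where
  "mul1 x y z w x' y' z' w' = x * y' + y * x' + a * b * (w * w' - z * z') + a * c * (z * w' + w * z')"

definition mul2 :: "int \<Rightarrow> int \<Rightarrow> int \<Rightarrow> int \<Rightarrow> int \<Rightarrow> int \<Rightarrow> int \<Rightarrow> int \<Rightarrow> int" where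
  "mul2 x y z w x' y' z' w' = x * z' + z * x' + c * (y * w' + w * y') - b * (y * z' + z * y')"

definition mul3 :: "int \<Rightarrow> int \<Rightarrow> int \<Rightarrow> int \<Rightarrow> int \<Rightarrow> int \<Rightarrow> int \<Rightarrow> int \<Rightarrow> int" where
  "mul3 x y z w x' y' z' w' = x * w' + w * x' + c * (y * z' + z * y') + b * (y * w' + w * y')"

lemmas mul_defs = mul0_def mul1_def mul2_def mul3_def

lemma ei_mult:
  "ei x y z w * ei x' y' z' w' =
     ei (mul0 x y z w x' y' z' w') (mul1 x y z w x' y' z' w') (mul2 x y z w x' y' z' w') (mul3 x y z w x' y' z' w')"
  unfolding el_mult el_eq_iff mul_defs by simp

lemma rep_mult:
  assumes "rep s x y z w" "rep s' x' y' z' w'"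
  shows "rep (s * s') (mul0 x y z w x' y' z' w') (mul1 x y z w x' y' z' w')
           (mul2 x y z w x' y' z' w') (mul3 x y z w x' y' z' w')"
proof -
  obtain t t' where t: "t \<in> \<O>" "s = ei x y z w + of_nat p * t"
      "t' \<in> \<O>" "s' = ei x' y' z' w' + of_nat p * t'"
    using assms unfolding rep_def by blast
  show ?thesis unfolding rep_def ei_mult[symmetric]
  proof (intro bexI)
    show "s * s' = ei x y z w * ei x' y' z' w' + of_nat p * (ei x y z w * t' + t * s')"
      unfolding t(2) t(4) by (simp add: algebra_simps)
    show "ei x y z w * t' + t * s' \<in> \<O>" using t rep_mem[OF assms(2)] by auto
  qed
qed

text \<open>
  Ideals containing \<open>p\<close> are described by conditions \<open>Q\<close> on the coordinates modulo \<open>p\<close>.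
\<close>

definition cong_ideal :: "(int \<Rightarrow> int \<Rightarrow> int \<Rightarrow> int \<Rightarrow> bool) \<Rightarrow> complex set" where
  "cong_ideal Q = {s. \<exists>x y z w. rep s x y z w \<and> Q x y z w}"

definition cong_subgroup :: "(int \<Rightarrow> int \<Rightarrow> int \<Rightarrow> int \<Rightarrow> bool) \<Rightarrow> bool" where
  "cong_subgroup Q \<longleftrightarrow>
     (\<forall>x y z w. int p dvd x \<longrightarrow> int p dvd y \<longrightarrow> int p dvd z \<longrightarrow> int p dvd w \<longrightarrow> Q x y z w) \<and>
     (\<forall>x y z w x' y' z' w'. Q x y z w \<longrightarrow> Q x' y' z' w' \<longrightarrow> Q (x + x') (y + y') (z + z') (w + w'))"

lemma cong_subgroup_zero:
  "cong_subgroup Q \<Longrightarrow> int p dvd x \<Longrightarrow> int p dvd y \<Longrightarrow> int p dvd z \<Longrightarrow> int p dvd w \<Longrightarrow> Q x y z w"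
  by (simp add: cong_subgroup_def)

lemma cong_subgroup_add:
  "cong_subgroup Q \<Longrightarrow> Q x y z w \<Longrightarrow> Q x' y' z' w' \<Longrightarrow> Q (x + x') (y + y') (z + z') (w + w')"
  by (simp add: cong_subgroup_def)

lemma cong_ideal_iff:
  assumes "cong_subgroup Q" "rep s x y z w"
  shows "s \<in> cong_ideal Q \<longleftrightarrow> Q x y z w"
proof
  assume "s \<in> cong_ideal Q"
  then obtain x' y' z' w' where r: "rep s x' y' z' w'" and Q: "Q x' y' z' w'"
    unfolding cong_ideal_def by blast
  have "Q (x' + (x - x')) (y' + (y - y')) (z' + (z - z')) (w' + (w - w'))"
    by (intro cong_subgroup_add[OF assms(1)] Q cong_subgroup_zero[OF assms(1)] rep_unique[OF assms(2) r])
  thus "Q x y z w" by simp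
qed (use assms(2) in \<open>auto simp: cong_ideal_def\<close>)

lemma cong_ideal_subset: "cong_ideal Q \<subseteq> \<O>"
  unfolding cong_ideal_def using rep_mem by blast

lemma cong_ideal_add:
  assumes "cong_subgroup Q" "s \<in> cong_ideal Q" "s' \<in> cong_ideal Q"
  shows "s + s' \<in> cong_ideal Q"
proof -
  obtain x y z w where 1: "rep s x y z w" "Q x y z w"
    using assms(2) unfolding cong_ideal_def by blast
  obtain x' y' z' w' where 2: "rep s' x' y' z' w'" "Q x' y' z' w'"
    using assms(3) unfolding cong_ideal_def by blast
  show ?thesis
    unfolding cong_ideal_iff[OF assms(1) rep_add[OF 1(1) 2(1)]]
    by (rule cong_subgroup_add[OF assms(1) 1(2) 2(2)])
qed

lemma ideal_cong_ideal:
  assumes "cong_subgroup Q"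
    and mult: "\<And>x y z w x' y' z' w'. Q x' y' z' w' \<Longrightarrow>
      Q (mul0 x y z w x' y' z' w') (mul1 x y z w x' y' z' w') (mul2 x y z w x' y' z' w') (mul3 x y z w x' y' z' w')"
  shows "ideal (cong_ideal Q) R"
proof (rule ideal_intro)
  show "0 \<in> cong_ideal Q"
    using cong_ideal_iff[OF assms(1) rep_ei[of 0 0 0 0]] assms(1) by (simp add: el_0 cong_subgroup_def)
  show "s * s' \<in> cong_ideal Q" if "s \<in> \<O>" and s': "s' \<in> cong_ideal Q" for s s'
  proof -
    obtain x y z w where r: "rep s x y z w" using \<open>s \<in> \<O>\<close> by (rule rep_exists)
    obtain x' y' z' w' where r': "rep s' x' y' z' w'" "Q x' y' z' w'"
      using s' unfolding cong_ideal_def by blast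
    show ?thesis
      using cong_ideal_iff[OF assms(1) rep_mult[OF r r'(1)]] mult[OF r'(2)] by simp
  qed
qed (use cong_ideal_subset cong_ideal_add[OF assms(1)] in auto)

lemma prime_cong_ideal:
  assumes "cong_subgroup Q"
    and "\<And>x y z w x' y' z' w'. Q x' y' z' w' \<Longrightarrow>
      Q (mul0 x y z w x' y' z' w') (mul1 x y z w x' y' z' w') (mul2 x y z w x' y' z' w') (mul3 x y z w x' y' z' w')"
    and "\<not> Q 1 0 0 0"
    and prime: "\<And>x y z w x' y' z' w'.
      Q (mul0 x y z w x' y' z' w') (mul1 x y z w x' y' z' w') (mul2 x y z w x' y' z' w') (mul3 x y z w x' y' z' w')
      \<Longrightarrow> Q x y z w \<or> Q x' y' z' w'"
  shows "cong_ideal Q \<in> primes_above quartic_field p"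
proof -
  note iff = cong_ideal_iff[OF assms(1)]
  have "primeideal (cong_ideal Q) R"
  proof (rule primeideal_intro)
    show "ideal (cong_ideal Q) R" by (rule ideal_cong_ideal[OF assms(1,2)])
    show "1 \<notin> cong_ideal Q" using iff[OF rep_ei[of 1 0 0 0]] assms(3) by (simp add: el_rat)
    show "s \<in> cong_ideal Q \<or> s' \<in> cong_ideal Q" if ss': "s \<in> \<O>" "s' \<in> \<O>" "s * s' \<in> cong_ideal Q" for s s'
    proof -
      obtain x y z w where r: "rep s x y z w" using ss'(1) by (rule rep_exists)
      obtain x' y' z' w' where r': "rep s' x' y' z' w'" using ss'(2) by (rule rep_exists)
      show ?thesis
        using ss'(3) unfolding iff[OF r] iff[OF r'] iff[OF rep_mult[OF r r']] by (rule prime)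
    qed
  qed
  moreover have "of_nat p \<in> cong_ideal Q"
    using iff[OF rep_p] assms(1) by (simp add: cong_subgroup_def)
  ultimately show ?thesis by (simp add: primes_above_eq)
qed

lemma cong_ideal_prod_subset:
  assumes "cong_subgroup Q3"
    and "\<And>x y z w x' y' z' w'. Q1 x y z w \<Longrightarrow> Q2 x' y' z' w' \<Longrightarrow>
      Q3 (mul0 x y z w x' y' z' w') (mul1 x y z w x' y' z' w') (mul2 x y z w x' y' z' w') (mul3 x y z w x' y' z' w')"
    and "I \<subseteq> cong_ideal Q1"
  shows "ideal_prod R I (cong_ideal Q2) \<subseteq> cong_ideal Q3"
proof
  fix s assume "s \<in> ideal_prod R I (cong_ideal Q2)"
  thus "s \<in> cong_ideal Q3"
  proof (induction rule: ideal_prod.induct)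
    case (prod i j)
    have "i \<in> cong_ideal Q1" using prod(1) assms(3) by blast
    then obtain x y z w where 1: "rep i x y z w" "Q1 x y z w" unfolding cong_ideal_def by blast
    obtain x' y' z' w' where 2: "rep j x' y' z' w'" "Q2 x' y' z' w'"
      using prod(2) unfolding cong_ideal_def by blast
    have "i * j \<in> cong_ideal Q3"
      unfolding cong_ideal_iff[OF assms(1) rep_mult[OF 1(1) 2(1)]] by (rule assms(2)[OF 1(2) 2(2)])
    thus ?case by simp
  next
    case (sum s1 s2)
    thus ?case using cong_ideal_add[OF assms(1)] by simp
  qed
qed

lemma ext_ideal_eq_cong_ideal:
  "ext_ideal quartic_field p =
     cong_ideal (\<lambda>x y z w. int p dvd x \<and> int p dvd y \<and> int p dvd z \<and> int p dvd w)"
proof (intro equalityI subsetI)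
  fix s assume "s \<in> ext_ideal quartic_field p"
  then obtain t where "t \<in> \<O>" "s = of_nat p * t" unfolding ext_ideal_eq by blast
  hence "rep s 0 0 0 0" unfolding rep_def by (auto simp: el_0)
  thus "s \<in> cong_ideal (\<lambda>x y z w. int p dvd x \<and> int p dvd y \<and> int p dvd z \<and> int p dvd w)"
    unfolding cong_ideal_def by auto
next
  fix s assume "s \<in> cong_ideal (\<lambda>x y z w. int p dvd x \<and> int p dvd y \<and> int p dvd z \<and> int p dvd w)"
  then obtain x y z w t where t: "t \<in> \<O>" "s = ei (int p * x) (int p * y) (int p * z) (int p * w) + of_nat p * t"
    unfolding cong_ideal_def rep_def dvd_def by blast
  have "s = of_nat p * (ei x y z w + t)"
    unfolding t(2) ei_scale[symmetric] by (simp add: algebra_simps)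
  thus "s \<in> ext_ideal quartic_field p" unfolding ext_ideal_eq using t(1) by blast
qed

lemma cong_subgroup_linear:
  "cong_subgroup (\<lambda>x y z w. int p dvd k * x + l * y + m * z + n * w)"
  unfolding cong_subgroup_def
proof (intro conjI allI impI)
  fix x y z w x' y' z' w'
  assume "int p dvd k * x + l * y + m * z + n * w" "int p dvd k * x' + l * y' + m * z' + n * w'"
  hence "int p dvd (k * x + l * y + m * z + n * w) + (k * x' + l * y' + m * z' + n * w')" by (rule dvd_add)
  thus "int p dvd k * (x + x') + l * (y + y') + m * (z + z') + n * (w + w')"
    by (simp add: algebra_simps)
qed auto

lemma cong_subgroup_conj:
  "cong_subgroup Q1 \<Longrightarrow> cong_subgroup Q2 \<Longrightarrow> cong_subgroup (\<lambda>x y z w. Q1 x y z w \<and> Q2 x y z w)"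
  unfolding cong_subgroup_def by simp

lemma cong_subgroup_coordinates:
  "cong_subgroup (\<lambda>x y z w. int p dvd x)" "cong_subgroup (\<lambda>x y z w. int p dvd y)"
  "cong_subgroup (\<lambda>x y z w. int p dvd z)" "cong_subgroup (\<lambda>x y z w. int p dvd w)"
  using cong_subgroup_linear[of 1 0 0 0] cong_subgroup_linear[of 0 1 0 0]
    cong_subgroup_linear[of 0 0 1 0] cong_subgroup_linear[of 0 0 0 1] by simp_all

section \<open>Primes as kernels of reduction maps\<close>

text \<open>
  If \<open>n\<close> is not a square modulo \<open>p\<close>, the ring \<open>\<int> / p\<close> with a square root of \<open>n\<close> adjoined is a
  field: its norm form is anisotropic.
\<close>

lemma norm_form_dvd_imp:
  assumes "\<not> QuadRes (int p) n" "int p dvd u\<^sup>2 - n * v\<^sup>2"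
  shows "int p dvd u" "int p dvd v"
proof -
  show v: "int p dvd v"
  proof (rule ccontr)
    assume "\<not> int p dvd v"
    then obtain i j where ij: "v * i + int p * j = 1" by (rule bezout_int_p)
    obtain m where m: "u\<^sup>2 - n * v\<^sup>2 = int p * m" using assms(2) by (elim dvdE)
    have vi: "v * i = 1 - int p * j" using ij by simp
    have "(u * i)\<^sup>2 - n = (u\<^sup>2 - n * v\<^sup>2) * i\<^sup>2 + n * ((v * i)\<^sup>2 - 1)"
      by (simp add: power_mult_distrib algebra_simps)
    also have "\<dots> = int p * (m * i\<^sup>2 + n * (int p * j\<^sup>2 - 2 * j))"
      unfolding m vi by (simp add: power2_eq_square algebra_simps)
    finally have "int p dvd (u * i)\<^sup>2 - n" by simp
    hence "QuadRes (int p) n" unfolding QuadRes_def cong_iff_dvd_diff by blast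
    thus False using assms(1) by blast
  qed
  have "int p dvd (u\<^sup>2 - n * v\<^sup>2) + n * v * v" using assms(2) v by (intro dvd_add dvd_mult)
  hence "int p dvd u\<^sup>2" by (simp add: power2_eq_square algebra_simps)
  thus "int p dvd u" by (simp add: int_p_dvd_power2_iff)
qed

lemma norm_form_prime:
  assumes n: "\<not> QuadRes (int p) n"
    and 1: "int p dvd u * u' + n * (v * v')" and 2: "int p dvd u * v' + u' * v"
  shows "int p dvd u \<and> int p dvd v \<or> int p dvd u' \<and> int p dvd v'"
proof (cases "int p dvd u\<^sup>2 - n * v\<^sup>2")
  case True
  thus ?thesis using norm_form_dvd_imp[OF n] by blast
next
  case False
  have "int p dvd u * (u * v' + u' * v) - v * (u * u' + n * (v * v'))"
    using 1 2 by (intro dvd_diff dvd_mult)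
  hence "int p dvd (u\<^sup>2 - n * v\<^sup>2) * v'" by (simp add: power2_eq_square algebra_simps)
  moreover have "int p dvd u * (u * u' + n * (v * v')) - n * v * (u * v' + u' * v)"
    using 1 2 by (intro dvd_diff dvd_mult)
  hence "int p dvd (u\<^sup>2 - n * v\<^sup>2) * u'" by (simp add: power2_eq_square algebra_simps)
  ultimately show ?thesis using False by (simp add: int_p_dvd_mult_iff)
qed

text \<open>
  These are the relations \<open>\<delta>\<^sup>2 = d\<close>, \<open>\<delta> \<beta> = c \<gamma> - b \<beta>\<close>, \<open>\<delta> \<gamma> = c \<beta> + b \<gamma>\<close>,
  \<open>\<beta>\<^sup>2 = a d - a b \<delta>\<close>, \<open>\<gamma>\<^sup>2 = a d + a b \<delta>\<close>, \<open>\<beta> \<gamma> = a c \<delta>\<close> after the substitution \<open>\<delta> \<mapsto> r\<close>,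
  \<open>\<beta> \<mapsto> \<mu> \<theta>\<close>, \<open>\<gamma> \<mapsto> \<nu> \<theta>\<close> with \<open>\<theta>\<^sup>2 = n\<close>. So they say that the substitution is a ring
  homomorphism from the integer span of the basis to \<open>\<int> / p\<close> with a root \<open>\<theta>\<close> of \<open>n\<close> adjoined.
  The image of an element has the two components \<open>x + r y\<close> and \<open>\<mu> z + \<nu> w\<close>.
\<close>

definition reduction_map :: "int \<Rightarrow> int \<Rightarrow> int \<Rightarrow> int \<Rightarrow> bool" where
  "reduction_map r \<mu> \<nu> n \<longleftrightarrow>
     int p dvd d - r\<^sup>2 \<and>
     int p dvd (c * \<nu> - b * \<mu>) - r * \<mu> \<and> int p dvd (c * \<mu> + b * \<nu>) - r * \<nu> \<and>
     int p dvd (a * d - a * b * r) - n * \<mu>\<^sup>2 \<and> int p dvd (a * d + a * b * r) - n * \<nu>\<^sup>2 \<and>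
     int p dvd a * c * r - n * \<mu> * \<nu>"

lemma reduction_map_mult:
  assumes "reduction_map r \<mu> \<nu> n"
  shows "int p dvd ((mul0 x y z w x' y' z' w') + r * (mul1 x y z w x' y' z' w'))
      - ((x + r * y) * (x' + r * y') + n * ((\<mu> * z + \<nu> * w) * (\<mu> * z' + \<nu> * w')))" (is "_ dvd ?A")
    and "int p dvd (\<mu> * (mul2 x y z w x' y' z' w') + \<nu> * (mul3 x y z w x' y' z' w'))
      - ((x + r * y) * (\<mu> * z' + \<nu> * w') + (x' + r * y') * (\<mu> * z + \<nu> * w))" (is "_ dvd ?B")
proof -
  have r: "int p dvd d - r\<^sup>2" "int p dvd (c * \<nu> - b * \<mu>) - r * \<mu>" "int p dvd (c * \<mu> + b * \<nu>) - r * \<nu>"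
     "int p dvd (a * d - a * b * r) - n * \<mu>\<^sup>2" "int p dvd (a * d + a * b * r) - n * \<nu>\<^sup>2"
     "int p dvd a * c * r - n * \<mu> * \<nu>"
    using assms by (simp_all add: reduction_map_def)
  have "?A = (y * y') * (d - r\<^sup>2) + (z * z') * ((a * d - a * b * r) - n * \<mu>\<^sup>2)
      + (w * w') * ((a * d + a * b * r) - n * \<nu>\<^sup>2) + (z * w' + w * z') * (a * c * r - n * \<mu> * \<nu>)"
    unfolding mul_defs by (simp add: power2_eq_square algebra_simps)
  thus "int p dvd ?A" using r by (auto intro!: dvd_add dvd_mult)
  have "?B = (y * z' + z * y') * ((c * \<nu> - b * \<mu>) - r * \<mu>) + (y * w' + w * y') * ((c * \<mu> + b * \<nu>) - r * \<nu>)"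
    unfolding mul_defs by (simp add: algebra_simps)
  thus "int p dvd ?B" using r by (auto intro!: dvd_add dvd_mult)
qed

lemma dvd_iff_if_dvd_diff: "int p dvd x - y \<Longrightarrow> int p dvd x \<longleftrightarrow> int p dvd y"
  by (metis dvd_diff_commute diff_add_cancel dvd_add_right_iff)

text \<open>
  The kernel of a reduction map when \<open>n\<close> has a square root \<open>\<theta>\<close> in \<open>\<int> / p\<close>, so that the image
  is \<open>\<int> / p\<close>.
\<close>

definition prime_deg1 :: "int \<Rightarrow> int \<Rightarrow> int \<Rightarrow> int \<Rightarrow> complex set" where
  "prime_deg1 r \<mu> \<nu> \<theta> = cong_ideal (\<lambda>x y z w. int p dvd 1 * x + r * y + (\<theta> * \<mu>) * z + (\<theta> * \<nu>) * w)"

text \<open>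
  The kernel of a reduction map when \<open>n\<close> is not a square modulo \<open>p\<close>: both components vanish.
\<close>

definition prime_deg2 :: "int \<Rightarrow> int \<Rightarrow> int \<Rightarrow> complex set" where
  "prime_deg2 r \<mu> \<nu> = cong_ideal (\<lambda>x y z w. int p dvd 1 * x + r * y + 0 * z + 0 * w \<and>
     int p dvd 0 * x + 0 * y + \<mu> * z + \<nu> * w)"

lemma prime_deg1_above:
  assumes reduction_map: "reduction_map r \<mu> \<nu> n" and \<theta>: "int p dvd \<theta>\<^sup>2 - n"
  shows "prime_deg1 r \<mu> \<nu> \<theta> \<in> primes_above quartic_field p"
proof -
  define L where "L = (\<lambda>x y z w. 1 * x + r * y + (\<theta> * \<mu>) * z + (\<theta> * \<nu>) * w)"
  have mult: "int p dvd L (mul0 x y z w x' y' z' w') (mul1 x y z w x' y' z' w')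
      (mul2 x y z w x' y' z' w') (mul3 x y z w x' y' z' w') - L x y z w * L x' y' z' w'" (is "_ dvd ?D")
    for x y z w x' y' z' w'
  proof -
    note dm = reduction_map_mult[OF reduction_map, of x y z w x' y' z' w']
    have "?D = (((mul0 x y z w x' y' z' w') + r * (mul1 x y z w x' y' z' w'))
        - ((x + r * y) * (x' + r * y') + n * ((\<mu> * z + \<nu> * w) * (\<mu> * z' + \<nu> * w'))))
      + \<theta> * ((\<mu> * (mul2 x y z w x' y' z' w') + \<nu> * (mul3 x y z w x' y' z' w'))
        - ((x + r * y) * (\<mu> * z' + \<nu> * w') + (x' + r * y') * (\<mu> * z + \<nu> * w)))
      - ((\<mu> * z + \<nu> * w) * (\<mu> * z' + \<nu> * w')) * (\<theta>\<^sup>2 - n)"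
      unfolding L_def by (simp add: power2_eq_square algebra_simps)
    thus ?thesis using dm \<theta> by (metis dvd_add dvd_diff dvd_mult)
  qed
  have "cong_ideal (\<lambda>x y z w. int p dvd L x y z w) \<in> primes_above quartic_field p"
  proof (rule prime_cong_ideal)
    show "cong_subgroup (\<lambda>x y z w. int p dvd L x y z w)"
      unfolding L_def by (rule cong_subgroup_linear)
    show "\<not> int p dvd L 1 0 0 0" using not_int_p_dvd_1 by (simp add: L_def)
  qed (use dvd_iff_if_dvd_diff[OF mult] in \<open>auto simp: int_p_dvd_mult_iff\<close>)
  thus ?thesis by (simp add: prime_deg1_def L_def)
qed

lemma prime_deg2_above:
  assumes reduction_map: "reduction_map r \<mu> \<nu> n" and n: "\<not> QuadRes (int p) n"
  shows "prime_deg2 r \<mu> \<nu> \<in> primes_above quartic_field p"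
  unfolding prime_deg2_def
proof (rule prime_cong_ideal)
  show "cong_subgroup (\<lambda>x y z w. int p dvd 1 * x + r * y + 0 * z + 0 * w \<and>
     int p dvd 0 * x + 0 * y + \<mu> * z + \<nu> * w)"
    by (intro cong_subgroup_conj cong_subgroup_linear)
  show "\<not> (int p dvd 1 * 1 + r * 0 + 0 * 0 + 0 * 0 \<and> int p dvd 0 * 1 + 0 * 0 + \<mu> * 0 + \<nu> * 0)"
    using not_int_p_dvd_1 by simp
  fix x y z w x' y' z' w'
  note iff = reduction_map_mult[OF reduction_map, of x y z w x' y' z' w', THEN dvd_iff_if_dvd_diff]
  show "int p dvd 1 * mul0 x y z w x' y' z' w' + r * mul1 x y z w x' y' z' w'
            + 0 * mul2 x y z w x' y' z' w' + 0 * mul3 x y z w x' y' z' w' \<and>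
        int p dvd 0 * mul0 x y z w x' y' z' w' + 0 * mul1 x y z w x' y' z' w'
            + \<mu> * mul2 x y z w x' y' z' w' + \<nu> * mul3 x y z w x' y' z' w'"
    if "int p dvd 1 * x' + r * y' + 0 * z' + 0 * w' \<and> int p dvd 0 * x' + 0 * y' + \<mu> * z' + \<nu> * w'"
    using that iff by (simp add: dvd_mult)
  show "(int p dvd 1 * x + r * y + 0 * z + 0 * w \<and> int p dvd 0 * x + 0 * y + \<mu> * z + \<nu> * w) \<or>
        (int p dvd 1 * x' + r * y' + 0 * z' + 0 * w' \<and> int p dvd 0 * x' + 0 * y' + \<mu> * z' + \<nu> * w')"
    if "int p dvd 1 * mul0 x y z w x' y' z' w' + r * mul1 x y z w x' y' z' w'
            + 0 * mul2 x y z w x' y' z' w' + 0 * mul3 x y z w x' y' z' w' \<and>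
        int p dvd 0 * mul0 x y z w x' y' z' w' + 0 * mul1 x y z w x' y' z' w'
            + \<mu> * mul2 x y z w x' y' z' w' + \<nu> * mul3 x y z w x' y' z' w'"
    using norm_form_prime[OF n, of "x + r * y" "x' + r * y'" "\<mu> * z + \<nu> * w" "\<mu> * z' + \<nu> * w'"] that iff
    by simp
qed

lemma ei_in_prime_deg1_iff:
  "ei x y z w \<in> prime_deg1 r \<mu> \<nu> \<theta> \<longleftrightarrow> int p dvd x + r * y + \<theta> * (\<mu> * z + \<nu> * w)"
  unfolding prime_deg1_def cong_ideal_iff[OF cong_subgroup_linear rep_ei] by (simp add: algebra_simps)

lemma ei_in_prime_deg2_iff:
  "ei x y z w \<in> prime_deg2 r \<mu> \<nu> \<longleftrightarrow> int p dvd x + r * y \<and> int p dvd \<mu> * z + \<nu> * w"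
  unfolding prime_deg2_def cong_ideal_iff[OF cong_subgroup_conj[OF cong_subgroup_linear cong_subgroup_linear] rep_ei]
  by simp

lemma conjugate_roots_imp_dvd:
  assumes "\<not> int p dvd r" "int p dvd x + r * y" "int p dvd x - r * y"
  shows "int p dvd x" "int p dvd y"
proof -
  have "int p dvd (x + r * y) + (x - r * y)" using assms(2,3) by (rule dvd_add)
  moreover have "int p dvd (x + r * y) - (x - r * y)" using assms(2,3) by (rule dvd_diff)
  ultimately show "int p dvd x" "int p dvd y"
    using assms(1) int_p_dvd_2_mult_iff[of x] int_p_dvd_2_mult_iff[of "r * y"]
    by (simp_all add: int_p_dvd_mult_iff)
qed

lemma det_imp_dvd:
  assumes "\<not> int p dvd \<mu> * \<nu>' - \<mu>' * \<nu>"
    and 1: "int p dvd \<mu> * z + \<nu> * w" and 2: "int p dvd \<mu>' * z + \<nu>' * w"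
  shows "int p dvd z" "int p dvd w"
proof -
  have "int p dvd \<nu>' * (\<mu> * z + \<nu> * w) - \<nu> * (\<mu>' * z + \<nu>' * w)"
    using 1 2 by (intro dvd_diff dvd_mult)
  moreover have "int p dvd \<mu> * (\<mu>' * z + \<nu>' * w) - \<mu>' * (\<mu> * z + \<nu> * w)"
    using 1 2 by (intro dvd_diff dvd_mult)
  ultimately have "int p dvd (\<mu> * \<nu>' - \<mu>' * \<nu>) * z" "int p dvd (\<mu> * \<nu>' - \<mu>' * \<nu>) * w"
    by (simp_all add: algebra_simps)
  thus "int p dvd z" "int p dvd w" using assms(1) by (simp_all add: int_p_dvd_mult_iff)
qed

text \<open>
  For exponent 1 it is enough to compare the primes and \<open>p \<O>\<close> on integer combinations of the basis.
\<close>

lemma Inter_power_1_split_typeI: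
  assumes "finite \<Q>" "\<Q> \<subseteq> primes_above quartic_field p" "\<Q> \<noteq> {}" "card \<Q> = g"
    and "\<And>x y z w. ei x y z w \<in> \<Inter>\<Q> \<Longrightarrow> int p dvd x \<and> int p dvd y \<and> int p dvd z \<and> int p dvd w"
  shows "split_type quartic_field p g 1"
proof (rule split_typeI[OF assms(1-4)])
  note I = ideal_Inter_primes[OF assms(2)] ideal_Inter_primes_nonempty[OF assms(2,3)]
  have eq: "\<Inter>\<Q> [^]\<^bsub>ideals_set R\<^esub> (1 :: nat) = \<Inter>\<Q>"
    using ideal_power_1[OF I(1)] unfolding I(2) .
  show p: "of_nat p \<in> \<Inter>\<Q> [^]\<^bsub>ideals_set R\<^esub> (1 :: nat)"
    unfolding eq using assms(2) by (auto simp: primes_above_eq)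
  show "\<Inter>\<Q> [^]\<^bsub>ideals_set R\<^esub> (1 :: nat) \<subseteq> ext_ideal quartic_field p"
  proof
    fix s assume "s \<in> \<Inter>\<Q> [^]\<^bsub>ideals_set R\<^esub> (1 :: nat)"
    hence s: "s \<in> \<Inter>\<Q>" unfolding eq .
    have ideal: "ideal (\<Inter>\<Q>) R" using I by simp
    obtain x y z w where r: "rep s x y z w"
      using ideal_closed(1)[OF ideal s] by (rule rep_exists)
    then obtain t where t: "t \<in> \<O>" "s = ei x y z w + of_nat p * t" unfolding rep_def by blast
    have "s - of_nat p * t \<in> \<Inter>\<Q>"
      using p s t(1) unfolding eq by (intro ideal_closed(4,6)[OF ideal])
    hence "ei x y z w \<in> \<Inter>\<Q>" using t(2) by simp
    thus "s \<in> ext_ideal quartic_field p"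
      using assms(5) r unfolding ext_ideal_eq_cong_ideal cong_ideal_def by blast
  qed
qed

text \<open>
  Two reduction maps with \<open>\<delta> \<mapsto> r\<close> and \<open>\<delta> \<mapsto> - r\<close>, and two choices of the square root for each. The
  four kernels meet in \<open>p \<O>\<close>: first both components of each map vanish, then \<open>x, y\<close> because
  \<open>r \<noteq> - r\<close>, and \<open>z, w\<close> because of the determinant.
\<close>

lemma split_type_4_1:
  assumes "reduction_map r \<mu> \<nu> n" "reduction_map (- r) \<mu>' \<nu>' n'"
    and r: "\<not> int p dvd r" and det: "\<not> int p dvd \<mu> * \<nu>' - \<mu>' * \<nu>"
    and "quad_residue p n" "quad_residue p n'"
  shows "split_type quartic_field p 4 1"
proof -
  obtain \<theta> where \<theta>: "int p dvd \<theta>\<^sup>2 - n"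
    using assms(5) by (auto simp: quad_residue_def QuadRes_def cong_iff_dvd_diff)
  obtain \<theta>' where \<theta>': "int p dvd \<theta>'\<^sup>2 - n'"
    using assms(6) by (auto simp: quad_residue_def QuadRes_def cong_iff_dvd_diff)
  have nz: "\<not> int p dvd \<theta>" "\<not> int p dvd \<theta>'"
    using assms(5,6) dvd_iff_if_dvd_diff[OF \<theta>] dvd_iff_if_dvd_diff[OF \<theta>']
    by (auto simp: quad_residue_def int_p_dvd_power2_iff)
  define P where "P = (\<lambda>\<theta>. prime_deg1 r \<mu> \<nu> \<theta>)"
  define P' where "P' = (\<lambda>\<theta>. prime_deg1 (- r) \<mu>' \<nu>' \<theta>)"
  define \<Q> where "\<Q> = {P \<theta>, P (- \<theta>), P' \<theta>', P' (- \<theta>')}"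
  have mem: "ei x y z w \<in> P \<phi> \<longleftrightarrow> int p dvd x + r * y + \<phi> * (\<mu> * z + \<nu> * w)"
      "ei x y z w \<in> P' \<phi> \<longleftrightarrow> int p dvd x - r * y + \<phi> * (\<mu>' * z + \<nu>' * w)" for x y z w \<phi>
    unfolding P_def P'_def ei_in_prime_deg1_iff by simp_all
  have above: "\<Q> \<subseteq> primes_above quartic_field p"
    unfolding \<Q>_def P_def P'_def
    using prime_deg1_above[OF assms(1)] prime_deg1_above[OF assms(2)] \<theta> \<theta>' by simp
  have root: "int p dvd u \<and> int p dvd v"
    if "int p dvd u + \<phi> * v" "int p dvd u + - \<phi> * v" "\<not> int p dvd \<phi>" for u v \<phi>
    using conjugate_roots_imp_dvd[of \<phi> u v] that by simp
  have "P \<phi> \<noteq> P' \<phi>'" for \<phi> \<phi>'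
  proof
    assume "P \<phi> = P' \<phi>'"
    moreover have "ei (- r) 1 0 0 \<in> P \<phi>" unfolding mem by simp
    ultimately have "ei (- r) 1 0 0 \<in> P' \<phi>'" by (rule subst)
    hence "int p dvd - (2 * r)" unfolding mem by simp
    thus False using r by (simp add: int_p_dvd_2_mult_iff)
  qed
  moreover have "P \<theta> \<noteq> P (- \<theta>)"
  proof
    assume eq: "P \<theta> = P (- \<theta>)"
    have "int p dvd \<mu> * z + \<nu> * w" for z w
      using mem(1)[of "- \<theta> * (\<mu> * z + \<nu> * w)" 0 z w \<theta>] mem(1)[of "- \<theta> * (\<mu> * z + \<nu> * w)" 0 z w "- \<theta>"] eq nz
        int_p_dvd_2_mult_iff[of "\<theta> * (\<mu> * z + \<nu> * w)"] by (simp add: int_p_dvd_mult_iff)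
    from this[of 1 0] this[of 0 1] show False using det by simp
  qed
  moreover have "P' \<theta>' \<noteq> P' (- \<theta>')"
  proof
    assume eq: "P' \<theta>' = P' (- \<theta>')"
    have "int p dvd \<mu>' * z + \<nu>' * w" for z w
      using mem(2)[of "- \<theta>' * (\<mu>' * z + \<nu>' * w)" 0 z w \<theta>'] mem(2)[of "- \<theta>' * (\<mu>' * z + \<nu>' * w)" 0 z w "- \<theta>'"] eq nz
        int_p_dvd_2_mult_iff[of "\<theta>' * (\<mu>' * z + \<nu>' * w)"] by (simp add: int_p_dvd_mult_iff)
    from this[of 1 0] this[of 0 1] show False using det by simp
  qed
  ultimately have "card \<Q> = 4" unfolding \<Q>_def by simp
  moreover have "int p dvd x \<and> int p dvd y \<and> int p dvd z \<and> int p dvd w"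
    if s: "ei x y z w \<in> \<Inter>\<Q>" for x y z w
  proof -
    have 1: "int p dvd x + r * y \<and> int p dvd \<mu> * z + \<nu> * w"
      by (rule root[OF _ _ nz(1)]) (use s in \<open>auto simp: \<Q>_def mem\<close>)
    have 2: "int p dvd x - r * y \<and> int p dvd \<mu>' * z + \<nu>' * w"
      by (rule root[OF _ _ nz(2)]) (use s in \<open>auto simp: \<Q>_def mem\<close>)
    show ?thesis using conjugate_roots_imp_dvd[OF r] det_imp_dvd[OF det] 1 2 by blast
  qed
  ultimately show ?thesis
    using Inter_power_1_split_typeI[OF _ above] by (simp add: \<Q>_def)
qed

lemma split_type_2_1:
  assumes "reduction_map r \<mu> \<nu> n" "reduction_map (- r) \<mu>' \<nu>' n'"
    and r: "\<not> int p dvd r" and det: "\<not> int p dvd \<mu> * \<nu>' - \<mu>' * \<nu>"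
    and "\<not> QuadRes (int p) n" "\<not> QuadRes (int p) n'"
  shows "split_type quartic_field p 2 1"
proof -
  define \<Q> where "\<Q> = {prime_deg2 r \<mu> \<nu>, prime_deg2 (- r) \<mu>' \<nu>'}"
  have above: "\<Q> \<subseteq> primes_above quartic_field p"
    unfolding \<Q>_def using prime_deg2_above assms by simp
  have "prime_deg2 r \<mu> \<nu> \<noteq> prime_deg2 (- r) \<mu>' \<nu>'"
  proof
    assume "prime_deg2 r \<mu> \<nu> = prime_deg2 (- r) \<mu>' \<nu>'"
    moreover have "ei (- r) 1 0 0 \<in> prime_deg2 r \<mu> \<nu>" unfolding ei_in_prime_deg2_iff by simp
    ultimately have "ei (- r) 1 0 0 \<in> prime_deg2 (- r) \<mu>' \<nu>'" by (rule subst)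
    hence "int p dvd - (2 * r)" unfolding ei_in_prime_deg2_iff by simp
    thus False using r by (simp add: int_p_dvd_2_mult_iff)
  qed
  hence "card \<Q> = 2" unfolding \<Q>_def by simp
  moreover have "int p dvd x \<and> int p dvd y \<and> int p dvd z \<and> int p dvd w"
    if s: "ei x y z w \<in> \<Inter>\<Q>" for x y z w
  proof -
    have "ei x y z w \<in> prime_deg2 r \<mu> \<nu>" "ei x y z w \<in> prime_deg2 (- r) \<mu>' \<nu>'"
      using s unfolding \<Q>_def by simp_all
    hence 1: "int p dvd x + r * y" "int p dvd x - r * y" "int p dvd \<mu> * z + \<nu> * w" "int p dvd \<mu>' * z + \<nu>' * w"
      unfolding ei_in_prime_deg2_iff by simp_all
    show ?thesis using conjugate_roots_imp_dvd[OF r 1(1,2)] det_imp_dvd[OF det 1(3,4)] by simp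
  qed
  ultimately show ?thesis
    using Inter_power_1_split_typeI[OF _ above] by (simp add: \<Q>_def)
qed

section \<open>Inert and ramified primes\<close>

text \<open>
  The argument for linear independence of the basis, carried out modulo \<open>p\<close>: all it needs is that
  \<open>d\<close> is not a square there. The positivity of \<open>S\<close> is replaced by solving for \<open>w\<^sup>2 - z\<^sup>2\<close>.
\<close>

lemma norm_dvd_imp:
  fixes x y z w :: int
  defines "U \<equiv> x\<^sup>2 + d * y\<^sup>2 - a * d * (z\<^sup>2 + w\<^sup>2)"
    and "V \<equiv> 2 * x * y - a * (b * (w\<^sup>2 - z\<^sup>2) + 2 * c * z * w)"
  assumes a: "\<not> int p dvd a" and d: "\<not> QuadRes (int p) d"
    and norm: "int p dvd U\<^sup>2 - d * V\<^sup>2"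
  shows "int p dvd x \<and> int p dvd y \<and> int p dvd z \<and> int p dvd w"
proof -
  define S where "S = z\<^sup>2 + w\<^sup>2"
  define D where "D = b * (w\<^sup>2 - z\<^sup>2) + 2 * c * z * w"
  define E where "E = c * (w\<^sup>2 - z\<^sup>2) - 2 * b * z * w"
  have "\<not> int p dvd d"
  proof
    assume "int p dvd d"
    hence "QuadRes (int p) d" unfolding QuadRes_def cong_iff_dvd_diff by (intro exI[of _ 0]) simp
    thus False using d by blast
  qed
  have "int p dvd U" "int p dvd V" using norm_form_dvd_imp[OF d norm] .
  have SDE: "d * S\<^sup>2 - D\<^sup>2 = E\<^sup>2"
    unfolding S_def D_def E_def d_eq by (simp add: power2_eq_square algebra_simps)
  have "(x\<^sup>2 - d * y\<^sup>2)\<^sup>2 - d * (a * E)\<^sup>2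
      = (U + a * d * S)\<^sup>2 - d * (V + a * D)\<^sup>2 - a\<^sup>2 * d * (d * S\<^sup>2 - D\<^sup>2)"
    unfolding SDE by (simp add: U_def V_def S_def D_def power2_eq_square algebra_simps)
  also have "\<dots> = U * (U + 2 * a * d * S) - d * V * (V + 2 * a * D)"
    by (simp add: power2_eq_square algebra_simps)
  finally have "int p dvd (x\<^sup>2 - d * y\<^sup>2)\<^sup>2 - d * (a * E)\<^sup>2"
    using \<open>int p dvd U\<close> \<open>int p dvd V\<close> by simp
  note xyE = norm_form_dvd_imp[OF d this]
  note xy = norm_form_dvd_imp[OF d xyE(1)]
  have E: "int p dvd E" using xyE(2) a by (simp add: int_p_dvd_mult_iff)
  have "a * d * S = x\<^sup>2 + d * y\<^sup>2 - U" by (simp add: U_def S_def)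
  hence "int p dvd a * d * S" using xy \<open>int p dvd U\<close> by (simp add: power2_eq_square)
  hence S: "int p dvd S" using a \<open>\<not> int p dvd d\<close> by (simp add: int_p_dvd_mult_iff)
  have "a * D = 2 * x * y - V" by (simp add: V_def D_def)
  hence "int p dvd a * D" using xy \<open>int p dvd V\<close> by simp
  hence D: "int p dvd D" using a by (simp add: int_p_dvd_mult_iff)
  have "d * (w\<^sup>2 - z\<^sup>2) = b * D + c * E"
    unfolding d_eq D_def E_def by (simp add: power2_eq_square algebra_simps)
  hence "int p dvd d * (w\<^sup>2 - z\<^sup>2)" using D E by simp
  hence W: "int p dvd w\<^sup>2 - z\<^sup>2" using \<open>\<not> int p dvd d\<close> by (simp add: int_p_dvd_mult_iff)
  have "int p dvd S + (w\<^sup>2 - z\<^sup>2)" "int p dvd S - (w\<^sup>2 - z\<^sup>2)"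
    using dvd_add[OF S W] dvd_diff[OF S W] .
  hence "int p dvd 2 * w\<^sup>2" "int p dvd 2 * z\<^sup>2" by (simp_all add: S_def)
  thus ?thesis using xy unfolding int_p_dvd_2_mult_iff int_p_dvd_power2_iff by blast
qed

lemma ei_in_ext_ideal_iff:
  "ei x y z w \<in> ext_ideal quartic_field p \<longleftrightarrow>
     int p dvd x \<and> int p dvd y \<and> int p dvd z \<and> int p dvd w"
  unfolding ext_ideal_eq_cong_ideal
  by (rule cong_ideal_iff[OF _ rep_ei]) (intro cong_subgroup_conj cong_subgroup_coordinates)

text \<open>
  If \<open>s\<close> is nonzero modulo \<open>p\<close>, its norm is prime to \<open>p\<close>, so \<open>s\<close> is invertible modulo \<open>p\<close>.
\<close>

lemma split_type_inert:
  assumes a: "\<not> int p dvd a" and d: "\<not> QuadRes (int p) d"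
  shows "split_type quartic_field p 1 1"
proof -
  let ?P = "ext_ideal quartic_field p"
  note I = ideal_closed[OF ideal_ext_ideal]
  have p: "of_nat p \<in> ?P" using ext_ideal_subset_iff[OF ideal_ext_ideal] by simp
  have "primeideal ?P R"
  proof (rule primeideal_intro[OF ideal_ext_ideal])
    have "ei 1 0 0 0 \<notin> ?P" unfolding ei_in_ext_ideal_iff using not_int_p_dvd_1 by simp
    thus "1 \<notin> ?P" by (simp add: el_rat)
    fix s t assume st: "s \<in> \<O>" "t \<in> \<O>" "s * t \<in> ?P"
    show "s \<in> ?P \<or> t \<in> ?P"
    proof (rule disjCI)
      assume "t \<notin> ?P"
      obtain x y z w where r: "rep s x y z w" using st(1) by (rule rep_exists)
      then obtain t0 where t0: "t0 \<in> \<O>" "s = ei x y z w + of_nat p * t0" unfolding rep_def by blast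
      define U where "U = x\<^sup>2 + d * y\<^sup>2 - a * d * (z\<^sup>2 + w\<^sup>2)"
      define V where "V = 2 * x * y - a * (b * (w\<^sup>2 - z\<^sup>2) + 2 * c * z * w)"
      define N where "N = U\<^sup>2 - d * V\<^sup>2"
      define u where "u = ei x y (- z) (- w) * ei U (- V) 0 0"
      have u: "u \<in> \<O>" unfolding u_def by (intro \<O>_closed ei_in_\<O>)
      have xu: "ei x y z w * u = of_int N"
        using el_norm(1)[of "of_int x" "of_int y" "of_int z" "of_int w"]
        by (simp add: u_def U_def V_def N_def of_rat_diff of_rat_mult of_rat_add of_rat_power)
      have "int p dvd N"
      proof (rule ccontr)
        assume "\<not> int p dvd N"
        then obtain i j where ij: "N * i + int p * j = 1" by (rule bezout_int_p)
        have "of_int N * t = (s * t) * u - of_nat p * (t0 * u * t)"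
          unfolding xu[symmetric] t0(2) by (simp add: algebra_simps)
        also have "\<dots> \<in> ?P"
          by (rule I(4)[OF I(6)[OF st(3) u] I(6)[OF p]]) (intro \<O>_closed t0(1) u st(2))
        finally have "of_int N * t \<in> ?P" .
        hence "(of_int N * t) * of_int i + of_nat p * (of_int j * t) \<in> ?P"
          by (rule I(3)[OF I(6) I(6)[OF p]]) (intro \<O>_closed \<O>_of_int st(2))+
        also have "(of_int N * t) * of_int i + of_nat p * (of_int j * t) = of_int (N * i + int p * j) * t"
          by (simp add: algebra_simps)
        finally show False using \<open>t \<notin> ?P\<close> by (simp add: ij)
      qed
      hence "ei x y z w \<in> ?P"
        unfolding ei_in_ext_ideal_iff N_def U_def V_def by (rule norm_dvd_imp[OF a d])
      thus "s \<in> ?P" unfolding t0(2) using p t0(1) by (intro I(3) I(6))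
    qed
  qed
  hence "{?P} \<subseteq> primes_above quartic_field p" using p by (simp add: primes_above_eq)
  thus ?thesis
    by (rule Inter_power_1_split_typeI[rotated]) (auto simp only: ei_in_ext_ideal_iff Inter_insert Inter_empty Int_UNIV_right, simp_all)
qed

text \<open>
  If \<open>p\<close> divides \<open>a\<close>, then \<open>\<beta>\<^sup>2\<close> and \<open>\<gamma>\<^sup>2\<close> vanish modulo \<open>p\<close>; this ideal, generated by \<open>p\<close>, \<open>\<beta>\<close>
  and \<open>\<gamma>\<close>, is then the radical of \<open>p \<O>\<close>.
\<close>

definition ramified_part :: "complex set" where
  "ramified_part = cong_ideal (\<lambda>x y z w. int p dvd x \<and> int p dvd y)"

lemma cong_subgroup_xy: "cong_subgroup (\<lambda>x y z w. int p dvd x \<and> int p dvd y)"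
  by (intro cong_subgroup_conj cong_subgroup_coordinates)

lemma mul_dvd_if_dvd_a:
  assumes "int p dvd a"
  shows "int p dvd mul0 x y z w x' y' z' w' \<longleftrightarrow> int p dvd x * x' + d * (y * y')"
    and "int p dvd mul1 x y z w x' y' z' w' \<longleftrightarrow> int p dvd x * y' + x' * y"
proof -
  have "int p dvd mul0 x y z w x' y' z' w' - (x * x' + d * (y * y'))"
    using assms by (simp add: mul0_def)
  thus "int p dvd mul0 x y z w x' y' z' w' \<longleftrightarrow> int p dvd x * x' + d * (y * y')"
    by (rule dvd_iff_if_dvd_diff)
  have "mul1 x y z w x' y' z' w' - (x * y' + x' * y) = a * (b * (w * w' - z * z') + c * (z * w' + w * z'))"
    by (simp add: mul1_def algebra_simps)
  hence "int p dvd mul1 x y z w x' y' z' w' - (x * y' + x' * y)" using assms by simp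
  thus "int p dvd mul1 x y z w x' y' z' w' \<longleftrightarrow> int p dvd x * y' + x' * y"
    by (rule dvd_iff_if_dvd_diff)
qed

lemma ideal_ramified_part:
  assumes "int p dvd a"
  shows "ideal ramified_part R"
  unfolding ramified_part_def
  by (rule ideal_cong_ideal[OF cong_subgroup_xy]) (simp add: mul_dvd_if_dvd_a[OF assms])

lemma ideal_power_2: "ideal I R \<Longrightarrow> I [^]\<^bsub>ideals_set R\<^esub> (2 :: nat) = ideal_prod R I I"
  using ideals.nat_pow_Suc[of I 1] ideal_power_1[of I] by (simp add: numeral_2_eq_2)

text \<open>
  The square contains \<open>\<beta>\<^sup>2 + \<gamma>\<^sup>2 = 2 a d\<close> and \<open>p\<^sup>2\<close>. As \<open>p\<close> divides \<open>a\<close> exactly once and does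
  not divide \<open>2 d\<close>, their greatest common divisor is \<open>p\<close>.
\<close>

lemma ramified_part_square:
  assumes a: "int p dvd a" and d: "\<not> int p dvd d"
  shows "ramified_part [^]\<^bsub>ideals_set R\<^esub> (2 :: nat) \<subseteq> ext_ideal quartic_field p"
    and "of_nat p \<in> ramified_part [^]\<^bsub>ideals_set R\<^esub> (2 :: nat)"
proof -
  note eq = ideal_power_2[OF ideal_ramified_part[OF a]]
  note I = ideal_closed[OF ideal_power[OF ideal_ramified_part[OF a], of 2]]
  show "ramified_part [^]\<^bsub>ideals_set R\<^esub> (2 :: nat) \<subseteq> ext_ideal quartic_field p"
    unfolding eq unfolding ramified_part_def ext_ideal_eq_cong_ideal
  proof (rule cong_ideal_prod_subset[OF _ _ order_refl])
    show "cong_subgroup (\<lambda>x y z w. int p dvd x \<and> int p dvd y \<and> int p dvd z \<and> int p dvd w)"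
      by (intro cong_subgroup_conj cong_subgroup_coordinates)
  qed (use a in \<open>auto simp: mul_defs\<close>)
  note mem = cong_ideal_iff[OF cong_subgroup_xy rep_ei, folded ramified_part_def]
  have "ei 0 0 1 0 \<in> ramified_part" "ei 0 0 0 1 \<in> ramified_part" unfolding mem by simp_all
  hence "\<beta> ^ 2 \<in> ramified_part [^]\<^bsub>ideals_set R\<^esub> (2 :: nat)" "\<gamma> ^ 2 \<in> ramified_part [^]\<^bsub>ideals_set R\<^esub> (2 :: nat)"
    using power_mem_ideal_power[of _ ramified_part 2] by (simp_all add: el_def)
  hence "\<beta> ^ 2 + \<gamma> ^ 2 \<in> ramified_part [^]\<^bsub>ideals_set R\<^esub> (2 :: nat)" by (rule I(3))
  also have "\<beta> ^ 2 + \<gamma> ^ 2 = of_int (2 * a * d)" by (simp add: power2_eq_square \<beta>\<beta> \<gamma>\<gamma>)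
  finally have 1: "of_int (2 * a * d) \<in> ramified_part [^]\<^bsub>ideals_set R\<^esub> (2 :: nat)" .
  have "ei (int p) 0 0 0 \<in> ramified_part" unfolding mem by simp
  hence 2: "of_nat p ^ 2 \<in> ramified_part [^]\<^bsub>ideals_set R\<^esub> (2 :: nat)"
    using power_mem_ideal_power[of _ ramified_part 2] by (simp add: el_rat)
  obtain k where k: "a = int p * k" using a by (elim dvdE)
  have "\<not> int p dvd k"
  proof
    assume "int p dvd k"
    hence "(int p)\<^sup>2 dvd a" unfolding k power2_eq_square by (intro mult_dvd_mono dvd_refl)
    hence "is_unit (int p)" by (rule squarefreeD[OF squarefree_a])
    thus False using not_int_p_dvd_1 by simp
  qed
  hence "\<not> int p dvd 2 * (k * d)" using d not_int_p_dvd_2 unfolding int_p_dvd_mult_iff by simp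
  then obtain i j where ij: "2 * (k * d) * i + int p * j = 1" by (rule bezout_int_p)
  have "(of_nat p :: complex) = of_int (int p * (2 * (k * d) * i + int p * j))" unfolding ij by simp
  also have "\<dots> = of_int (2 * a * d) * of_int i + of_nat p ^ 2 * of_int j"
    by (simp add: k power2_eq_square algebra_simps)
  also have "\<dots> \<in> ramified_part [^]\<^bsub>ideals_set R\<^esub> (2 :: nat)"
    using 1 2 by (intro I(3) I(6)) auto
  finally show "of_nat p \<in> ramified_part [^]\<^bsub>ideals_set R\<^esub> (2 :: nat)" .
qed

text \<open>
  Modulo \<open>ramified_part\<close> the ring becomes \<open>\<int> / p\<close> with a square root of \<open>d\<close> adjoined.
\<close>

lemma split_type_1_2:
  assumes a: "int p dvd a" and d: "\<not> int p dvd d" and nonres: "\<not> QuadRes (int p) d"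
  shows "split_type quartic_field p 1 2"
proof (rule split_typeI)
  show "{ramified_part} \<subseteq> primes_above quartic_field p"
    unfolding ramified_part_def
  proof (intro subsetI, elim singletonE, hypsubst, rule prime_cong_ideal[OF cong_subgroup_xy])
    show "\<not> (int p dvd 1 \<and> int p dvd 0)" using not_int_p_dvd_1 by simp
  qed (use norm_form_prime[OF nonres] in \<open>auto simp: mul_dvd_if_dvd_a[OF a]\<close>)
qed (use ramified_part_square[OF a d] in auto)

text \<open>
  With \<open>d = r\<^sup>2\<close> modulo \<open>p\<close> the maps \<open>\<delta> \<mapsto> \<plusminus> r\<close>, \<open>\<beta>, \<gamma> \<mapsto> 0\<close> are reduction maps, and
  \<open>ramified_part\<close> is the intersection of their kernels.
\<close>

lemma split_type_2_2:
  assumes a: "int p dvd a" and d: "\<not> int p dvd d" and res: "QuadRes (int p) d"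
  shows "split_type quartic_field p 2 2"
proof -
  obtain r where "int p dvd r\<^sup>2 - d" using res by (auto simp: QuadRes_def cong_iff_dvd_diff)
  hence r: "int p dvd d - r\<^sup>2" by (simp add: dvd_diff_commute)
  have r0: "\<not> int p dvd r" using d dvd_iff_if_dvd_diff[OF r] by (simp add: int_p_dvd_power2_iff)
  have reduction_map: "reduction_map r 0 0 0" "reduction_map (- r) 0 0 0" using a r by (simp_all add: reduction_map_def)
  define \<Q> where "\<Q> = {prime_deg1 r 0 0 0, prime_deg1 (- r) 0 0 0}"
  have above: "\<Q> \<subseteq> primes_above quartic_field p"
    unfolding \<Q>_def using prime_deg1_above[OF reduction_map(1)] prime_deg1_above[OF reduction_map(2)] by simp
  have "prime_deg1 r 0 0 0 \<noteq> prime_deg1 (- r) 0 0 0"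
  proof
    assume "prime_deg1 r 0 0 0 = prime_deg1 (- r) 0 0 0"
    moreover have "ei (- r) 1 0 0 \<in> prime_deg1 r 0 0 0" unfolding ei_in_prime_deg1_iff by simp
    ultimately have "ei (- r) 1 0 0 \<in> prime_deg1 (- r) 0 0 0" by (rule subst)
    hence "int p dvd - (2 * r)" unfolding ei_in_prime_deg1_iff by simp
    thus False using r0 by (simp add: int_p_dvd_2_mult_iff)
  qed
  hence "card \<Q> = 2" unfolding \<Q>_def by simp
  have "\<Inter>\<Q> = ramified_part"
  proof -
    have "s \<in> \<Inter>\<Q> \<longleftrightarrow> s \<in> ramified_part" if s: "s \<in> \<O>" for s
    proof -
      obtain x y z w where r: "rep s x y z w" using s by (rule rep_exists)
      have "s \<in> prime_deg1 r' 0 0 0 \<longleftrightarrow> int p dvd x + r' * y" for r'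
        unfolding prime_deg1_def cong_ideal_iff[OF cong_subgroup_linear r] by simp
      hence "s \<in> \<Inter>\<Q> \<longleftrightarrow> int p dvd x + r * y \<and> int p dvd x - r * y" by (simp add: \<Q>_def)
      also have "\<dots> \<longleftrightarrow> int p dvd x \<and> int p dvd y"
        using conjugate_roots_imp_dvd[OF r0, of x y] by auto
      also have "\<dots> \<longleftrightarrow> s \<in> ramified_part"
        unfolding ramified_part_def cong_ideal_iff[OF cong_subgroup_xy r] ..
      finally show ?thesis .
    qed
    moreover have "\<Inter>\<Q> \<subseteq> \<O>" "ramified_part \<subseteq> \<O>"
      using cong_ideal_subset by (auto simp: \<Q>_def prime_deg1_def ramified_part_def)
    ultimately show ?thesis by blast
  qed
  thus ?thesis
    using ramified_part_square[OF a d] split_typeI[OF _ above _ \<open>card \<Q> = 2\<close>] by (simp add: \<Q>_def)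
qed

text \<open>
  The minimal polynomial of \<open>\<beta>\<close> is Eisenstein at \<open>p\<close>, and \<open>P\<close>, the kernel of \<open>\<delta>, \<beta>, \<gamma> \<mapsto> 0\<close>, is
  the only prime. Modulo \<open>p\<close> the matrix with rows \<open>(c, b)\<close> and \<open>(-b, c)\<close> has determinant
  \<open>d = 0\<close>; the successive powers of \<open>P\<close> are cut out by \<open>x = 0\<close>, then \<open>c z + b w = 0\<close>, then
  \<open>y = 0\<close>, and the fourth power is contained in \<open>p \<O>\<close>. Conversely \<open>\<beta>\<^sup>4\<close> is \<open>p\<close> times an element
  that is prime to \<open>p\<close>, which brings \<open>p\<close> into the fourth power.
\<close>

lemma split_type_1_4:
  assumes d: "int p dvd d"
  shows "split_type quartic_field p 1 4"
proof -
  have c: "\<not> int p dvd c"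
  proof
    assume "int p dvd c"
    hence "int p dvd d - c\<^sup>2" using d by (simp add: power2_eq_square)
    hence "int p dvd b\<^sup>2" by (simp add: d_eq)
    hence "int p dvd b" by (simp add: int_p_dvd_power2_iff)
    hence "(int p)\<^sup>2 dvd d" unfolding d_eq using \<open>int p dvd c\<close>
      by (intro dvd_add) (simp_all add: dvd_power_same)
    hence "is_unit (int p)" by (rule squarefreeD[OF squarefree_d])
    thus False using not_int_p_dvd_1 by simp
  qed
  have a: "\<not> int p dvd a"
  proof
    assume "int p dvd a"
    hence "int p dvd 1" using coprime_a_d d by (metis coprime_common_divisor)
    thus False using not_int_p_dvd_1 by simp
  qed
  have "reduction_map 0 0 0 0" using d by (simp add: reduction_map_def)
  hence above: "prime_deg1 0 0 0 0 \<in> primes_above quartic_field p" by (rule prime_deg1_above) simp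
  define P where "P = cong_ideal (\<lambda>x y z w. int p dvd x)"
  define P2 where "P2 = cong_ideal (\<lambda>x y z w. int p dvd x \<and> int p dvd 0 * x + 0 * y + c * z + b * w)"
  define P3 where "P3 = cong_ideal (\<lambda>x y z w. int p dvd x \<and> int p dvd y \<and> int p dvd 0 * x + 0 * y + c * z + b * w)"
  have P: "P = prime_deg1 0 0 0 0" by (simp add: P_def prime_deg1_def)
  have ideal: "ideal P R" using above by (simp add: P primes_above_eq primeideal_dest)
  have lin: "int p dvd c * mul2 x y z w x' y' z' w' + b * mul3 x y z w x' y' z' w'"
    if "int p dvd x" "int p dvd x'" for x y z w x' y' z' w'
  proof -
    have "c * mul2 x y z w x' y' z' w' + b * mul3 x y z w x' y' z' w'
      = x * (c * z' + b * w') + x' * (c * z + b * w) + d * (y * w' + w * y')"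
      unfolding mul_defs d_eq by (simp add: power2_eq_square algebra_simps)
    thus ?thesis using that d by simp
  qed
  have conj: "int p dvd c * w - b * z" if "int p dvd c * z + b * w" for z w
  proof -
    have "c * (c * w - b * z) = d * w - b * (c * z + b * w)"
      by (simp add: d_eq power2_eq_square algebra_simps)
    hence "int p dvd c * (c * w - b * z)" using that d by simp
    thus ?thesis using c by (simp add: int_p_dvd_mult_iff)
  qed
  have m0: "int p dvd mul0 x y z w x' y' z' w'" if "int p dvd x" for x y z w x' y' z' w'
    using that d by (simp add: mul0_def)
  have m1: "int p dvd mul1 x y z w x' y' z' w'"
    if "int p dvd x" "int p dvd x'" "int p dvd c * z + b * w" for x y z w x' y' z' w'
  proof -
    have "mul1 x y z w x' y' z' w' = x * y' + x' * y + a * w' * (c * z + b * w) + a * z' * (c * w - b * z)"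
      by (simp add: mul1_def algebra_simps)
    thus ?thesis using that conj[OF that(3)] by simp
  qed
  have 2: "ideal_prod R P P \<subseteq> P2"
    unfolding P2_def P_def
  proof (rule cong_ideal_prod_subset[OF _ _ order_refl])
    show "cong_subgroup (\<lambda>x y z w. int p dvd x \<and> int p dvd 0 * x + 0 * y + c * z + b * w)"
      by (intro cong_subgroup_conj cong_subgroup_coordinates cong_subgroup_linear)
  qed (simp add: m0 lin)
  have 3: "ideal_prod R (ideal_prod R P P) P \<subseteq> P3"
    unfolding P3_def P_def
  proof (rule cong_ideal_prod_subset[OF _ _ 2[unfolded P2_def P_def]])
    show "cong_subgroup (\<lambda>x y z w. int p dvd x \<and> int p dvd y \<and> int p dvd 0 * x + 0 * y + c * z + b * w)"
      by (intro cong_subgroup_conj cong_subgroup_coordinates cong_subgroup_linear)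
  qed (simp add: m0 m1 lin)
  have 4: "ideal_prod R (ideal_prod R (ideal_prod R P P) P) P \<subseteq> ext_ideal quartic_field p"
    unfolding ext_ideal_eq_cong_ideal P_def
  proof (rule cong_ideal_prod_subset[OF _ _ 3[unfolded P3_def P_def]])
    show "cong_subgroup (\<lambda>x y z w. int p dvd x \<and> int p dvd y \<and> int p dvd z \<and> int p dvd w)"
      by (intro cong_subgroup_conj cong_subgroup_coordinates)
    fix x y z w x' y' z' w'
    assume q: "int p dvd x \<and> int p dvd y \<and> int p dvd 0 * x + 0 * y + c * z + b * w" "int p dvd x'"
    have "mul2 x y z w x' y' z' w' = x * z' + x' * z + y * (c * w' - b * z') + y' * (c * w - b * z)"
      "mul3 x y z w x' y' z' w' = x * w' + x' * w + y * (c * z' + b * w') + y' * (c * z + b * w)"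
      by (simp_all add: mul_defs algebra_simps)
    thus "int p dvd mul0 x y z w x' y' z' w' \<and> int p dvd mul1 x y z w x' y' z' w' \<and>
        int p dvd mul2 x y z w x' y' z' w' \<and> int p dvd mul3 x y z w x' y' z' w'"
      using q conj[of z w] m0 m1 by simp
  qed
  have pow: "P [^]\<^bsub>ideals_set R\<^esub> (4 :: nat) = ideal_prod R (ideal_prod R (ideal_prod R P P) P) P"
    using ideals.nat_pow_Suc[of P 3] ideals.nat_pow_Suc[of P 2] ideal_power_2[OF ideal]
    by (simp add: eval_nat_numeral)
  note I = ideal_closed[OF ideal_power[OF ideal, of 4]]
  obtain k where k: "d = int p * k" using d by (elim dvdE)
  have "\<not> int p dvd k"
  proof
    assume "int p dvd k"
    hence "(int p)\<^sup>2 dvd d" unfolding k power2_eq_square by (intro mult_dvd_mono dvd_refl)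
    hence "is_unit (int p)" by (rule squarefreeD[OF squarefree_d])
    thus False using not_int_p_dvd_1 by simp
  qed
  define u where "u = a\<^sup>2 * c\<^sup>2 * k"
  have u: "\<not> int p dvd u"
    using \<open>\<not> int p dvd k\<close> a c by (simp add: u_def int_p_dvd_mult_iff int_p_dvd_power2_iff)
  define X0 where "X0 = of_int (2 * a * k) * \<beta>\<^sup>2"
  have \<beta>4: "\<beta> ^ 4 = of_nat p * (X0 - of_int u)"
  proof -
    have "\<beta> ^ 4 = (\<beta> * \<beta>) * (\<beta> * \<beta>)" by (simp add: power4_eq_xxxx mult_ac)
    also have "\<dots> = of_int a * of_int a * (of_int d * of_int d + of_int b * of_int b * (\<delta> * \<delta>) - 2 * of_int d * of_int b * \<delta>)"
      unfolding \<beta>\<beta> by (simp add: algebra_simps)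
    also have "\<dots> = of_int d * (2 * of_int a * (of_int a * of_int d - of_int a * of_int b * \<delta>)
        - of_int a * of_int a * (of_int d - of_int b * of_int b))"
      unfolding \<delta>\<delta> by (simp add: algebra_simps)
    also have "\<dots> = of_int d * (2 * of_int a * \<beta>\<^sup>2 - of_int (a\<^sup>2 * c\<^sup>2))"
      unfolding \<beta>\<beta>[symmetric] by (simp add: d_eq_of_int power2_eq_square)
    finally show ?thesis by (simp add: X0_def u_def k algebra_simps)
  qed
  have "\<beta> \<in> P"
    using cong_ideal_iff[OF cong_subgroup_coordinates(1) rep_ei[of 0 0 1 0]] by (simp add: P_def el_def)
  hence mem1: "\<beta> ^ 4 \<in> P [^]\<^bsub>ideals_set R\<^esub> (4 :: nat)" by (rule power_mem_ideal_power)
  have "of_nat p \<in> P" using above by (simp add: P primes_above_eq)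
  hence mem2: "of_nat p ^ 4 \<in> P [^]\<^bsub>ideals_set R\<^esub> (4 :: nat)" by (rule power_mem_ideal_power)
  have \<beta>O: "\<beta> \<in> \<O>" using ideal_closed(1)[OF ideal \<open>\<beta> \<in> P\<close>] .
  (* a factor that turns X0 - u into u^2: it is - (X0 + u), corrected by a term that cancels X0^2,
     which is a multiple of beta^4 *)
  have Y: "of_int (4 * a\<^sup>2 * k\<^sup>2) * of_nat p - X0 - of_int u \<in> \<O>"
    unfolding X0_def by (intro \<O>_closed \<O>_power \<O>_of_int \<O>_of_nat \<beta>O)
  have XX: "X0 * X0 = of_int (4 * a\<^sup>2 * k\<^sup>2) * \<beta> ^ 4"
    by (simp add: X0_def power2_eq_square power4_eq_xxxx mult_ac)
  have "\<beta> ^ 4 * (of_int (4 * a\<^sup>2 * k\<^sup>2) * of_nat p - X0 - of_int u)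
      = of_nat p * (of_int (4 * a\<^sup>2 * k\<^sup>2) * (of_nat p * (X0 - of_int u))) - of_nat p * (X0 * X0) + of_nat p * of_int (u\<^sup>2)"
    unfolding \<beta>4 by (simp add: power2_eq_square algebra_simps)
  also have "\<dots> = of_nat p * of_int (u\<^sup>2)" unfolding XX \<beta>4[symmetric] by simp
  finally have mem3: "of_nat p * of_int (u\<^sup>2) \<in> P [^]\<^bsub>ideals_set R\<^esub> (4 :: nat)"
    using I(6)[OF mem1 Y] by simp
  have "coprime (int p) (u\<^sup>2)" using u prime_int by (simp add: prime_imp_coprime)
  hence "coprime ((int p) ^ 3) (u\<^sup>2)" by simp
  then obtain i j where ij: "i * (int p) ^ 3 + j * u\<^sup>2 = 1"
    using bezout_int[of "(int p) ^ 3" "u\<^sup>2"] by auto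
  have "(of_nat p :: complex) = of_nat p * of_int (i * (int p) ^ 3 + j * u\<^sup>2)" unfolding ij by simp
  also have "\<dots> = of_nat p ^ 4 * of_int i + of_nat p * of_int (u\<^sup>2) * of_int j"
    by (simp add: power4_eq_xxxx power3_eq_cube algebra_simps)
  also have "\<dots> \<in> P [^]\<^bsub>ideals_set R\<^esub> (4 :: nat)"
    by (intro I(3) I(6)[OF mem2] I(6)[OF mem3] \<O>_of_int)
  finally have "of_nat p \<in> P [^]\<^bsub>ideals_set R\<^esub> (4 :: nat)" .
  thus ?thesis
    using split_typeI[of "{P}" 1 4] above 4 pow by (simp add: P)
qed

section \<open>Unramified primes modulo which \<open>d\<close> is a square\<close>

lemma QuadRes_if_mult_square:
  assumes "QuadRes (int p) n" "\<not> int p dvd n" "int p dvd n * m - k\<^sup>2"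
  shows "QuadRes (int p) m"
proof -
  obtain y where y: "int p dvd y\<^sup>2 - n" using assms(1) by (auto simp: QuadRes_def cong_iff_dvd_diff)
  have "\<not> int p dvd y" using assms(2) dvd_iff_if_dvd_diff[OF y] by (simp add: int_p_dvd_power2_iff)
  then obtain i j where ij: "y * i + int p * j = 1" by (rule bezout_int_p)
  hence yi: "y * i = 1 - int p * j" by simp
  have "(k * i)\<^sup>2 - m = m * ((y * i) * (y * i) - 1) - i\<^sup>2 * (m * (y\<^sup>2 - n) + (n * m - k\<^sup>2))"
    by (simp add: power2_eq_square algebra_simps)
  also have "(y * i) * (y * i) - 1 = int p * (int p * j\<^sup>2 - 2 * j)"
    unfolding yi by (simp add: power2_eq_square algebra_simps)
  also have "m * (int p * (int p * j\<^sup>2 - 2 * j)) - i\<^sup>2 * (m * (y\<^sup>2 - n) + (n * m - k\<^sup>2))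
      = int p * (m * (int p * j\<^sup>2 - 2 * j)) - i\<^sup>2 * (m * (y\<^sup>2 - n) + (n * m - k\<^sup>2))" by simp
  finally have "int p dvd (k * i)\<^sup>2 - m" using y assms(3) by simp
  thus ?thesis unfolding QuadRes_def cong_iff_dvd_diff by blast
qed

lemma quad_residue_if_dvd_diff:
  assumes "quad_residue p x" "int p dvd x - y"
  shows "quad_residue p y"
proof -
  have "\<not> int p dvd y" using assms dvd_iff_if_dvd_diff[OF assms(2)] by (simp add: quad_residue_def)
  moreover have "x * y - y\<^sup>2 = (x - y) * y" by (simp add: power2_eq_square algebra_simps)
  hence "int p dvd x * y - y\<^sup>2" using assms(2) by simp
  hence "QuadRes (int p) y" using assms(1) QuadRes_if_mult_square unfolding quad_residue_def by blast
  ultimately show ?thesis by (simp add: quad_residue_def)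
qed

text \<open>
  The vector \<open>(1, e)\<close> is an eigenvector, for the eigenvalue \<open>r\<close>, of multiplication by \<open>\<delta>\<close> acting on
  the images of \<open>\<beta>\<close> and \<open>\<gamma>\<close>. Normalizing \<open>\<beta> \<mapsto> \<theta>\<close> makes \<open>n\<close> the image of \<open>\<beta>\<^sup>2\<close>.
\<close>

lemma reduction_map_if_not_dvd_c:
  assumes c: "\<not> int p dvd c" and r: "int p dvd d - r\<^sup>2" and e: "int p dvd c * e - (r + b)"
  shows "reduction_map r 1 e (a * d - a * b * r)"
proof -
  define X0 where "X0 = b\<^sup>2 + c\<^sup>2 - r\<^sup>2"
  define Y where "Y = c * e - (r + b)"
  have XY: "int p dvd X0" "int p dvd Y" using r e by (simp_all add: X0_def Y_def d_eq)
  have cancel: "int p dvd c * t \<Longrightarrow> int p dvd t" for t using c by (simp add: int_p_dvd_mult_iff)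
  have eq3: "c * ((c * 1 + b * e) - r * e) = X0 - (r - b) * Y"
    by (simp add: X0_def Y_def power2_eq_square algebra_simps)
  have 3: "int p dvd (c * 1 + b * e) - r * e"
    by (rule cancel, subst eq3) (use XY in simp)
  have eq5: "c * (c * ((a * d + a * b * r) - (a * d - a * b * r) * e\<^sup>2))
      = X0 * (a * (c\<^sup>2 - (r + b)\<^sup>2) + a * r * (r + b)) - Y * ((a * d - a * b * r) * (Y + 2 * (r + b)))"
    unfolding X0_def Y_def d_eq by (simp add: power2_eq_square algebra_simps)
  have 5: "int p dvd (a * d + a * b * r) - (a * d - a * b * r) * e\<^sup>2"
    by (rule cancel, rule cancel, subst eq5) (use XY in simp)
  have eq6: "c * (a * c * r - (a * d - a * b * r) * 1 * e) = X0 * (- (a * b)) - Y * (a * d - a * b * r)"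
    unfolding X0_def Y_def d_eq by (simp add: power2_eq_square algebra_simps)
  have 6: "int p dvd a * c * r - (a * d - a * b * r) * 1 * e"
    by (rule cancel, subst eq6) (use XY in simp)
  have "(c * e - b * 1) - r * 1 = Y" by (simp add: Y_def)
  thus ?thesis unfolding reduction_map_def using r 3 5 6 XY by simp
qed

definition splitting_condition :: bool where
  "splitting_condition \<longleftrightarrow>
     int p dvd b \<and> quad_residue p a \<or>
     int p dvd c \<and> quad_residue p (2 * a) \<or>
     \<not> int p dvd a * b * c * d \<and> quad_residue p d \<and>
       (\<forall>z. [d = z\<^sup>2] (mod int p) \<longrightarrow>
            quad_residue p (a * d + a * b * z) \<and> quad_residue p (a * d - a * b * z))"

text \<open>
  Now \<open>d = b\<^sup>2\<close> modulo \<open>p\<close>. For \<open>\<delta> \<mapsto> b\<close> the number \<open>\<beta>\<^sup>2\<close> vanishes and \<open>\<gamma>\<close> carries the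
  information, for \<open>\<delta> \<mapsto> - b\<close> it is the other way round; in both cases the square that survives is
  \<open>2 a b\<^sup>2\<close>. This is where \<open>2 a\<close> comes from.
\<close>

lemma split_type_if_dvd_c:
  assumes a: "\<not> int p dvd a" and d: "\<not> int p dvd d" and c: "int p dvd c"
  shows "split_type quartic_field p (if splitting_condition then 4 else 2) 1"
proof -
  have b: "\<not> int p dvd b"
  proof
    assume "int p dvd b"
    thus False using c d by (simp add: d_eq power2_eq_square)
  qed
  define n where "n = 2 * a * b\<^sup>2"
  have eqs: "d - b\<^sup>2 = c * c" "a * d - a * b * b = a * c * c" "a * d + a * b * b - n * 1\<^sup>2 = a * c * c"
      "a * d - a * b * (- b) - n * 1\<^sup>2 = a * c * c" "a * d + a * b * (- b) = a * c * c"
    by (simp_all add: d_eq n_def power2_eq_square algebra_simps)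
  have reduction_map: "reduction_map b 0 1 n" "reduction_map (- b) 1 0 n"
    unfolding reduction_map_def using c eqs by simp_all
  have det: "\<not> int p dvd 0 * 0 - 1 * 1" using not_int_p_dvd_1 by simp
  have n: "\<not> int p dvd n" "\<not> int p dvd 2 * a"
    using a b by (simp_all add: n_def mult.assoc not_int_p_dvd_2 int_p_dvd_mult_iff int_p_dvd_power2_iff)
  have "n * (2 * a) - (2 * a * b)\<^sup>2 = 0" by (simp add: n_def power2_eq_square)
  hence "int p dvd n * (2 * a) - (2 * a * b)\<^sup>2" "int p dvd (2 * a) * n - (2 * a * b)\<^sup>2"
    by (simp_all add: mult.commute)
  hence "QuadRes (int p) n \<longleftrightarrow> QuadRes (int p) (2 * a)"
    using QuadRes_if_mult_square n by blast
  moreover have "splitting_condition \<longleftrightarrow> QuadRes (int p) (2 * a)"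
    using b c n by (simp add: splitting_condition_def quad_residue_def)
  ultimately have "splitting_condition \<longleftrightarrow> QuadRes (int p) n" by simp
  thus ?thesis
    using split_type_4_1[OF reduction_map b det] split_type_2_1[OF reduction_map b det] n
    by (simp add: quad_residue_def)
qed

text \<open>
  The images \<open>n\<close> and \<open>n'\<close> of \<open>\<beta>\<^sup>2\<close> under \<open>\<delta> \<mapsto> \<plusminus> r\<close> have the product \<open>(a c r)\<^sup>2\<close>, so they are squares
  or non-squares together. If \<open>p\<close> divides \<open>b\<close>, both are \<open>a c\<^sup>2\<close> modulo \<open>p\<close>, which explains the
  condition on \<open>a\<close> alone.
\<close>

lemma split_type_if_not_dvd_c:
  assumes a: "\<not> int p dvd a" and d: "\<not> int p dvd d" and c: "\<not> int p dvd c" and res: "QuadRes (int p) d"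
  shows "split_type quartic_field p (if splitting_condition then 4 else 2) 1"
proof -
  obtain r where "int p dvd r\<^sup>2 - d" using res by (auto simp: QuadRes_def cong_iff_dvd_diff)
  hence r: "int p dvd d - r\<^sup>2" "int p dvd d - (- r)\<^sup>2" by (simp_all add: dvd_diff_commute)
  have r0: "\<not> int p dvd r" using d dvd_iff_if_dvd_diff[OF r(1)] by (simp add: int_p_dvd_power2_iff)
  obtain i j where ij: "c * i + int p * j = 1" using c by (rule bezout_int_p)
  have inv: "int p dvd c * (i * t) - t" for t
  proof -
    have "c * (i * t) - t = (c * i + int p * j) * t - int p * j * t - t" by (simp add: algebra_simps)
    also have "\<dots> = int p * (- j * t)" unfolding ij by simp
    finally show ?thesis by simp
  qed
  define e where "e = i * (r + b)"
  define e' where "e' = i * (- r + b)"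
  define n where "n = a * d - a * b * r"
  define n' where "n' = a * d - a * b * (- r)"
  have reduction_map: "reduction_map r 1 e n" "reduction_map (- r) 1 e' n'"
    unfolding n_def n'_def e_def e'_def using reduction_map_if_not_dvd_c[OF c _ inv] r by blast+
  have det: "\<not> int p dvd 1 * e' - 1 * e"
  proof
    assume "int p dvd 1 * e' - 1 * e"
    hence 1: "int p dvd c * (e' - e)" by simp
    have "int p dvd (c * e' - (- r + b)) - (c * e - (r + b))"
      unfolding e_def e'_def by (rule dvd_diff[OF inv inv])
    hence "int p dvd c * (e' - e) - ((c * e' - (- r + b)) - (c * e - (r + b)))"
      by (rule dvd_diff[OF 1])
    hence "int p dvd - (2 * r)" by (simp add: algebra_simps)
    thus False using r0 by (simp add: int_p_dvd_2_mult_iff)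
  qed
  have "n * n' - (a * c * r)\<^sup>2 = a\<^sup>2 * d * (d - r\<^sup>2)"
    unfolding n_def n'_def d_eq by (simp add: power2_eq_square algebra_simps)
  hence sq: "int p dvd n * n' - (a * c * r)\<^sup>2" "int p dvd n' * n - (a * c * r)\<^sup>2"
    using r(1) by (simp_all add: mult.commute)
  have "\<not> int p dvd n * n'"
    using dvd_iff_if_dvd_diff[OF sq(1)] a c r0 by (simp add: int_p_dvd_mult_iff int_p_dvd_power2_iff)
  hence n: "\<not> int p dvd n" "\<not> int p dvd n'" by auto
  have nn': "QuadRes (int p) n \<longleftrightarrow> QuadRes (int p) n'"
    using QuadRes_if_mult_square sq n by blast
  have "splitting_condition \<longleftrightarrow> QuadRes (int p) n"
  proof (cases "int p dvd b")
    case True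
    have "n * a - (a * c)\<^sup>2 = b * (a\<^sup>2 * (b - r))"
      unfolding n_def d_eq by (simp add: power2_eq_square algebra_simps)
    hence "int p dvd n * a - (a * c)\<^sup>2" "int p dvd a * n - (a * c)\<^sup>2"
      using True by (simp_all add: mult.commute)
    hence "QuadRes (int p) n \<longleftrightarrow> QuadRes (int p) a" using QuadRes_if_mult_square n a by blast
    thus ?thesis using True c a by (simp add: splitting_condition_def quad_residue_def)
  next
    case False
    hence cond: "splitting_condition \<longleftrightarrow> (\<forall>z. [d = z\<^sup>2] (mod int p) \<longrightarrow>
        quad_residue p (a * d + a * b * z) \<and> quad_residue p (a * d - a * b * z))"
      using a c d res by (simp add: splitting_condition_def quad_residue_def int_p_dvd_mult_iff)
    show ?thesis
    proof
      assume splitting_condition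
      moreover have "[d = r\<^sup>2] (mod int p)" using r(1) by (simp add: cong_iff_dvd_diff)
      ultimately show "QuadRes (int p) n" unfolding cond by (simp add: quad_residue_def n_def)
    next
      assume "QuadRes (int p) n"
      hence q: "quad_residue p n" "quad_residue p n'" using nn' n by (simp_all add: quad_residue_def)
      show splitting_condition
        unfolding cond
      proof (intro allI impI)
        fix z assume "[d = z\<^sup>2] (mod int p)"
        hence "int p dvd d - z\<^sup>2" by (simp add: cong_iff_dvd_diff)
        hence "int p dvd (d - z\<^sup>2) - (d - r\<^sup>2)" using r(1) by (rule dvd_diff)
        hence "int p dvd (r - z) * (r + z)" by (simp add: power2_eq_square algebra_simps)
        hence "int p dvd r - z \<or> int p dvd r + z" by (simp add: int_p_dvd_mult_iff)
        thus "quad_residue p (a * d + a * b * z) \<and> quad_residue p (a * d - a * b * z)"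
        proof
          assume z: "int p dvd r - z"
          have "n' - (a * d + a * b * z) = a * b * (r - z)" "n - (a * d - a * b * z) = - (a * b) * (r - z)"
            by (simp_all add: n_def n'_def algebra_simps)
          hence "int p dvd n' - (a * d + a * b * z)" "int p dvd n - (a * d - a * b * z)"
            using z by (simp_all only: dvd_mult)
          thus ?thesis using quad_residue_if_dvd_diff q by blast
        next
          assume z: "int p dvd r + z"
          have "n - (a * d + a * b * z) = - (a * b) * (r + z)" "n' - (a * d - a * b * z) = a * b * (r + z)"
            by (simp_all add: n_def n'_def algebra_simps)
          hence "int p dvd n - (a * d + a * b * z)" "int p dvd n' - (a * d - a * b * z)"
            using z by (simp_all only: dvd_mult)
          thus ?thesis using quad_residue_if_dvd_diff q by blast
        qed
      qed
    qed
  qed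
  thus ?thesis
    using split_type_4_1[OF reduction_map r0 det] split_type_2_1[OF reduction_map r0 det] n nn'
    by (simp add: quad_residue_def)
qed

text \<open>
  If \<open>p\<close> divides \<open>b\<close> or \<open>c\<close>, then \<open>d\<close> is the square of the other one modulo \<open>p\<close>, and \<open>p\<close> does not
  divide \<open>d\<close> because \<open>d\<close> is squarefree.
\<close>

lemma splitting_condition_imp:
  assumes splitting_condition
  shows "\<not> int p dvd a" "\<not> int p dvd d" "QuadRes (int p) d"
proof -
  have two: "\<not> int p dvd a" if "quad_residue p (2 * a)"
    using that by (simp add: quad_residue_def int_p_dvd_2_mult_iff)
  show a: "\<not> int p dvd a"
    using assms two by (auto simp: splitting_condition_def quad_residue_def)
  have sq: "\<not> int p dvd d \<and> QuadRes (int p) d" if "int p dvd d - t\<^sup>2" "d = t\<^sup>2 + s\<^sup>2" "int p dvd s" for s t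
  proof -
    have "\<not> int p dvd d"
    proof
      assume "int p dvd d"
      hence "int p dvd t\<^sup>2" using dvd_iff_if_dvd_diff[OF that(1)] by simp
      hence "(int p)\<^sup>2 dvd d" unfolding that(2) using that(3)
        by (intro dvd_add) (simp_all add: int_p_dvd_power2_iff dvd_power_same)
      hence "is_unit (int p)" by (rule squarefreeD[OF squarefree_d])
      thus False using not_int_p_dvd_1 by simp
    qed
    moreover have "QuadRes (int p) d"
      unfolding QuadRes_def cong_iff_dvd_diff using that(1) by (intro exI[of _ t]) (simp add: dvd_diff_commute)
    ultimately show ?thesis by blast
  qed
  have b: "\<not> int p dvd d \<and> QuadRes (int p) d" if "int p dvd b"
    using sq[of c b] that by (simp add: d_eq power2_eq_square)
  have c: "\<not> int p dvd d \<and> QuadRes (int p) d" if "int p dvd c"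
    using sq[of b c] that by (simp add: d_eq power2_eq_square)
  have "\<not> int p dvd d \<and> QuadRes (int p) d"
    using assms b c by (auto simp: splitting_condition_def quad_residue_def)
  thus "\<not> int p dvd d" "QuadRes (int p) d" by blast+
qed

lemma not_QuadRes_imp_not_dvd:
  assumes "\<not> QuadRes (int p) d"
  shows "\<not> int p dvd b" "\<not> int p dvd c" "\<not> int p dvd d"
proof -
  have "QuadRes (int p) d" if "int p dvd t - d" "t = s\<^sup>2" for s t
    unfolding QuadRes_def cong_iff_dvd_diff using that by blast
  note res = this[of "c\<^sup>2" c] this[of "b\<^sup>2" b] this[of 0 0]
  show "\<not> int p dvd b"
  proof
    assume "int p dvd b"
    hence "int p dvd c\<^sup>2 - d" by (simp add: d_eq power2_eq_square)
    thus False using assms res(1) by simp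
  qed
  show "\<not> int p dvd c"
  proof
    assume "int p dvd c"
    hence "int p dvd b\<^sup>2 - d" by (simp add: d_eq power2_eq_square)
    thus False using assms res(2) by simp
  qed
  show "\<not> int p dvd d" using assms res(3) by auto
qed

section \<open>The decomposition law\<close>

theorem decomposition:
  shows "int p dvd d \<Longrightarrow> split_type quartic_field p 1 4"
    and "int p dvd a \<Longrightarrow> quad_nonresidue p d \<Longrightarrow> split_type quartic_field p 1 2"
    and "int p dvd a \<Longrightarrow> quad_residue p d \<Longrightarrow> split_type quartic_field p 2 2"
    and "\<not> int p dvd a * b * c * d \<Longrightarrow> quad_nonresidue p d \<Longrightarrow> split_type quartic_field p 1 1"
    and "splitting_condition \<Longrightarrow> split_type quartic_field p 4 1"
    and "\<not> int p dvd d \<Longrightarrow> \<not> (int p dvd a \<and> quad_nonresidue p d) \<Longrightarrow>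
      \<not> (int p dvd a \<and> quad_residue p d) \<Longrightarrow> \<not> (\<not> int p dvd a * b * c * d \<and> quad_nonresidue p d) \<Longrightarrow>
      \<not> splitting_condition \<Longrightarrow> split_type quartic_field p 2 1"
proof -
  show "int p dvd d \<Longrightarrow> split_type quartic_field p 1 4" by (rule split_type_1_4)
  show "int p dvd a \<Longrightarrow> quad_nonresidue p d \<Longrightarrow> split_type quartic_field p 1 2"
    by (rule split_type_1_2) (simp_all add: quad_nonresidue_def)
  show "int p dvd a \<Longrightarrow> quad_residue p d \<Longrightarrow> split_type quartic_field p 2 2"
    by (rule split_type_2_2) (simp_all add: quad_residue_def)
  show "\<not> int p dvd a * b * c * d \<Longrightarrow> quad_nonresidue p d \<Longrightarrow> split_type quartic_field p 1 1"
    by (rule split_type_inert) (auto simp: quad_nonresidue_def)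
  have split: "split_type quartic_field p (if splitting_condition then 4 else 2) 1"
    if "\<not> int p dvd a" "\<not> int p dvd d" "QuadRes (int p) d"
    using split_type_if_dvd_c split_type_if_not_dvd_c that by blast
  show "splitting_condition \<Longrightarrow> split_type quartic_field p 4 1"
    using split[OF splitting_condition_imp] by simp
  show "split_type quartic_field p 2 1"
    if h: "\<not> int p dvd d" "\<not> (int p dvd a \<and> quad_nonresidue p d)"
      "\<not> (int p dvd a \<and> quad_residue p d)" "\<not> (\<not> int p dvd a * b * c * d \<and> quad_nonresidue p d)"
      "\<not> splitting_condition"
  proof -
    have a: "\<not> int p dvd a" using h by (auto simp: quad_residue_def quad_nonresidue_def)
    have "QuadRes (int p) d"
    proof (rule ccontr)
      assume nonres: "\<not> QuadRes (int p) d"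
      hence "\<not> int p dvd a * b * c * d"
        using a not_QuadRes_imp_not_dvd by (simp add: int_p_dvd_mult_iff)
      thus False using h(1,4) nonres by (simp add: quad_nonresidue_def)
    qed
    thus ?thesis using split[OF a h(1)] h(5) by simp
  qed
qed

lemma split_type_eq_iff:
  assumes "split_type quartic_field p g e" "g > 0"
  shows "split_type quartic_field p g' e' \<longleftrightarrow> g' = g \<and> e' = e"
  using split_type_unique[OF assms(1) _ assms(2)] assms(1) by blast

text \<open>
  The cases of \<open>decomposition\<close> are exhaustive, and their splitting types are pairwise distinct.
\<close>

theorem decomposition_iff:
  shows "split_type quartic_field p 1 4 \<longleftrightarrow> int p dvd d"
    and "split_type quartic_field p 1 2 \<longleftrightarrow> int p dvd a \<and> quad_nonresidue p d"
    and "split_type quartic_field p 2 2 \<longleftrightarrow> int p dvd a \<and> quad_residue p d"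
    and "split_type quartic_field p 1 1 \<longleftrightarrow> \<not> int p dvd a * b * c * d \<and> quad_nonresidue p d"
    and "split_type quartic_field p 4 1 \<longleftrightarrow> splitting_condition"
proof -
  consider "int p dvd d" | "int p dvd a" "quad_nonresidue p d" | "int p dvd a" "quad_residue p d"
    | "\<not> int p dvd a * b * c * d" "quad_nonresidue p d" | splitting_condition
    | "\<not> int p dvd d" "\<not> (int p dvd a \<and> quad_nonresidue p d)"
      "\<not> (int p dvd a \<and> quad_residue p d)" "\<not> (\<not> int p dvd a * b * c * d \<and> quad_nonresidue p d)"
      "\<not> splitting_condition"
    by blast
  hence "(split_type quartic_field p 1 4 \<longrightarrow> int p dvd d) \<and>
    (split_type quartic_field p 1 2 \<longrightarrow> int p dvd a \<and> quad_nonresidue p d) \<and>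
    (split_type quartic_field p 2 2 \<longrightarrow> int p dvd a \<and> quad_residue p d) \<and>
    (split_type quartic_field p 1 1 \<longrightarrow> \<not> int p dvd a * b * c * d \<and> quad_nonresidue p d) \<and>
    (split_type quartic_field p 4 1 \<longrightarrow> splitting_condition)"
  proof cases
    case 1
    thus ?thesis using split_type_eq_iff[OF decomposition(1)] by simp
  next
    case 2
    thus ?thesis using split_type_eq_iff[OF decomposition(2)] by simp
  next
    case 3
    thus ?thesis using split_type_eq_iff[OF decomposition(3)] by simp
  next
    case 4
    thus ?thesis using split_type_eq_iff[OF decomposition(4)] by simp
  next
    case 5
    thus ?thesis using split_type_eq_iff[OF decomposition(5)] by simp
  next
    case 6
    show ?thesis using split_type_eq_iff[OF decomposition(6)[OF 6]] by simp
  qed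
  with decomposition(1-5)
  show "split_type quartic_field p 1 4 \<longleftrightarrow> int p dvd d"
    and "split_type quartic_field p 1 2 \<longleftrightarrow> int p dvd a \<and> quad_nonresidue p d"
    and "split_type quartic_field p 2 2 \<longleftrightarrow> int p dvd a \<and> quad_residue p d"
    and "split_type quartic_field p 1 1 \<longleftrightarrow> \<not> int p dvd a * b * c * d \<and> quad_nonresidue p d"
    and "split_type quartic_field p 4 1 \<longleftrightarrow> splitting_condition"
    by blast+
qed

end

theorem theorem4p18:
  fixes a b c d :: int and p :: nat and F :: "complex set" and OF :: "complex ring"
  assumes "squarefree a" and "odd a"
    and "d = b\<^sup>2 + c\<^sup>2" and "squarefree d"
    and "b > 0" and "c > 0"
    and "gcd a d = 1"
    and F: "F = cyclic_quartic_field a b d"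
    and OF: "OF = ring_of_integers F"
    and "Factorial_Ring.prime p" and "odd p"
  shows
    "(totally_ramified F p \<longleftrightarrow> int p dvd d) \<and>
     ((\<exists>P. primes_above F p = {P} \<and>
           ext_ideal F p = P [^]\<^bsub>ideals_set OF\<^esub> (2::nat))
        \<longleftrightarrow> int p dvd a \<and> quad_nonresidue p d) \<and>
     ((\<exists>P1 P2. P1 \<noteq> P2 \<and> primes_above F p = {P1, P2} \<and>
           ext_ideal F p =
             P1 [^]\<^bsub>ideals_set OF\<^esub> (2::nat) \<otimes>\<^bsub>ideals_set OF\<^esub> P2 [^]\<^bsub>ideals_set OF\<^esub> (2::nat))
        \<longleftrightarrow> int p dvd a \<and> quad_residue p d) \<and>
     (inert F p \<longleftrightarrow> \<not> int p dvd a * b * c * d \<and> quad_nonresidue p d) \<and>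
     (splits_totally F p \<longleftrightarrow>
        int p dvd b \<and> quad_residue p a \<or>
        int p dvd c \<and> quad_residue p (2 * a) \<or>
        \<not> int p dvd a * b * c * d \<and> quad_residue p d \<and>
          (\<forall>z. [d = z\<^sup>2] (mod int p) \<longrightarrow>
               quad_residue p (a * d + a * b * z) \<and> quad_residue p (a * d - a * b * z))) \<and>
     (\<not> int p dvd d \<and>
      \<not> (int p dvd a \<and> quad_nonresidue p d) \<and>
      \<not> (int p dvd a \<and> quad_residue p d) \<and>
      \<not> (\<not> int p dvd a * b * c * d \<and> quad_nonresidue p d) \<and>
      \<not> (int p dvd b \<and> quad_residue p a \<or>
         int p dvd c \<and> quad_residue p (2 * a) \<or>
         \<not> int p dvd a * b * c * d \<and> quad_residue p d \<and>
           (\<forall>z. [d = z\<^sup>2] (mod int p) \<longrightarrow>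
                quad_residue p (a * d + a * b * z) \<and> quad_residue p (a * d - a * b * z)))
      \<longrightarrow> (\<exists>P1 P2. primeideal P1 OF \<and> primeideal P2 OF \<and> P1 \<noteq> P2 \<and>
             ext_ideal F p = P1 \<otimes>\<^bsub>ideals_set OF\<^esub> P2))"
proof -
  define \<delta> where "\<delta> = complex_of_real (sqrt (real_of_int d))"
  define \<beta> where "\<beta> = csqrt (complex_of_real
       (real_of_int a * (real_of_int d - real_of_int b * sqrt (real_of_int d))))"
  define \<gamma> where "\<gamma> = \<beta> * (\<delta> + of_int b) / of_int c"
  have "d > 0" using assms by (simp add: add_pos_pos)
  interpret cyclic_quartic_at_prime a b c d \<delta> \<beta> \<gamma> p
  proof
    show "coprime a d" using assms by (simp add: coprime_iff_gcd_eq_1)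
    show "\<delta>\<^sup>2 = of_int d"
      using \<open>d > 0\<close> by (simp add: \<delta>_def flip: of_real_power)
    show "\<beta>\<^sup>2 = of_int (a * d) - of_int (a * b) * \<delta>"
      by (simp add: \<beta>_def \<delta>_def algebra_simps)
    show "of_int c * \<gamma> = \<beta> * (\<delta> + of_int b)"
      using assms by (simp add: \<gamma>_def)
  qed (use assms in auto)
  have F_eq: "F = quartic_field"
    unfolding F cyclic_quartic_field_def \<beta>_def[symmetric] by (rule adjoin_\<beta>_eq)
  have degree: "field_degree quartic_field = 4" by (rule field_degree_quartic_field)
  have "totally_ramified quartic_field p \<longleftrightarrow> int p dvd d"
    using totally_ramified_iff decomposition_iff(1) unfolding degree by simp
  moreover have "splits_totally quartic_field p \<longleftrightarrow> splitting_condition"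
    using splits_totally_iff decomposition_iff(5) unfolding degree by simp
  moreover have "inert quartic_field p \<longleftrightarrow> \<not> int p dvd a * b * c * d \<and> quad_nonresidue p d"
    unfolding inert_iff by (rule decomposition_iff(4))
  ultimately show ?thesis
    unfolding OF F_eq splitting_condition_def[symmetric] one_prime_square_iff[symmetric]
      two_primes_square_iff[symmetric] decomposition_iff(2,3)
    using split_type_2_1_imp_two_primes[OF decomposition(6)] by blast
qed

end
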